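(* Let $K$, $L$ be two convex bodies in $\mathbb{R}^n$ that contain $0$ in their interior. For every $i\in\{1,\dots,n-1\}$, $p\ge0$ and $\lambda\in(0,1)$, $$W_i\Big(\big[\lambda\cdot K+_p(1-\lambda)\cdot L\big]^{\circ}\Big)\ \le\ W_i(K^{\circ})^{\lambda}\,W_i(L^{\circ})^{1-\lambda}.$$
   Context: A convex body in $\mathbb{R}^n$ is a compact convex set with non-empty interior. Support function: $h_K(u)=\max_{y\in K}u\cdot y$; polar body: $K^{\circ}=\{x: x\cdot y\le 1\ \forall y\in K\}$. For convex bodies $K,L$ containing the origin in their interiors and $\lambda\in(0,1)$: for $p>0$, $$\lambda\cdot K+_p(1-\lambda)\cdot L=\{x : x\cdot u\le[\lambda h_K(u)^p+(1-\lambda)h_L(u)^p]^{1/p}\ \text{for all } u\in S^{n-1}\},$$ and for $p=0$, $$\lambda\cdot K+_0(1-\lambda)\cdot L=\{x : x\cdot u\le h_K(u)^{\lambda}h_L(u)^{1-\lambda}\ \text{for all } u\in S^{n-1}\}.$$ The quermassintegrals $W_i(K)$, $i=0,\dots,n$, are defined by the Steiner formula $|K+tB_2^n|=\sum_{i=0}^n\binom{n}{i}W_i(K)t^i$, $t>0$, where $B_2^n$ is the Euclidean unit ball and $|\cdot|$ is Lebesgue measure. *)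

theory Defs
  imports "HOL-Analysis.Analysis"
begin

definition convex_body :: "'a::euclidean_space set \<Rightarrow> bool" where
  "convex_body K \<longleftrightarrow> compact K \<and> convex K \<and> interior K \<noteq> {}"

(* For a nonempty compact K the supremum is attained, so it is the maximum. *)
definition support_function :: "'a::euclidean_space set \<Rightarrow> 'a \<Rightarrow> real" where
  "support_function K u = (SUP y\<in>K. u \<bullet> y)"

definition polar_body :: "'a::euclidean_space set \<Rightarrow> 'a set" where
  "polar_body K = {x. \<forall>y\<in>K. x \<bullet> y \<le> 1}"

(* Lp_combination p l K L is l . K +_p (1 - l) . L. When 0 is an interior point of
   K and L, both support functions are positive on the unit sphere, so powr is the
   usual real power of positive numbers. *)
definition Lp_combination ::
    "real \<Rightarrow> real \<Rightarrow> 'a::euclidean_space set \<Rightarrow> 'a set \<Rightarrow> 'a set" where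
  "Lp_combination p l K L =
     (if p = 0
      then {x. \<forall>u\<in>sphere 0 1.
              x \<bullet> u \<le> support_function K u powr l * support_function L u powr (1 - l)}
      else {x. \<forall>u\<in>sphere 0 1.
              x \<bullet> u \<le> (l * support_function K u powr p
                     + (1 - l) * support_function L u powr p) powr (1 / p)})"

definition outer_parallel :: "'a::euclidean_space set \<Rightarrow> real \<Rightarrow> 'a set" where
  "outer_parallel K t = {x + t *\<^sub>R b | x b. x \<in> K \<and> b \<in> cball 0 1}"

(* The Steiner formula determines W only at indices up to the dimension; W is set to 0
   beyond that so that the description by THE is of a unique sequence. *)
definition quermassintegral :: "nat \<Rightarrow> 'a::euclidean_space set \<Rightarrow> real" where
  "quermassintegral i K =
     (THE W :: nat \<Rightarrow> real.
        (\<forall>t>0. measure lebesgue (outer_parallel K t)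
                = (\<Sum>j=0..DIM('a). real (DIM('a) choose j) * W j * t ^ j)) \<and>
        (\<forall>j>DIM('a). W j = 0)) i"

end

theory Submission
  imports Defs "HOL-Computational_Algebra.Polynomial"
begin

text \<open>Write $A = K^\circ$, $B = L^\circ$ and let $C$ be the polar of the combination. The radial function
  of $K^\circ$ is $1/h_K$, and $\lambda\cdot K +_p (1-\lambda)\cdot L$ increases with $p$, so $C$ lies in the
  closed convex hull of the radial geometric mean of $A$ and $B$.

  For a polytope with vertices $c_k u_k$, $c_k = a_k^\lambda b_k^{1-\lambda}$, $a_k u_k \in A$,
  $b_k u_k \in B$, triangulate its boundary (generically, after perturbing the $c_k$). It is then the
  union of simplices conv$(0, c_k u_k : k \in I)$ lying in non-overlapping cones, and the simplices
  conv$(0, a_k u_k : k \in I)$ lie in $A$. The volume of a simplex is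
  multiplicative in the $c_k$, so Hoelder's inequality gives $|C| \le |A|^\lambda |B|^{1-\lambda}$. The same
  argument works modulo a subspace spanned by vectors $v_j$, with prisms instead of simplices.

  If $Z$ is a sum of segments $[0, v_j]$, then $|K + tZ|$ is a polynomial in $t$, since the volume of
  $K + s[0,v]$ is affine in $s$; its coefficients are sums over sets $S$ of volumes of $K$ modulo
  span$(v_j : j \in S)$, to which the argument above and Hoelder's inequality apply. Approximating the
  ball by such zonotopes yields the Steiner polynomial together with the inequality between its
  coefficients.\<close>

section \<open>Linear images of Lebesgue measure\<close>

text \<open>The volume of a body modulo a subspace has to be expressed without quotients or
  projections. Here it is a growth rate: for independent V, the volume of K plus the parallelotope
  on the vectors \<open>\<tau>\<close> V, divided by \<open>\<tau> ^ card V\<close>, tends to it as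
  \<open>\<tau>\<close> grows, up to a factor depending on V only. A bounded overhang of the prisms
  disappears in this limit, so for C a covering with a fixed error suffices, while for A and B there
  is a plain inclusion. The triangulation is not built geometrically. Its simplices are the optimal
  bases of a linear program: the covering is existence of an optimum, the disjointness of the cones
  is its uniqueness, and the perturbation of the weights secures this uniqueness. The inequality is
  available only between coefficients for the same zonotope, so the zonotopes are chosen before the
  bodies. Pointwise convergence of polynomials of bounded degree then gives convergence of their
  coefficients, so that Steiner's formula is a conclusion and not an input.\<close>

abbreviation vol :: "'a::euclidean_space set \<Rightarrow> real" where
  "vol \<equiv> measure lebesgue"

lemma nn_integral_lborel_shift:
  fixes f :: "'a::euclidean_space \<Rightarrow> ennreal"
  assumes [measurable]: "f \<in> borel_measurable borel"
  shows "(\<integral>\<^sup>+x. f (c + x) \<partial>lborel) = (\<integral>\<^sup>+x. f x \<partial>lborel)"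
proof -
  have "(\<integral>\<^sup>+x. f x \<partial>lborel) = (\<integral>\<^sup>+x. f x \<partial>distr lborel borel ((+) c))"
    by (simp add: lborel_distr_plus)
  also have "\<dots> = (\<integral>\<^sup>+x. f (c + x) \<partial>lborel)"
    by (subst nn_integral_distr) auto
  finally show ?thesis by simp
qed

lemma linear_image_borel:
  fixes T :: "'a::euclidean_space \<Rightarrow> 'a"
  assumes "linear T" "inj T" "X \<in> sets borel"
  shows "T ` X \<in> sets borel"
proof -
  obtain S where S: "linear S" "\<And>x. S (T x) = x" "\<And>x. T (S x) = x"
    using linear_injective_isomorphism[OF assms(1,2)] by metis
  have "T ` X = S -` X"
    unfolding vimage_def image_def using S by (auto, metis)
  moreover have "S \<in> borel_measurable borel"
    using S(1) by (simp add: borel_measurable_continuous_onI linear_continuous_on linear_linear)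
  ultimately show ?thesis
    using measurable_sets[of S borel borel X] assms(3) by simp
qed

text \<open>The matrix version of this in the library is restricted to well-ordered index types. Here both
  sides equal the integral of $1_A(T^{-1}x + y)\,1_B(y)$ over all $x$ and $y$.\<close>

lemma linear_image_emeasure:
  fixes T :: "'a::euclidean_space \<Rightarrow> 'a"
  assumes lin: "linear T" and inj: "inj T"
    and A: "A \<in> sets borel" and B: "B \<in> sets borel" and sym: "\<And>x. - x \<in> B \<longleftrightarrow> x \<in> B"
  shows "emeasure lborel (T ` A) * emeasure lborel B
       = emeasure lborel A * emeasure lborel (T ` B)"
proof -
  obtain S where S: "linear S" "\<And>x. S (T x) = x" "\<And>x. T (S x) = x"
    using linear_injective_isomorphism[OF lin inj] by metis
  have im: "T ` X = S -` X" for X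
    unfolding vimage_def image_def using S by (auto, metis)
  have [measurable]: "S \<in> borel_measurable borel"
    using S(1) by (simp add: borel_measurable_continuous_onI linear_continuous_on linear_linear)
  note [measurable] = A B
  have em: "emeasure lborel (T ` X) = (\<integral>\<^sup>+x. indicator X (S x) \<partial>lborel)"
    if [measurable]: "X \<in> sets borel" for X
  proof -
    have *: "S -` X \<in> sets borel"
      using measurable_sets[of S borel borel X] by simp
    have "(\<lambda>x. indicator X (S x)) = (indicator (S -` X) :: 'a \<Rightarrow> ennreal)"
      by (auto simp: indicator_def)
    then show ?thesis using * by (simp add: im)
  qed
  have shift: "(\<integral>\<^sup>+x. indicator X (S x + y) \<partial>lborel) = emeasure lborel (T ` X)"
    if [measurable]: "X \<in> sets borel" for X y
  proof -
    have "(\<integral>\<^sup>+x. indicator X (S x + y) \<partial>lborel) = (\<integral>\<^sup>+x. indicator X (S (T y + x)) \<partial>lborel)"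
      using S by (simp add: linear_add add.commute)
    also have "\<dots> = (\<integral>\<^sup>+x. indicator X (S x) \<partial>lborel)"
      by (rule nn_integral_lborel_shift) measurable
    finally show ?thesis using em[OF that] by simp
  qed
  have "emeasure lborel (T ` A) * emeasure lborel B
      = (\<integral>\<^sup>+y. (\<integral>\<^sup>+x. indicator A (S x + y) * indicator B y \<partial>lborel) \<partial>lborel)"
    by (simp add: nn_integral_multc shift nn_integral_cmult)
  also have "\<dots> = (\<integral>\<^sup>+x. (\<integral>\<^sup>+y. indicator A (S x + y) * indicator B y \<partial>lborel) \<partial>lborel)"
    by (rule lborel_pair.Fubini') measurable
  also have "\<dots> = (\<integral>\<^sup>+x. (\<integral>\<^sup>+y. indicator A y * indicator B (y - S x) \<partial>lborel) \<partial>lborel)"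
  proof (rule nn_integral_cong)
    fix x :: 'a
    have "(\<integral>\<^sup>+y. indicator A (S x + y) * indicator B y \<partial>lborel)
        = (\<integral>\<^sup>+y. (\<lambda>z. indicator A z * indicator B (z - S x) :: ennreal) (S x + y) \<partial>lborel)"
      by simp
    also have "\<dots> = (\<integral>\<^sup>+y. indicator A y * indicator B (y - S x) \<partial>lborel)"
      by (rule nn_integral_lborel_shift) measurable
    finally show "(\<integral>\<^sup>+y. indicator A (S x + y) * indicator B y \<partial>lborel)
        = (\<integral>\<^sup>+y. indicator A y * indicator B (y - S x) \<partial>lborel)" .
  qed
  also have "\<dots> = (\<integral>\<^sup>+y. (\<integral>\<^sup>+x. indicator A y * indicator B (y - S x) \<partial>lborel) \<partial>lborel)"
    by (rule lborel_pair.Fubini') measurable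
  also have "\<dots> = (\<integral>\<^sup>+y. indicator A y * (\<integral>\<^sup>+x. indicator B (S x + - y) \<partial>lborel) \<partial>lborel)"
  proof (rule nn_integral_cong)
    fix y :: 'a
    have "indicator B (y - S x) = (indicator B (S x + - y) :: ennreal)" for x
      using sym[of "y - S x"] by (simp add: indicator_def)
    then show "(\<integral>\<^sup>+x. indicator A y * indicator B (y - S x) \<partial>lborel)
       = indicator A y * (\<integral>\<^sup>+x. indicator B (S x + - y) \<partial>lborel)"
      by (simp only:) (rule nn_integral_cmult, measurable)
  qed
  also have "\<dots> = emeasure lborel A * emeasure lborel (T ` B)"
    using shift[OF B, of "- y" for y] by (simp add: nn_integral_multc)
  finally show ?thesis .
qed

text \<open>With \<open>B\<close> a fixed reference set, the quotient of the volumes of its image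
  and of \<open>B\<close> itself acts as the absolute determinant of \<open>T\<close>.\<close>

lemma linear_image_measure:
  fixes T :: "'a::euclidean_space \<Rightarrow> 'a"
  assumes lin: "linear T" and inj: "inj T"
    and "A \<in> sets borel" "bounded A" "B \<in> sets borel" "bounded B"
    and "\<And>x. - x \<in> B \<longleftrightarrow> x \<in> B"
  shows "T ` A \<in> sets borel"
    and "vol (T ` A) * vol B
       = vol A * vol (T ` B)"
proof -
  note borel = linear_image_borel[OF lin inj]
  show "T ` A \<in> sets borel" by (simp add: borel assms)
  have me: "emeasure lborel X = ennreal (vol X)" if "X \<in> sets borel" "bounded X" for X :: "'a set"
    using emeasure_bounded_finite[OF that(2)] that(1)
    by (simp add: emeasure_eq_ennreal_measure less_top)
  have bd: "bounded (T ` X)" if "bounded X" for X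
    using that lin by (simp add: bounded_linear_image linear_linear)
  show "vol (T ` A) * vol B
       = vol A * vol (T ` B)"
    using linear_image_emeasure[OF lin inj assms(3,5,7)]
    by (simp add: me borel bd assms flip: ennreal_mult)
qed

section \<open>Prismatic cells\<close>

text \<open>A prism over the simplex with vertices 0 and \<open>p /\<^sub>R w p\<close>: larger
  weights mean a smaller simplex. The strict inequality removes the facets through 0, so that prisms
  over non-overlapping cones are disjoint outright and not merely up to null sets.\<close>

definition cell :: "'a::euclidean_space set \<Rightarrow> 'a set \<Rightarrow> ('a \<Rightarrow> real) \<Rightarrow> real \<Rightarrow> real \<Rightarrow> 'a set" where
  "cell I V w a b = {(\<Sum>p\<in>I. s p *\<^sub>R p) + (\<Sum>v\<in>V. z v *\<^sub>R v) | s z.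
     (\<forall>p\<in>I. 0 < s p) \<and> (\<Sum>p\<in>I. w p * s p) \<le> 1 \<and> (\<forall>v\<in>V. a \<le> z v \<and> z v \<le> b)}"

text \<open>The factor \<open>g\<close> is independent of \<open>w\<close>, \<open>a\<close> and
  \<open>b\<close>, which later lets cells with different weights be compared. All cells over
  \<open>I\<close> and \<open>V\<close> arise from one fixed prism by a diagonal map, a change of
  basis and a translation; of these only the diagonal map scales volume by an amount that involves
  \<open>w\<close>, \<open>a\<close> and \<open>b\<close>.\<close>

lemma measure_cell:
  fixes I V :: "'a::euclidean_space set"
  assumes ind: "independent (I \<union> V)" and disj: "I \<inter> V = {}" and card: "card (I \<union> V) = DIM('a)"
  shows "\<exists>g\<ge>0. \<forall>w a b. (\<forall>p\<in>I. 0 < w p) \<longrightarrow> a < b \<longrightarrow> cell I V w a b \<in> lmeasurable \<and>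
           vol (cell I V w a b) = g * (b - a) ^ card V / prod w I"
proof -
  have fin: "finite I" "finite V"
    using ind independent_imp_finite by auto
  have "\<exists>\<beta>. bij_betw \<beta> (Basis :: 'a set) (I \<union> V)"
    using fin card by (intro finite_same_card_bij) auto
  then obtain \<beta> where \<beta>: "bij_betw \<beta> (Basis :: 'a set) (I \<union> V)" ..
  define T where "T = (\<lambda>x::'a. \<Sum>e\<in>Basis. (x \<bullet> e) *\<^sub>R \<beta> e)"
  have linT: "linear T"
    unfolding T_def by (intro linear_compose_sum ballI)
      (auto intro!: linearI simp: inner_add_left scaleR_add_left)
  define \<gamma> where "\<gamma> = inv_into Basis \<beta>"
  have \<gamma>: "\<gamma> (\<beta> e) = e" if "e \<in> Basis" for e
    using \<beta> that unfolding \<gamma>_def bij_betw_def by simp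
  have \<gamma>B: "\<gamma> u \<in> Basis" "\<beta> (\<gamma> u) = u" if "u \<in> I \<union> V" for u
    using \<beta> that unfolding \<gamma>_def bij_betw_def by (metis inv_into_into, metis f_inv_into_f)
  have Tsum: "T x = (\<Sum>u\<in>I. (x \<bullet> \<gamma> u) *\<^sub>R u) + (\<Sum>u\<in>V. (x \<bullet> \<gamma> u) *\<^sub>R u)" for x
  proof -
    have "T x = (\<Sum>e\<in>Basis. (x \<bullet> \<gamma> (\<beta> e)) *\<^sub>R \<beta> e)"
      unfolding T_def by (simp add: \<gamma>)
    also have "\<dots> = (\<Sum>u\<in>I \<union> V. (x \<bullet> \<gamma> u) *\<^sub>R u)"
      using sum.reindex_bij_betw[OF \<beta>, of "\<lambda>u. (x \<bullet> \<gamma> u) *\<^sub>R u"] .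
    also have "\<dots> = (\<Sum>u\<in>I. (x \<bullet> \<gamma> u) *\<^sub>R u) + (\<Sum>u\<in>V. (x \<bullet> \<gamma> u) *\<^sub>R u)"
      using fin disj by (rule sum.union_disjoint)
    finally show ?thesis .
  qed
  have injT: "inj T"
  proof (subst linear_injective_0[OF linT], intro allI impI)
    fix x assume "T x = 0"
    then have "(\<Sum>u\<in>I \<union> V. (x \<bullet> \<gamma> u) *\<^sub>R u) = 0"
      unfolding Tsum using fin disj by (simp add: sum.union_disjoint)
    then have "x \<bullet> \<gamma> u = 0" if "u \<in> I \<union> V" for u
      using ind fin that by (auto simp: independent_explicit)
    then have "x \<bullet> e = 0" if "e \<in> Basis" for e
      using that \<gamma>[OF that] bij_betwE[OF \<beta>] by metis
    then show "x = 0" by (simp add: euclidean_eq_iff[of x 0])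
  qed
  define B where "B = cbox (- One) (One :: 'a)"
  have B: "B \<in> sets borel" "bounded B" "\<And>x. - x \<in> B \<longleftrightarrow> x \<in> B"
    unfolding B_def by (auto simp: mem_box)
  have mB: "vol B = 2 ^ DIM('a)"
    unfolding B_def by (simp add: measure_completion measure_lborel_cbox_eq inner_diff_left inner_add_left)
  \<comment> \<open>The fixed prism, in coordinates: unit weights and unit segments.\<close>
  define R where "R = {x::'a. (\<forall>p\<in>I. 0 < x \<bullet> \<gamma> p) \<and> (\<Sum>p\<in>I. x \<bullet> \<gamma> p) \<le> 1
      \<and> (\<forall>v\<in>V. 0 \<le> x \<bullet> \<gamma> v \<and> x \<bullet> \<gamma> v \<le> 1)}"
  have "R = (\<Inter>p\<in>I. {x. 0 < x \<bullet> \<gamma> p}) \<inter> {x. (\<Sum>p\<in>I. x \<bullet> \<gamma> p) \<le> 1}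
      \<inter> (\<Inter>v\<in>V. {x. 0 \<le> x \<bullet> \<gamma> v} \<inter> {x. x \<bullet> \<gamma> v \<le> 1})"
    unfolding R_def by auto
  moreover have "(\<Inter>p\<in>I. {x. 0 < x \<bullet> \<gamma> p}) \<in> sets borel"
    using fin by (intro borel_open open_INT ballI open_Collect_less continuous_intros)
  moreover have "closed (\<Inter>v\<in>V. {x. 0 \<le> x \<bullet> \<gamma> v} \<inter> {x. x \<bullet> \<gamma> v \<le> 1})"
    by (intro closed_INT ballI closed_Int closed_Collect_le continuous_intros)
  moreover have "closed {x. (\<Sum>p\<in>I. x \<bullet> \<gamma> p) \<le> 1}"
    by (intro closed_Collect_le continuous_intros)
  ultimately have Rb: "R \<in> sets borel"
    by (simp only: sets.Int borel_closed)
  have Rbd: "bounded R"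
  proof (rule bounded_subset)
    show "R \<subseteq> B"
    proof
      fix x assume x: "x \<in> R"
      have "- 1 \<le> x \<bullet> e \<and> x \<bullet> e \<le> 1" if e: "e \<in> Basis" for e
      proof -
        have "\<beta> e \<in> I \<or> \<beta> e \<in> V"
          using bij_betwE[OF \<beta>] e by blast
        then show ?thesis
        proof
          assume I: "\<beta> e \<in> I"
          have "x \<bullet> \<gamma> (\<beta> e) \<le> (\<Sum>p\<in>I. x \<bullet> \<gamma> p)"
            using I fin x by (intro member_le_sum) (auto simp: R_def less_imp_le)
          then show ?thesis
            using x I \<gamma>[OF e] unfolding R_def by force
        next
          assume "\<beta> e \<in> V"
          then show ?thesis
            using x \<gamma>[OF e] unfolding R_def by force
        qed
      qed
      then show "x \<in> B"
        by (simp add: B_def mem_box)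
    qed
  qed (use B in simp)
  \<comment> \<open>As \<open>vol B\<close> is \<open>2 ^ DIM('a)\<close>, the factor beside
    \<open>vol R\<close> is the absolute determinant of \<open>T\<close>.\<close>
  define g where "g = vol R * vol (T ` B) / 2 ^ DIM('a)"
  have main: "cell I V w a b \<in> lmeasurable \<and>
      vol (cell I V w a b) = g * (b - a) ^ card V / prod w I"
    if w: "\<And>p. p \<in> I \<Longrightarrow> 0 < w p" and ab: "a < b" for w a b
  proof -
    \<comment> \<open>Simplex coordinates are divided by the weight, prism coordinates are stretched
      from unit length to \<open>b - a\<close>. The offset \<open>a\<close> enters later through the
      translation by \<open>\<tau>\<close>.\<close>
    define d where "d u = (if u \<in> I then 1 / w u else b - a)" for u
    have d: "d u > 0" if "u \<in> I \<union> V" for u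
      using w ab by (simp add: d_def)
    have d\<beta>: "d (\<beta> e) > 0" if "e \<in> Basis" for e
      using d bij_betwE[OF \<beta>] that by blast
    define D where "D = (\<lambda>x::'a. \<Sum>e\<in>Basis. (d (\<beta> e) * (x \<bullet> e)) *\<^sub>R e)"
    have Dc: "D x \<bullet> e = d (\<beta> e) * (x \<bullet> e)" if "e \<in> Basis" for x e
      unfolding D_def using that by (simp add: inner_sum_left_Basis)
    have D\<gamma>: "D x \<bullet> \<gamma> u = d u * (x \<bullet> \<gamma> u)" if "u \<in> I \<union> V" for x u
      using Dc[of "\<gamma> u" x] \<gamma>B[OF that] by simp
    have linD: "linear D"
      unfolding D_def by (intro linear_compose_sum ballI)
        (auto intro!: linearI simp: inner_add_left scaleR_add_left algebra_simps)
    have injD: "inj D"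
    proof (subst linear_injective_0[OF linD], intro allI impI)
      fix x assume "D x = 0"
      then have "x \<bullet> e = 0" if "e \<in> Basis" for e
        using Dc[OF that, of x] d\<beta>[OF that] by simp
      then show "x = 0" by (simp add: euclidean_eq_iff[of x 0])
    qed
    define Di where "Di = (\<lambda>x::'a. \<Sum>e\<in>Basis. (x \<bullet> e / d (\<beta> e)) *\<^sub>R e)"
    have Dic: "Di x \<bullet> e = x \<bullet> e / d (\<beta> e)" if "e \<in> Basis" for x e
      unfolding Di_def using that by (simp add: inner_sum_left_Basis)
    have DDi: "D (Di x) = x" for x
    proof (rule euclidean_eqI)
      fix e :: 'a assume "e \<in> Basis"
      then show "D (Di x) \<bullet> e = x \<bullet> e" using d\<beta>[of e] by (simp add: Dc Dic)
    qed
    define d1 where "d1 = (\<Sum>e\<in>Basis. d (\<beta> e) *\<^sub>R (e::'a))"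
    have d1: "d1 \<bullet> e = d (\<beta> e)" if "e \<in> Basis" for e
      unfolding d1_def using that by (simp add: inner_sum_left_Basis)
    have DB: "D ` B = cbox (- d1) d1"
    proof
      show "D ` B \<subseteq> cbox (- d1) d1"
      proof (clarsimp simp: mem_box Dc d1 B_def)
        fix x e :: 'a assume "\<forall>i\<in>Basis. - 1 \<le> x \<bullet> i \<and> x \<bullet> i \<le> 1" and e: "e \<in> Basis"
        then have "\<bar>x \<bullet> e\<bar> \<le> 1" by (simp add: abs_le_iff)
        then have "\<bar>d (\<beta> e) * (x \<bullet> e)\<bar> \<le> d (\<beta> e)"
          using d\<beta>[OF e] by (simp add: abs_mult)
        then show "- d (\<beta> e) \<le> d (\<beta> e) * (x \<bullet> e) \<and> d (\<beta> e) * (x \<bullet> e) \<le> d (\<beta> e)"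
          by linarith
      qed
      show "cbox (- d1) d1 \<subseteq> D ` B"
      proof
        fix x assume x: "x \<in> cbox (- d1) d1"
        have "Di x \<in> B"
          using x d\<beta> by (auto simp: B_def mem_box Dic d1 field_simps)
        then show "x \<in> D ` B" using DDi[of x] by (metis imageI)
      qed
    qed
    have "(\<Prod>e\<in>Basis. 2 * d (\<beta> e)) = 2 ^ DIM('a) * (\<Prod>e\<in>Basis. d (\<beta> (e::'a)))"
      by (simp add: prod.distrib)
    also have "(\<Prod>e\<in>Basis. d (\<beta> e)) = (\<Prod>u\<in>I \<union> V. d u)"
      using prod.reindex_bij_betw[OF \<beta>, of d] .
    also have "\<dots> = prod d I * prod d V"
      using fin disj by (rule prod.union_disjoint)
    also have "prod d I = 1 / prod w I"
      by (simp add: d_def prod_dividef)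
    also have "prod d V = (\<Prod>u\<in>V. b - a)"
      using disj by (intro prod.cong) (auto simp: d_def)
    finally have prod_d: "(\<Prod>e\<in>Basis. 2 * d (\<beta> e)) = 2 ^ DIM('a) * ((b - a) ^ card V / prod w I)"
      by simp
    have "vol (D ` B) = (\<Prod>e\<in>Basis. 2 * d (\<beta> e))"
      unfolding DB using d\<beta>
      by (simp add: measure_completion measure_lborel_cbox_eq inner_diff_left inner_add_left d1 less_imp_le)
    then have mDB: "vol (D ` B) = 2 ^ DIM('a) * ((b - a) ^ card V / prod w I)"
      using prod_d by simp
    define q where "q = (b - a) ^ card V / prod w I"
    have DR: "D ` R \<in> sets borel" "bounded (D ` R)"
      using linear_image_measure(1)[OF linD injD Rb Rbd B] Rbd linD
      by (auto simp: bounded_linear_image linear_linear)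
    have "vol (D ` R) * 2 ^ DIM('a) = vol R * (2 ^ DIM('a) * q)"
      using linear_image_measure(2)[OF linD injD Rb Rbd B] unfolding mB mDB q_def .
    then have mDR: "vol (D ` R) = vol R * q"
      using mult_right_cancel[of "2 ^ DIM('a) :: real"] by (simp only: mult.assoc mult.left_commute[of _ "2 ^ DIM('a)"] mult.commute[of _ "2 ^ DIM('a)"]) simp
    have TDR: "T ` (D ` R) \<in> sets borel"
      by (rule linear_image_measure(1)[OF linT injT DR B])
    have "vol (T ` (D ` R)) * 2 ^ DIM('a) = vol R * q * vol (T ` B)"
      using linear_image_measure(2)[OF linT injT DR B] unfolding mB mDR .
    then have "vol (T ` (D ` R)) = vol R * q * vol (T ` B) / 2 ^ DIM('a)"
      by (metis divide_eq_eq power_not_zero zero_neq_numeral)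
    then have mTDR: "vol (T ` (D ` R)) = g * (b - a) ^ card V / prod w I"
      unfolding g_def q_def by (metis (no_types, opaque_lifting) mult.assoc mult.commute times_divide_eq_right)
    have lm: "T ` (D ` R) \<in> lmeasurable"
      using TDR DR(2) linT
      by (intro bounded_set_imp_lmeasurable) (auto simp: bounded_linear_image linear_linear)
    define \<tau> where "\<tau> = (\<Sum>v\<in>V. a *\<^sub>R v)"
    have eq: "cell I V w a b = (+) \<tau> ` (T ` (D ` R))"
    proof (intro set_eqI iffI)
      fix x assume "x \<in> cell I V w a b"
      then obtain s z where x: "x = (\<Sum>p\<in>I. s p *\<^sub>R p) + (\<Sum>v\<in>V. z v *\<^sub>R v)"
        and s: "\<And>p. p \<in> I \<Longrightarrow> 0 < s p" "(\<Sum>p\<in>I. w p * s p) \<le> 1"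
        and z: "\<And>v. v \<in> V \<Longrightarrow> a \<le> z v \<and> z v \<le> b"
        unfolding cell_def by blast
      define y where "y = (\<Sum>e\<in>Basis. (if \<beta> e \<in> I then w (\<beta> e) * s (\<beta> e) else (z (\<beta> e) - a) / (b - a)) *\<^sub>R (e::'a))"
      have yc: "y \<bullet> e = (if \<beta> e \<in> I then w (\<beta> e) * s (\<beta> e) else (z (\<beta> e) - a) / (b - a))"
        if "e \<in> Basis" for e
        unfolding y_def using that by (simp add: inner_sum_left_Basis)
      have yI: "y \<bullet> \<gamma> u = w u * s u" if "u \<in> I" for u
        using that \<gamma>B[of u] by (simp add: yc)
      have yV: "y \<bullet> \<gamma> u = (z u - a) / (b - a)" if "u \<in> V" for u
        using that \<gamma>B[of u] disj by (auto simp: yc)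
      have "y \<in> R"
        using s z w ab by (auto simp: R_def yI yV field_simps cong: sum.cong)
      moreover have "x = \<tau> + T (D y)"
      proof -
        have "(\<Sum>u\<in>I. (D y \<bullet> \<gamma> u) *\<^sub>R u) = (\<Sum>p\<in>I. s p *\<^sub>R p)"
          using w by (intro sum.cong refl) (simp add: D\<gamma> yI d_def, fastforce)
        moreover have "(\<Sum>u\<in>V. (D y \<bullet> \<gamma> u) *\<^sub>R u) = (\<Sum>v\<in>V. (z v - a) *\<^sub>R v)"
          using ab disj by (intro sum.cong refl) (auto simp: D\<gamma> yV d_def)
        ultimately show ?thesis
          unfolding x \<tau>_def Tsum by (simp add: scaleR_diff_left sum_subtractf)
      qed
      ultimately show "x \<in> (+) \<tau> ` (T ` (D ` R))" by blast
    next
      fix x assume "x \<in> (+) \<tau> ` (T ` (D ` R))"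
      then obtain y where y: "y \<in> R" and x: "x = \<tau> + T (D y)" by blast
      define s where "s u = (y \<bullet> \<gamma> u) / w u" for u
      define z where "z u = a + (b - a) * (y \<bullet> \<gamma> u)" for u
      have "(\<Sum>u\<in>I. (D y \<bullet> \<gamma> u) *\<^sub>R u) = (\<Sum>p\<in>I. s p *\<^sub>R p)"
        by (intro sum.cong refl) (simp add: D\<gamma> s_def d_def)
      moreover have "(\<Sum>u\<in>V. (D y \<bullet> \<gamma> u) *\<^sub>R u) = (\<Sum>v\<in>V. (z v - a) *\<^sub>R v)"
        using disj by (intro sum.cong refl) (auto simp: D\<gamma> z_def d_def)
      ultimately have "x = (\<Sum>p\<in>I. s p *\<^sub>R p) + (\<Sum>v\<in>V. z v *\<^sub>R v)"
        unfolding x \<tau>_def Tsum by (simp add: scaleR_diff_left sum_subtractf)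
      moreover have "\<forall>p\<in>I. 0 < s p"
        using y w by (simp add: R_def s_def)
      moreover have "(\<Sum>p\<in>I. w p * s p) = (\<Sum>p\<in>I. y \<bullet> \<gamma> p)"
        using w by (intro sum.cong refl) (simp add: s_def, fastforce)
      moreover have "a \<le> z v \<and> z v \<le> b" if "v \<in> V" for v
      proof -
        have "0 \<le> y \<bullet> \<gamma> v" "y \<bullet> \<gamma> v \<le> 1" using y that by (auto simp: R_def)
        then have "0 \<le> (b - a) * (y \<bullet> \<gamma> v)" "(b - a) * (y \<bullet> \<gamma> v) \<le> (b - a) * 1"
          using ab by (auto intro!: mult_left_mono mult_nonneg_nonneg)
        then show ?thesis by (simp add: z_def)
      qed
      moreover have "(\<Sum>p\<in>I. y \<bullet> \<gamma> p) \<le> 1"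
        using y by (simp add: R_def)
      ultimately show "x \<in> cell I V w a b"
        unfolding cell_def mem_Collect_eq by (intro exI[of _ s] exI[of _ z]) simp
    qed
    show ?thesis
      unfolding eq using lm mTDR by (simp add: measurable_translation measure_translation)
  qed
  show ?thesis
    using main by (intro exI[of _ g]) (auto simp: g_def)
qed

section \<open>Feasible bases of a linear program\<close>

definition complements :: "'a::euclidean_space set \<Rightarrow> 'a set \<Rightarrow> bool" where
  "complements V I \<longleftrightarrow> independent (I \<union> V) \<and> I \<inter> V = {} \<and> card (I \<union> V) = DIM('a)"

lemma independent_Un_coeffs_0:
  fixes I V :: "'a::euclidean_space set"
  assumes ind: "independent (I \<union> V)" and disj: "I \<inter> V = {}"
    and r: "(\<Sum>p\<in>I. r p *\<^sub>R p) \<in> span V" and p: "p \<in> I"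
  shows "r p = 0"
proof -
  have fin: "finite I" "finite V"
    using ind independent_imp_finite by auto
  obtain u where u: "(\<Sum>p\<in>I. r p *\<^sub>R p) = (\<Sum>v\<in>V. u v *\<^sub>R v)"
    using r span_finite[OF fin(2)] by auto
  define c where "c x = (if x \<in> I then r x else - u x)" for x
  have "(\<Sum>x\<in>I. c x *\<^sub>R x) = (\<Sum>p\<in>I. r p *\<^sub>R p)"
    by (simp add: c_def)
  moreover have "(\<Sum>x\<in>V. c x *\<^sub>R x) = (\<Sum>v\<in>V. - u v *\<^sub>R v)"
    using disj by (intro sum.cong) (auto simp: c_def)
  ultimately have "(\<Sum>x\<in>I \<union> V. c x *\<^sub>R x) = 0"
    using fin disj u by (simp add: sum.union_disjoint sum_negf)
  then have "c p = 0"
    using ind fin p by (auto simp: independent_explicit)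
  then show ?thesis
    using p by (simp add: c_def)
qed

lemma complements_decomp:
  fixes x :: "'a::euclidean_space"
  assumes "complements V I"
  obtains \<sigma> where "x - (\<Sum>p\<in>I. \<sigma> p *\<^sub>R p) \<in> span V"
proof -
  have ind: "independent (I \<union> V)" and card: "card (I \<union> V) = DIM('a)"
    using assms by (auto simp: complements_def)
  have fin: "finite I"
    using ind independent_imp_finite by auto
  have "span (I \<union> V) = UNIV"
    using ind card dim_eq_card_independent dim_eq_full by metis
  then obtain a b where "a \<in> span I" "b \<in> span V" "x = a + b"
    unfolding span_Un by blast
  then obtain u where "x - (\<Sum>p\<in>I. u p *\<^sub>R p) = b"
    using span_finite[OF fin] by auto
  then show ?thesis
    using that \<open>b \<in> span V\<close> by metis
qed

lemma exists_linear_weights: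
  fixes I V :: "'a::euclidean_space set" and \<theta> :: "'a \<Rightarrow> real"
  assumes "independent (I \<union> V)" "I \<inter> V = {}"
  obtains y :: "'a \<Rightarrow> real" where "linear y" "\<And>p. p \<in> I \<Longrightarrow> y p = \<theta> p" "\<And>v. v \<in> V \<Longrightarrow> y v = 0"
proof -
  obtain y :: "'a \<Rightarrow> real" where "linear y" "\<forall>x\<in>I \<union> V. y x = (if x \<in> I then \<theta> x else 0)"
    using linear_independent_extend[OF assms(1), of "\<lambda>x. if x \<in> I then \<theta> x else 0"] by blast
  then show ?thesis
    using assms(2) by (intro that[of y]) auto
qed

lemma linear_eq_0_on_span':
  fixes y :: "'a::euclidean_space \<Rightarrow> real"
  assumes "linear y" "\<And>v. v \<in> V \<Longrightarrow> y v = 0" "x \<in> span V"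
  shows "y x = 0"
  using linear_eq_0_on_span[OF assms(1)] assms(2,3) by blast

text \<open>A form vanishing on \<open>V\<close> does not see an error in \<open>span V\<close>. For
  the dual solution of a basis this is the equality of primal and dual values.\<close>

lemma linear_weights_eq:
  fixes y :: "'a::euclidean_space \<Rightarrow> real"
  assumes y: "linear y" "\<And>p. p \<in> I \<Longrightarrow> y p = \<theta> p" "\<And>v. v \<in> V \<Longrightarrow> y v = 0"
    and x: "x - (\<Sum>p\<in>I. s p *\<^sub>R p) \<in> span V"
  shows "y x = (\<Sum>p\<in>I. \<theta> p * s p)"
proof -
  have "y (x - (\<Sum>p\<in>I. s p *\<^sub>R p)) = 0"
    using linear_eq_0_on_span'[OF y(1,3) x] .
  then have "y x = (\<Sum>p\<in>I. s p * y p)"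
    using y(1) by (simp add: linear_diff linear_sum linear_cmul)
  then show ?thesis
    using y(2) by (simp add: mult.commute)
qed

text \<open>Caratheodory's reduction with control of the cost. A dependency modulo
  \<open>span V\<close> among the points used may be added with either sign; the sign is chosen so
  that the cost does not rise, and the move continues until a coefficient vanishes.\<close>

lemma basic_representation:
  fixes P V :: "'a::euclidean_space set"
  assumes "finite P" and V: "independent V" and \<theta>: "\<And>p. p \<in> P \<Longrightarrow> 0 < \<theta> p"
    and "\<And>p. p \<in> P \<Longrightarrow> 0 \<le> s p" and "x - (\<Sum>p\<in>P. s p *\<^sub>R p) \<in> span V"
  shows "\<exists>I t. I \<subseteq> P \<and> independent (I \<union> V) \<and> I \<inter> V = {} \<and> (\<forall>p\<in>I. 0 < t p)
    \<and> x - (\<Sum>p\<in>I. t p *\<^sub>R p) \<in> span V \<and> (\<Sum>p\<in>I. \<theta> p * t p) \<le> (\<Sum>p\<in>P. \<theta> p * s p)"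
  using assms
proof (induction P arbitrary: s rule: finite_psubset_induct)
  case (psubset P)
  have finV: "finite V"
    using V independent_imp_finite by auto
  have drop: ?case if p: "p \<in> P" "s' p = 0" and s': "\<And>p. p \<in> P \<Longrightarrow> 0 \<le> s' p"
      "x - (\<Sum>p\<in>P. s' p *\<^sub>R p) \<in> span V" "(\<Sum>p\<in>P. \<theta> p * s' p) \<le> (\<Sum>p\<in>P. \<theta> p * s p)" for s' p
  proof -
    have P: "P = insert p (P - {p})" using p by auto
    have e: "(\<Sum>p\<in>P. s' p *\<^sub>R p) = (\<Sum>p\<in>P - {p}. s' p *\<^sub>R p)"
      "(\<Sum>p\<in>P. \<theta> p * s' p) = (\<Sum>p\<in>P - {p}. \<theta> p * s' p)"
      using p(2) psubset.hyps by (auto simp: sum.remove[OF _ p(1)])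
    have "\<exists>I t. I \<subseteq> P - {p} \<and> independent (I \<union> V) \<and> I \<inter> V = {} \<and> (\<forall>p\<in>I. 0 < t p)
      \<and> x - (\<Sum>p\<in>I. t p *\<^sub>R p) \<in> span V \<and> (\<Sum>p\<in>I. \<theta> p * t p) \<le> (\<Sum>p\<in>P - {p}. \<theta> p * s' p)"
      using p(1) V psubset.prems(2) s'(1,2) e(1) by (intro psubset.IH) auto
    then show ?thesis
      using s'(3) unfolding e(2) by (meson Diff_subset order_trans)
  qed
  show ?case
  proof (cases "\<exists>p\<in>P. s p = 0")
    case True
    then obtain p where "p \<in> P" "s p = 0" by blast
    then show ?thesis using psubset.prems by (intro drop[of p s]) auto
  next
    case False
    then have pos: "0 < s p" if "p \<in> P" for p
      using psubset.prems(3)[OF that] that by force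
    show ?thesis
    proof (cases "independent (P \<union> V) \<and> P \<inter> V = {}")
      case True
      then show ?thesis using pos psubset.prems by blast
    next
      case dep: False
      have "\<exists>r. (\<Sum>p\<in>P. r p *\<^sub>R p) \<in> span V \<and> (\<exists>p\<in>P. r p \<noteq> 0)"
      proof (cases "P \<inter> V = {}")
        case False
        then obtain p where p: "p \<in> P" "p \<in> V" by blast
        have "(\<Sum>q\<in>P. (if q = p then 1 else 0) *\<^sub>R q) = p"
          using p psubset.hyps by (simp add: if_distrib[of "\<lambda>c. c *\<^sub>R _"] cong: if_cong)
        then show ?thesis
          using p by (intro exI[of _ "\<lambda>q. if q = p then 1 else 0"]) (auto intro: span_base)
      next
        case disj: True
        then have "\<not> independent (P \<union> V)" using dep by blast
        then obtain u where u: "(\<Sum>x\<in>P \<union> V. u x *\<^sub>R x) = 0" "\<exists>x\<in>P \<union> V. u x \<noteq> 0"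
          using psubset.hyps finV by (auto simp: independent_explicit)
        have s0: "(\<Sum>x\<in>P. u x *\<^sub>R x) + (\<Sum>x\<in>V. u x *\<^sub>R x) = 0"
          using u(1) psubset.hyps finV disj by (simp add: sum.union_disjoint)
        have "(\<Sum>x\<in>P. u x *\<^sub>R x) = - (\<Sum>x\<in>V. u x *\<^sub>R x)"
          using s0 by (simp add: eq_neg_iff_add_eq_0)
        then have 1: "(\<Sum>x\<in>P. u x *\<^sub>R x) \<in> span V"
          by (simp add: span_neg span_sum span_scale span_base)
        have "\<exists>p\<in>P. u p \<noteq> 0"
        proof (rule ccontr)
          assume "\<not> ?thesis"
          then have z: "\<forall>p\<in>P. u p = 0" by blast
          then have "(\<Sum>x\<in>V. u x *\<^sub>R x) = 0" using s0 by simp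
          then have "\<forall>x\<in>V. u x = 0"
            using V by (auto simp: independent_explicit)
          then show False using z u(2) by blast
        qed
        then show ?thesis using 1 by blast
      qed
      then obtain r0 where r0: "(\<Sum>p\<in>P. r0 p *\<^sub>R p) \<in> span V" "\<exists>p\<in>P. r0 p \<noteq> 0" by blast
      obtain r where r: "(\<Sum>p\<in>P. r p *\<^sub>R p) \<in> span V" "\<exists>p\<in>P. r p \<noteq> 0"
        and cost: "(\<Sum>p\<in>P. \<theta> p * r p) \<le> 0"
      proof (cases "(\<Sum>p\<in>P. \<theta> p * r0 p) \<le> 0")
        case True
        then show ?thesis using that r0 by blast
      next
        case False
        then show ?thesis
          using that[of "\<lambda>p. - r0 p"] r0 by (simp add: sum_negf span_neg)
      qed
      \<comment> \<open>Positive weights and a nonpositive total exclude a nonzero \<open>r\<close>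
        with nonnegative entries, so some coefficient decreases and the move must stop.\<close>
      have "\<exists>p\<in>P. r p < 0"
      proof (rule ccontr)
        assume "\<not> ?thesis"
        then have nn: "0 \<le> r p" if "p \<in> P" for p using that by force
        obtain q where q: "q \<in> P" "r q \<noteq> 0" using r(2) by blast
        have "0 < (\<Sum>p\<in>P. \<theta> p * r p)"
        proof (rule sum_pos2[OF psubset.hyps q(1)])
          show "0 < \<theta> q * r q" using nn q psubset.prems(2) by (metis less_eq_real_def mult_pos_pos)
        qed (use nn psubset.prems(2) in \<open>simp add: less_imp_le\<close>)
        then show False using cost by simp
      qed
      define N where "N = {p\<in>P. r p < 0}"
      have N: "finite N" "N \<noteq> {}"
        using psubset.hyps \<open>\<exists>p\<in>P. r p < 0\<close> by (auto simp: N_def)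
      \<comment> \<open>The longest step along \<open>r\<close> that keeps all coefficients
        nonnegative; the minimising index is the point that leaves.\<close>
      define \<tau> where "\<tau> = Min ((\<lambda>p. s p / - r p) ` N)"
      have "\<tau> \<in> (\<lambda>p. s p / - r p) ` N"
        unfolding \<tau>_def using N by (intro Min_in) auto
      then obtain m where m: "m \<in> N" "\<tau> = s m / - r m" by blast
      have \<tau>0: "0 < \<tau>"
        using m pos[of m] by (auto simp: N_def divide_pos_neg)
      define s' where "s' p = s p + \<tau> * r p" for p
      show ?thesis
      proof (rule drop[of m s'])
        show "m \<in> P" using m by (simp add: N_def)
        show "s' m = 0" using m by (simp add: s'_def N_def)
        show "0 \<le> s' p" if p: "p \<in> P" for p
        proof (cases "r p < 0")
          case True
          then have "\<tau> \<le> s p / - r p"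
            unfolding \<tau>_def using N p by (intro Min_le) (auto simp: N_def)
          then show ?thesis using True by (simp add: s'_def field_simps)
        next
          case False
          then show ?thesis using pos[OF p] \<tau>0 by (simp add: s'_def)
        qed
        have "x - (\<Sum>p\<in>P. s' p *\<^sub>R p)
            = (x - (\<Sum>p\<in>P. s p *\<^sub>R p)) - \<tau> *\<^sub>R (\<Sum>p\<in>P. r p *\<^sub>R p)"
          by (simp add: s'_def scaleR_add_left sum.distrib scaleR_sum_right)
        then show "x - (\<Sum>p\<in>P. s' p *\<^sub>R p) \<in> span V"
          using psubset.prems(4) r(1) by (simp only: span_diff span_scale)
        have "(\<Sum>p\<in>P. \<theta> p * s' p) = (\<Sum>p\<in>P. \<theta> p * s p) + \<tau> * (\<Sum>p\<in>P. \<theta> p * r p)"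
          by (simp add: s'_def algebra_simps sum.distrib sum_distrib_left)
        then show "(\<Sum>p\<in>P. \<theta> p * s' p) \<le> (\<Sum>p\<in>P. \<theta> p * s p)"
          using \<tau>0 cost by (simp add: mult_nonneg_nonpos)
      qed
    qed
  qed
qed

text \<open>A minimum exists because only finitely many costs compete: points independent modulo
  \<open>span V\<close> determine their coefficients, so each subset of \<open>P\<close> contributes
  at most one basic cost, and every representation is at least as expensive as some basic
  one.\<close>

lemma optimal_representation:
  fixes P V :: "'a::euclidean_space set"
  assumes P: "finite P" and V: "independent V" and \<theta>: "\<And>p. p \<in> P \<Longrightarrow> 0 < \<theta> p"
    and s: "\<And>p. p \<in> P \<Longrightarrow> 0 \<le> s p" "x - (\<Sum>p\<in>P. s p *\<^sub>R p) \<in> span V"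
  obtains I t where "I \<subseteq> P" "independent (I \<union> V)" "I \<inter> V = {}" "\<forall>p\<in>I. 0 < t p"
    "x - (\<Sum>p\<in>I. t p *\<^sub>R p) \<in> span V"
    "\<forall>s. (\<forall>p\<in>P. 0 \<le> s p) \<longrightarrow> x - (\<Sum>p\<in>P. s p *\<^sub>R p) \<in> span V \<longrightarrow>
       (\<Sum>p\<in>I. \<theta> p * t p) \<le> (\<Sum>p\<in>P. \<theta> p * s p)"
proof -
  define Q where "Q I t \<longleftrightarrow> I \<subseteq> P \<and> independent (I \<union> V) \<and> I \<inter> V = {} \<and> (\<forall>p\<in>I. 0 < t p)
    \<and> x - (\<Sum>p\<in>I. t p *\<^sub>R p) \<in> span V" for I t
  define F where "F = {\<Sum>p\<in>I. \<theta> p * t p | I t. Q I t}"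
  have "F \<subseteq> (\<lambda>I. \<Sum>p\<in>I. \<theta> p * (SOME t. Q I t) p) ` Pow P"
  proof
    fix c assume "c \<in> F"
    then obtain I t where It: "Q I t" "c = (\<Sum>p\<in>I. \<theta> p * t p)" by (auto simp: F_def)
    define t' where "t' = (SOME t. Q I t)"
    have t': "Q I t'" unfolding t'_def by (rule someI[of "Q I", OF It(1)])
    have "(x - (\<Sum>p\<in>I. t' p *\<^sub>R p)) - (x - (\<Sum>p\<in>I. t p *\<^sub>R p)) \<in> span V"
      using t' It(1) unfolding Q_def by (intro span_diff[of "x - _" V "x - _"]) blast+
    then have "(\<Sum>p\<in>I. (t p - t' p) *\<^sub>R p) \<in> span V"
      by (simp add: scaleR_diff_left sum_subtractf)
    then have "t p - t' p = 0" if "p \<in> I" for p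
      using independent_Un_coeffs_0[of I V "\<lambda>p. t p - t' p" p] It(1) that by (auto simp: Q_def)
    then have "c = (\<Sum>p\<in>I. \<theta> p * t' p)"
      unfolding It(2) by (intro sum.cong) auto
    then show "c \<in> (\<lambda>I. \<Sum>p\<in>I. \<theta> p * (SOME t. Q I t) p) ` Pow P"
      unfolding t'_def by (rule image_eqI) (use It(1) in \<open>simp add: Q_def\<close>)
  qed
  then have finF: "finite F"
    using finite_surj[of "Pow P"] P by simp
  have dom: "\<exists>c\<in>F. c \<le> (\<Sum>p\<in>P. \<theta> p * s p)"
    if "\<And>p. p \<in> P \<Longrightarrow> 0 \<le> s p" "x - (\<Sum>p\<in>P. s p *\<^sub>R p) \<in> span V" for s
    using basic_representation[of P V \<theta> s x, OF P V \<theta> that] unfolding F_def Q_def by blast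
  have "F \<noteq> {}" using dom[OF s] by blast
  then have "Min F \<in> F" using finF by simp
  then obtain I t where It: "Q I t" "Min F = (\<Sum>p\<in>I. \<theta> p * t p)" by (auto simp: F_def)
  show ?thesis
  proof (rule that[of I t])
    show "\<forall>s. (\<forall>p\<in>P. 0 \<le> s p) \<longrightarrow> x - (\<Sum>p\<in>P. s p *\<^sub>R p) \<in> span V \<longrightarrow>
       (\<Sum>p\<in>I. \<theta> p * t p) \<le> (\<Sum>p\<in>P. \<theta> p * s p)"
    proof (intro allI impI)
      fix s assume "\<forall>p\<in>P. 0 \<le> s p" "x - (\<Sum>p\<in>P. s p *\<^sub>R p) \<in> span V"
      then obtain c where "c \<in> F" "c \<le> (\<Sum>p\<in>P. \<theta> p * s p)" using dom by blast
      then show "(\<Sum>p\<in>I. \<theta> p * t p) \<le> (\<Sum>p\<in>P. \<theta> p * s p)"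
        using finF It(2) Min_le by fastforce
    qed
  qed (use It in \<open>auto simp: Q_def\<close>)
qed

text \<open>In the linear program of minimising $\sum_{p \in P} \theta_p s_p$ over all representations of $x$
  as $\sum_{p \in P} s_p p$ modulo span $V$, the linear form $y$ is the dual solution that belongs to the
  basis $I$. Feasible bases correspond to the facets of the polytope with vertices $p / \theta_p$, and
  genericity of $\theta$ says that these facets are simplices.\<close>

definition feasible_bases :: "'a::euclidean_space set \<Rightarrow> 'a set \<Rightarrow> ('a \<Rightarrow> real) \<Rightarrow> 'a set set" where
  "feasible_bases P V \<theta> = {I. I \<subseteq> P \<and> complements V I \<and>
     (\<forall>y. linear y \<longrightarrow> (\<forall>p\<in>I. y p = \<theta> p) \<longrightarrow> (\<forall>v\<in>V. y v = 0) \<longrightarrow> (\<forall>q\<in>P. y q \<le> \<theta> q))}"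

definition generic_weights :: "'a::euclidean_space set \<Rightarrow> 'a set \<Rightarrow> ('a \<Rightarrow> real) \<Rightarrow> bool" where
  "generic_weights P V \<theta> \<longleftrightarrow> (\<forall>I\<subseteq>P. complements V I \<longrightarrow>
     (\<forall>y. linear y \<longrightarrow> (\<forall>p\<in>I. y p = \<theta> p) \<longrightarrow> (\<forall>v\<in>V. y v = 0) \<longrightarrow> (\<forall>q\<in>P - I. y q \<noteq> \<theta> q)))"

text \<open>An optimal basic representation either uses a full basis, whose optimality forces the
  dual form to be feasible, or uses fewer points. In the second case \<open>x\<close> lies in one of
  finitely many proper subspaces, which form a null set.\<close>

lemma feasible_bases_cover:
  fixes P V :: "'a::euclidean_space set"
  assumes P: "finite P" and V: "independent V" and \<theta>: "\<And>p. p \<in> P \<Longrightarrow> 0 < \<theta> p"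
    and s: "\<And>p. p \<in> P \<Longrightarrow> 0 \<le> s p" "x - (\<Sum>p\<in>P. s p *\<^sub>R p) \<in> span V"
      "(\<Sum>p\<in>P. \<theta> p * s p) \<le> 1"
  shows "(\<exists>I\<in>feasible_bases P V \<theta>. \<exists>t. (\<forall>p\<in>I. 0 < t p) \<and> x - (\<Sum>p\<in>I. t p *\<^sub>R p) \<in> span V
            \<and> (\<Sum>p\<in>I. \<theta> p * t p) \<le> 1)
       \<or> (\<exists>I\<subseteq>P. dim (I \<union> V) < DIM('a) \<and> x \<in> span (I \<union> V))"
proof -
  obtain I t where It: "I \<subseteq> P" "independent (I \<union> V)" "I \<inter> V = {}" and t: "\<forall>p\<in>I. 0 < t p"
    and It5: "x - (\<Sum>p\<in>I. t p *\<^sub>R p) \<in> span V"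
    and opt: "\<forall>s. (\<forall>p\<in>P. 0 \<le> s p) \<longrightarrow> x - (\<Sum>p\<in>P. s p *\<^sub>R p) \<in> span V \<longrightarrow>
       (\<Sum>p\<in>I. \<theta> p * t p) \<le> (\<Sum>p\<in>P. \<theta> p * s p)"
    using optimal_representation[of P V \<theta> s x, OF P V \<theta> s(1,2)] by blast
  have fin: "finite I" using It(1) P finite_subset by blast
  have dimI: "dim (I \<union> V) = card (I \<union> V)"
    using It(2) by (rule dim_eq_card_independent)
  show ?thesis
  proof (cases "card (I \<union> V) = DIM('a)")
    case True
    then have compl: "complements V I" using It by (simp add: complements_def)
    have "y q \<le> \<theta> q"
      if y: "linear y" "\<forall>p\<in>I. y p = \<theta> p" "\<forall>v\<in>V. y v = 0" and q: "q \<in> P" for y q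
    proof -
      obtain \<sigma> where \<sigma>: "q - (\<Sum>p\<in>I. \<sigma> p *\<^sub>R p) \<in> span V"
        using complements_decomp[OF compl] by blast
      \<comment> \<open>All \<open>t p\<close> are positive, so a small multiple of the expression
        of \<open>q\<close> through \<open>I\<close> can be subtracted. The form
        \<open>1 + \<bar>\<sigma> p\<bar>\<close> keeps the denominators positive.\<close>
      have "\<exists>e>0. \<forall>p\<in>I. e * \<sigma> p \<le> t p"
      proof -
        define e where "e = Min (insert 1 ((\<lambda>p. t p / (1 + \<bar>\<sigma> p\<bar>)) ` I))"
        have "e \<in> insert 1 ((\<lambda>p. t p / (1 + \<bar>\<sigma> p\<bar>)) ` I)"
          unfolding e_def using fin by (intro Min_in) auto
        then have e: "e > 0" using t by (auto intro!: divide_pos_pos add_pos_nonneg)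
        have "e * \<sigma> p \<le> t p" if "p \<in> I" for p
        proof -
          have "e \<le> t p / (1 + \<bar>\<sigma> p\<bar>)"
            unfolding e_def using fin that by (intro Min_le) auto
          then have "e * (1 + \<bar>\<sigma> p\<bar>) \<le> t p"
            by (simp add: pos_le_divide_eq add_pos_nonneg)
          moreover have "e * \<sigma> p \<le> e * (1 + \<bar>\<sigma> p\<bar>)"
            using e by (intro mult_left_mono) auto
          ultimately show ?thesis by linarith
        qed
        then show ?thesis using e by blast
      qed
      then obtain e where e: "e > 0" "\<And>p. p \<in> I \<Longrightarrow> e * \<sigma> p \<le> t p" by blast
      \<comment> \<open>Brings in \<open>q\<close> with coefficient \<open>e\<close> and takes out
        its expression through \<open>I\<close>: \<open>x\<close> is still represented modulo
        \<open>span V\<close>, and the cost changes by \<open>e * (\<theta> q - y q)\<close>, which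
        optimality keeps nonnegative.\<close>
      define s' where "s' p = (if p \<in> I then t p - e * \<sigma> p else 0) + (if p = q then e else 0)" for p
      have I': "P \<inter> {p. p \<in> I} = I" using It(1) by auto
      have I'': "P \<inter> I = I" using It(1) by auto
      have 1: "(\<Sum>p\<in>P. s' p *\<^sub>R p) = (\<Sum>p\<in>I. (t p - e * \<sigma> p) *\<^sub>R p) + e *\<^sub>R q"
        using P q by (simp add: s'_def scaleR_add_left sum.distrib if_distrib[of "\<lambda>c. c *\<^sub>R _"]
            sum.If_cases I' I'' cong: if_cong)
      have 2: "(\<Sum>p\<in>P. \<theta> p * s' p) = (\<Sum>p\<in>I. \<theta> p * (t p - e * \<sigma> p)) + \<theta> q * e"
        using P q by (simp add: s'_def distrib_left sum.distrib if_distrib[of "(*) _"]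
            sum.If_cases I' I'' cong: if_cong)
      have "x - (\<Sum>p\<in>P. s' p *\<^sub>R p) = (x - (\<Sum>p\<in>I. t p *\<^sub>R p)) - e *\<^sub>R (q - (\<Sum>p\<in>I. \<sigma> p *\<^sub>R p))"
        unfolding 1 by (simp add: scaleR_diff_left sum_subtractf scaleR_sum_right scaleR_diff_right)
      then have "x - (\<Sum>p\<in>P. s' p *\<^sub>R p) \<in> span V"
        using It5 \<sigma> by (simp only: span_diff span_scale)
      moreover have "0 \<le> s' p" if "p \<in> P" for p
        using e(1) e(2)[of p] by (simp add: s'_def)
      ultimately have "(\<Sum>p\<in>I. \<theta> p * t p) \<le> (\<Sum>p\<in>P. \<theta> p * s' p)"
        using opt by blast
      also have "\<dots> = (\<Sum>p\<in>I. \<theta> p * t p) - e * (\<Sum>p\<in>I. \<theta> p * \<sigma> p) + e * \<theta> q"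
        unfolding 2 by (simp add: algebra_simps sum_subtractf sum_distrib_left)
      finally have "e * (\<Sum>p\<in>I. \<theta> p * \<sigma> p) \<le> e * \<theta> q" by simp
      moreover have "y q = (\<Sum>p\<in>I. \<theta> p * \<sigma> p)"
        using y \<sigma> by (intro linear_weights_eq[where V=V]) auto
      ultimately show ?thesis using e(1) by simp
    qed
    then have "I \<in> feasible_bases P V \<theta>"
      using It(1) compl unfolding feasible_bases_def by blast
    moreover have "(\<Sum>p\<in>I. \<theta> p * t p) \<le> 1"
    proof -
      have "\<forall>p\<in>P. 0 \<le> s p" using s(1) by blast
      then have "(\<Sum>p\<in>I. \<theta> p * t p) \<le> (\<Sum>p\<in>P. \<theta> p * s p)" using opt s(2) by blast
      then show ?thesis using s(3) by linarith
    qed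
    ultimately show ?thesis using t It5 by blast
  next
    case False
    have "dim (I \<union> V) < DIM('a)"
      using False dimI dim_subset_UNIV[of "I \<union> V"] by simp
    moreover have "x \<in> span (I \<union> V)"
    proof -
      have "x - (\<Sum>p\<in>I. t p *\<^sub>R p) \<in> span (I \<union> V)"
        using It5 span_mono[of V "I \<union> V"] by auto
      moreover have "(\<Sum>p\<in>I. t p *\<^sub>R p) \<in> span (I \<union> V)"
        by (intro span_sum span_scale span_base) auto
      ultimately have "(x - (\<Sum>p\<in>I. t p *\<^sub>R p)) + (\<Sum>p\<in>I. t p *\<^sub>R p) \<in> span (I \<union> V)"
        by (rule span_add)
      then show ?thesis by simp
    qed
    ultimately show ?thesis using It(1) by blast
  qed
qed

text \<open>Both bases are optimal for \<open>x\<close>: the dual form of each bounds the cost of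
  the other from below, so the costs agree. Equality makes the dual form of \<open>I\<close> tight
  at every point of \<open>J\<close> (complementary slackness), and genericity allows tightness only
  on \<open>I\<close>.\<close>

lemma feasible_bases_disjoint:
  fixes P V :: "'a::euclidean_space set"
  assumes gen: "generic_weights P V \<theta>"
    and I: "I \<in> feasible_bases P V \<theta>" and J: "J \<in> feasible_bases P V \<theta>"
    and s: "\<And>p. p \<in> I \<Longrightarrow> 0 < s p" "x - (\<Sum>p\<in>I. s p *\<^sub>R p) \<in> span V"
    and t: "\<And>p. p \<in> J \<Longrightarrow> 0 < t p" "x - (\<Sum>p\<in>J. t p *\<^sub>R p) \<in> span V"
  shows "I = J"
proof -
  have le: "(\<Sum>p\<in>I. \<theta> p * s p) \<le> (\<Sum>p\<in>J. \<theta> p * t p)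
      \<and> ((\<Sum>p\<in>I. \<theta> p * s p) = (\<Sum>p\<in>J. \<theta> p * t p) \<longrightarrow> J \<subseteq> I)"
    if I: "I \<in> feasible_bases P V \<theta>" and J: "J \<in> feasible_bases P V \<theta>"
    and s: "x - (\<Sum>p\<in>I. s p *\<^sub>R p) \<in> span V"
    and t: "\<And>p. p \<in> J \<Longrightarrow> 0 < t p" "x - (\<Sum>p\<in>J. t p *\<^sub>R p) \<in> span V" for I J s t
  proof -
    have cI: "complements V I" "I \<subseteq> P" and cJ: "complements V J" "J \<subseteq> P"
      using I J by (auto simp: feasible_bases_def)
    obtain y :: "'a \<Rightarrow> real" where y: "linear y" "\<And>p. p \<in> I \<Longrightarrow> y p = \<theta> p" "\<And>v. v \<in> V \<Longrightarrow> y v = 0"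
      using exists_linear_weights[of I V \<theta>] cI by (auto simp: complements_def)
    have yle: "y q \<le> \<theta> q" if "q \<in> P" for q
      using I y that unfolding feasible_bases_def by blast
    have yne: "y q \<noteq> \<theta> q" if "q \<in> P - I" for q
      using gen cI y that unfolding generic_weights_def by blast
    have finJ: "finite J"
      using cJ independent_imp_finite by (auto simp: complements_def)
    have yx: "y x = (\<Sum>p\<in>I. \<theta> p * s p)"
      using y s by (intro linear_weights_eq[where V=V]) auto
    have yx': "y x = (\<Sum>p\<in>J. y p * t p)"
      using linear_weights_eq[of y J y V x t] y t(2) by auto
    have tle: "y p * t p \<le> \<theta> p * t p" if "p \<in> J" for p
      using yle[of p] t(1)[OF that] cJ that by (intro mult_right_mono) auto
    have "J \<subseteq> I" if eq: "(\<Sum>p\<in>I. \<theta> p * s p) = (\<Sum>p\<in>J. \<theta> p * t p)"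
    proof
      fix q assume q: "q \<in> J"
      have "(\<Sum>p\<in>J. \<theta> p * t p - y p * t p) = 0"
        using eq yx yx' by (simp add: sum_subtractf)
      then have "\<theta> q * t q - y q * t q = 0"
        using finJ q tle by (subst (asm) sum_nonneg_eq_0_iff) auto
      then have "y q = \<theta> q" using t(1)[OF q] by simp
      then show "q \<in> I" using yne[of q] q cJ by auto
    qed
    moreover have "(\<Sum>p\<in>I. \<theta> p * s p) \<le> (\<Sum>p\<in>J. \<theta> p * t p)"
      unfolding yx[symmetric] yx' using tle by (rule sum_mono)
    ultimately show ?thesis by blast
  qed
  show ?thesis
    using le[OF I J s(2) t] le[OF J I t(2) s] by auto
qed

section \<open>Generic weights close to 1\<close>

lemma generic_weights_exist:
  fixes P V :: "'a::euclidean_space set"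
  assumes P: "finite P" and \<eta>: "0 < \<eta>" "\<eta> < 1"
  obtains \<theta> where "generic_weights P V \<theta>" "\<And>p. 1 - \<eta> \<le> \<theta> p" "\<And>p. \<theta> p \<le> 1"
proof -
  obtain h :: "'a \<Rightarrow> nat" where h: "inj_on h P"
    using P by (metis finite_imp_inj_to_nat_seg)
  define \<sigma> where "\<sigma> I q = (SOME \<sigma>. q - (\<Sum>p\<in>I. \<sigma> p *\<^sub>R p) \<in> span V)" for I and q :: 'a
  have \<sigma>: "q - (\<Sum>p\<in>I. \<sigma> I q p *\<^sub>R p) \<in> span V" if "complements V I" for I q
  proof -
    have "\<exists>\<sigma>. q - (\<Sum>p\<in>I. \<sigma> p *\<^sub>R p) \<in> span V"
      using complements_decomp[OF that, of q] by blast
    then show ?thesis unfolding \<sigma>_def by (rule someI_ex)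
  qed
  \<comment> \<open>The value at \<open>e\<close> is the slack \<open>y q - \<theta> q\<close> of
    the dual form \<open>y\<close> of \<open>I\<close> when
    \<open>\<theta> p = 1 - e ^ Suc (h p)\<close>. The \<open>Suc\<close> separates the exponents
    from the constant term, and injectivity of \<open>h\<close> makes the coefficient at
    \<open>Suc (h q)\<close> equal to 1, so the polynomial is not zero.\<close>
  define f where "f I q = [:(\<Sum>p\<in>I. \<sigma> I q p) - 1:] - (\<Sum>p\<in>I. monom (\<sigma> I q p) (Suc (h p)))
     + monom 1 (Suc (h q))" for I q
  have f0: "f I q \<noteq> 0" if "I \<subseteq> P" "q \<in> P - I" for I q
  proof -
    have "h p \<noteq> h q" if "p \<in> I" for p
      using h that \<open>I \<subseteq> P\<close> \<open>q \<in> P - I\<close> by (auto dest: inj_onD)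
    then have "coeff (f I q) (Suc (h q)) = 1"
      by (simp add: f_def coeff_sum)
    then show ?thesis by auto
  qed
  define Z where "Z = (\<Union>I\<in>Pow P. \<Union>q\<in>P - I. {e. poly (f I q) e = 0})"
  have "finite Z"
    unfolding Z_def using P f0 by (intro finite_UN_I) (auto intro: poly_roots_finite)
  then have "infinite ({0<..<\<eta>} - Z)"
    using \<eta> by simp
  then obtain e where e: "0 < e" "e < \<eta>" "e \<notin> Z"
    by (metis Diff_iff finite.emptyI greaterThanLessThan_iff ex_in_conv)
  \<comment> \<open>Along this curve every degeneracy is a nonzero polynomial equation in $e$.\<close>
  define \<theta> where "\<theta> p = 1 - e ^ Suc (h p)" for p
  show ?thesis
  proof (rule that[of \<theta>])
    show "\<theta> p \<le> 1" for p using e by (simp add: \<theta>_def)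
    show "1 - \<eta> \<le> \<theta> p" for p
    proof -
      have "e ^ Suc (h p) \<le> e * 1"
        unfolding power_Suc using e \<eta> by (intro mult_left_mono power_le_one) auto
      then have "e ^ Suc (h p) \<le> \<eta>" using e by linarith
      then show ?thesis unfolding \<theta>_def by linarith
    qed
    show "generic_weights P V \<theta>"
      unfolding generic_weights_def
    proof (intro allI impI ballI)
      fix I y q
      assume I: "I \<subseteq> P" "complements V I" and y: "linear y" "\<forall>p\<in>I. y p = \<theta> p" "\<forall>v\<in>V. y v = 0"
        and q: "q \<in> P - I"
      have "poly (f I q) e \<noteq> 0"
        using e(3) I(1) q by (auto simp: Z_def)
      moreover have "poly (f I q) e = (\<Sum>p\<in>I. \<theta> p * \<sigma> I q p) - \<theta> q"
        by (simp add: f_def poly_sum poly_monom \<theta>_def algebra_simps sum_subtractf)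
      moreover have "y q = (\<Sum>p\<in>I. \<theta> p * \<sigma> I q p)"
        using y \<sigma>[OF I(2), of q] by (intro linear_weights_eq[where V=V]) auto
      ultimately show "y q \<noteq> \<theta> q" by simp
    qed
  qed
qed

section \<open>Volumes of sums with segments\<close>

definition minkowski_sum :: "'a::euclidean_space set \<Rightarrow> 'a set \<Rightarrow> 'a set" where
  "minkowski_sum A B = {x + y | x y. x \<in> A \<and> y \<in> B}"

text \<open>Indexed by \<open>J\<close>, since generators may coincide, and with a separate length
  for every index, so that the volume can be studied one length at a time.\<close>

definition segment_sum :: "'b set \<Rightarrow> ('b \<Rightarrow> 'a::euclidean_space) \<Rightarrow> ('b \<Rightarrow> real) \<Rightarrow> 'a set" where
  "segment_sum J v t = {\<Sum>j\<in>J. z j *\<^sub>R v j | z. \<forall>j\<in>J. 0 \<le> z j \<and> z j \<le> t j}"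

abbreviation zonotope_sum :: "'a::euclidean_space set \<Rightarrow> 'b set \<Rightarrow> ('b \<Rightarrow> 'a) \<Rightarrow> real \<Rightarrow> 'a set" where
  "zonotope_sum K S v \<tau> \<equiv> minkowski_sum K (segment_sum S v (\<lambda>_. \<tau>))"

lemma compact_minkowski_sum: "compact A \<Longrightarrow> compact B \<Longrightarrow> compact (minkowski_sum A B)"
  unfolding minkowski_sum_def by (rule compact_sums)

lemma convex_minkowski_sum:
  assumes "convex A" "convex B"
  shows "convex (minkowski_sum A B)"
proof -
  have "minkowski_sum A B = (\<Union>x\<in>A. \<Union>y\<in>B. {x + y})"
    by (auto simp: minkowski_sum_def)
  then show ?thesis using convex_sums[OF assms] by simp
qed

lemma minkowski_sum_mono: "A \<subseteq> A' \<Longrightarrow> B \<subseteq> B' \<Longrightarrow> minkowski_sum A B \<subseteq> minkowski_sum A' B'"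
  unfolding minkowski_sum_def by blast

lemma minkowski_sum_assoc:
  "minkowski_sum (minkowski_sum A B) C = minkowski_sum A (minkowski_sum B C)"
  unfolding minkowski_sum_def
  by (auto, metis add.assoc, metis add.assoc)

lemma minkowski_sum_0 [simp]: "minkowski_sum A {0} = A"
  by (simp add: minkowski_sum_def)

lemma measure_minkowski_sum_mono:
  assumes "compact A" "compact B" "compact A'" "compact B'" "A \<subseteq> A'" "B \<subseteq> B'"
  shows "vol (minkowski_sum A B) \<le> vol (minkowski_sum A' B')"
  using assms
  by (intro measure_mono_fmeasurable minkowski_sum_mono)
     (auto intro: lmeasurable_compact compact_minkowski_sum fmeasurableD)

lemma segment_sum_empty [simp]: "segment_sum {} v t = {0}"
  by (simp add: segment_sum_def)

lemma segment_sum_cong: "(\<And>j. j \<in> J \<Longrightarrow> t j = t' j) \<Longrightarrow> segment_sum J v t = segment_sum J v t'"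
  unfolding segment_sum_def by (simp cong: ball_cong)

lemma segment_sum_insert:
  assumes "finite J" "j \<notin> J"
  shows "segment_sum (insert j J) v t = minkowski_sum (segment_sum J v t) ((\<lambda>r. r *\<^sub>R v j) ` {0..t j})"
proof (intro set_eqI iffI)
  fix x assume "x \<in> segment_sum (insert j J) v t"
  then obtain z where z: "x = (\<Sum>i\<in>insert j J. z i *\<^sub>R v i)" "\<forall>i\<in>insert j J. 0 \<le> z i \<and> z i \<le> t i"
    unfolding segment_sum_def by blast
  have "x = (\<Sum>i\<in>J. z i *\<^sub>R v i) + z j *\<^sub>R v j"
    using z(1) assms by (simp add: add.commute)
  moreover have "(\<Sum>i\<in>J. z i *\<^sub>R v i) \<in> segment_sum J v t"
    using z(2) unfolding segment_sum_def by auto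
  moreover have "z j *\<^sub>R v j \<in> (\<lambda>r. r *\<^sub>R v j) ` {0..t j}"
    using z(2) by auto
  ultimately show "x \<in> minkowski_sum (segment_sum J v t) ((\<lambda>r. r *\<^sub>R v j) ` {0..t j})"
    unfolding minkowski_sum_def by blast
next
  fix x assume "x \<in> minkowski_sum (segment_sum J v t) ((\<lambda>r. r *\<^sub>R v j) ` {0..t j})"
  then obtain z r where z: "x = (\<Sum>i\<in>J. z i *\<^sub>R v i) + r *\<^sub>R v j" "\<forall>i\<in>J. 0 \<le> z i \<and> z i \<le> t i"
    and r: "0 \<le> r" "r \<le> t j"
    unfolding minkowski_sum_def segment_sum_def by auto
  have "(\<Sum>i\<in>insert j J. (z(j := r)) i *\<^sub>R v i) = r *\<^sub>R v j + (\<Sum>i\<in>J. z i *\<^sub>R v i)"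
    using assms by (subst sum.insert) (auto intro!: sum.cong)
  then have "x = (\<Sum>i\<in>insert j J. (z(j := r)) i *\<^sub>R v i)"
    using z(1) by simp
  moreover have "\<forall>i\<in>insert j J. 0 \<le> (z(j := r)) i \<and> (z(j := r)) i \<le> t i"
    using z(2) r by auto
  ultimately show "x \<in> segment_sum (insert j J) v t"
    unfolding segment_sum_def by blast
qed

lemma compact_segment: "compact ((\<lambda>r. r *\<^sub>R (w::'a::euclidean_space)) ` {0..s::real})"
  by (intro compact_continuous_image continuous_intros) auto

lemma convex_segment: "convex ((\<lambda>r. r *\<^sub>R (w::'a::euclidean_space)) ` {0..s::real})"
  by (intro convex_linear_image) (auto intro: linearI simp: scaleR_add_left)

lemma compact_convex_segment_sum:
  assumes "finite J"
  shows "compact (segment_sum J v t) \<and> convex (segment_sum J v t)"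
  using assms
  by (induction J) (auto simp: segment_sum_insert intro!: compact_minkowski_sum convex_minkowski_sum
      compact_segment convex_segment)

section \<open>Dependence of the volume on the segment lengths\<close>

lemma nonneg_additive_linear:
  fixes g :: "real \<Rightarrow> real"
  assumes add: "\<And>a b. 0 \<le> a \<Longrightarrow> 0 \<le> b \<Longrightarrow> g (a + b) = g a + g b"
    and nn: "\<And>a. 0 \<le> a \<Longrightarrow> 0 \<le> g a" and s: "0 \<le> s"
  shows "g s = s * g 1"
proof -
  have g0: "g 0 = 0" using add[of 0 0] by simp
  have gn: "g (real n * a) = real n * g a" if "0 \<le> a" for n a
    using that by (induction n) (auto simp: g0 algebra_simps add)
  \<comment> \<open>Nonnegativity makes an additive function monotone, which excludes the irregular
    solutions of Cauchy's equation. Below, \<open>N * s\<close> is caught between the integers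
    \<open>m\<close> and \<open>m + 1\<close>.\<close>
  have mono: "g a \<le> g b" if "0 \<le> a" "a \<le> b" for a b
    using add[of a "b - a"] nn[of "b - a"] that by simp
  have "\<bar>g s - s * g 1\<bar> \<le> g 1 / real (Suc n)" for n
  proof -
    define N where "N = real (Suc n)"
    have N: "N > 0" by (simp add: N_def)
    define m where "m = nat \<lfloor>N * s\<rfloor>"
    have m: "real m \<le> N * s" "N * s \<le> real (Suc m)"
      using s N unfolding m_def by (simp_all add: of_nat_nat) linarith
    have e: "g (N * s) = N * g s"
      unfolding N_def by (rule gn[OF s])
    have "real m * g 1 \<le> N * g s"
      using mono[OF _ m(1)] gn[of 1 m] e by simp
    moreover have "N * g s \<le> (real m + 1) * g 1"
      using mono[OF _ m(2)] gn[of 1 "Suc m"] e s N by (simp add: add.commute)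
    moreover have "real m * g 1 \<le> N * s * g 1" "N * s * g 1 \<le> (real m + 1) * g 1"
      using m nn[of 1] by (auto intro!: mult_right_mono)
    ultimately have "\<bar>N * g s - N * s * g 1\<bar> \<le> g 1"
      by (simp add: algebra_simps abs_le_iff)
    then have "N * \<bar>g s - s * g 1\<bar> \<le> g 1"
      using N by (simp add: abs_mult_pos' algebra_simps abs_mult flip: abs_mult_pos)
    then have "\<bar>g s - s * g 1\<bar> \<le> g 1 / N"
      using N by (simp add: pos_le_divide_eq mult.commute)
    then show ?thesis unfolding N_def .
  qed
  then have "\<bar>g s - s * g 1\<bar> \<le> 0"
    by (intro LIMSEQ_le_const[OF LIMSEQ_Suc[OF lim_const_over_n[of "g 1"]]]) auto
  then show ?thesis by simp
qed

text \<open>For $a, b \ge 0$ the set $K + [0, a + b]w$ is the union of $K + [0, a]w$ and $aw + K + [0, b]w$, which by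
  convexity of $K$ intersect in the translate $aw + K$.\<close>

lemma measure_sum_segment_affine:
  fixes K :: "'a::euclidean_space set" and w :: 'a
  assumes K: "compact K" "convex K" and s: "0 \<le> s"
  defines "f \<equiv> \<lambda>s. vol (minkowski_sum K ((\<lambda>r. r *\<^sub>R w) ` {0..s}))"
  shows "f s = f 0 + s * (f 1 - f 0)"
proof -
  define L where "L s = minkowski_sum K ((\<lambda>r. r *\<^sub>R w) ` {0..s})" for s
  have Lc: "compact (L s)" for s
    unfolding L_def using K compact_segment by (intro compact_minkowski_sum)
  have f: "f s = vol (L s)" for s
    by (simp add: f_def L_def)
  have L0: "L 0 = K" by (simp add: L_def)
  have memL: "x \<in> L a \<longleftrightarrow> (\<exists>k\<in>K. \<exists>r. 0 \<le> r \<and> r \<le> a \<and> x = k + r *\<^sub>R w)" for x a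
    unfolding L_def minkowski_sum_def by (auto simp: Bex_def image_iff)
  have add: "f (a + b) = f a + f b - f 0" if ab: "0 \<le> a" "0 \<le> b" for a b
  proof -
    have memT: "x \<in> (+) (a *\<^sub>R w) ` L b \<longleftrightarrow> (\<exists>k\<in>K. \<exists>r. a \<le> r \<and> r \<le> a + b \<and> x = k + r *\<^sub>R w)" for x
    proof
      assume "x \<in> (+) (a *\<^sub>R w) ` L b"
      then obtain k r where "k \<in> K" "0 \<le> r" "r \<le> b" "x = k + (a + r) *\<^sub>R w"
        by (auto simp: memL algebra_simps)
      then show "\<exists>k\<in>K. \<exists>r. a \<le> r \<and> r \<le> a + b \<and> x = k + r *\<^sub>R w"
        by (intro bexI[of _ k] exI[of _ "a + r"]) auto
    next
      assume "\<exists>k\<in>K. \<exists>r. a \<le> r \<and> r \<le> a + b \<and> x = k + r *\<^sub>R w"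
      then obtain k r where kr: "k \<in> K" "a \<le> r" "r \<le> a + b" "x = k + r *\<^sub>R w" by blast
      then have "k + (r - a) *\<^sub>R w \<in> L b" unfolding memL by (intro bexI[of _ k] exI[of _ "r - a"]) auto
      then show "x \<in> (+) (a *\<^sub>R w) ` L b"
        using kr by (intro image_eqI[of _ _ "k + (r - a) *\<^sub>R w"]) (auto simp: algebra_simps)
    qed
    have U: "L (a + b) = L a \<union> (+) (a *\<^sub>R w) ` L b"
    proof (intro set_eqI iffI)
      fix x assume "x \<in> L (a + b)"
      then obtain k r where kr: "k \<in> K" "0 \<le> r" "r \<le> a + b" "x = k + r *\<^sub>R w"
        unfolding memL by blast
      show "x \<in> L a \<union> (+) (a *\<^sub>R w) ` L b"
      proof (cases "r \<le> a")
        case True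
        then show ?thesis using kr unfolding Un_iff memL memT by blast
      next
        case False
        then have "a \<le> r" by simp
        then show ?thesis using kr unfolding Un_iff memL memT by blast
      qed
    next
      fix x assume "x \<in> L a \<union> (+) (a *\<^sub>R w) ` L b"
      then show "x \<in> L (a + b)"
        unfolding Un_iff memL memT using ab by (meson add_increasing2 order_trans)
    qed
    have I: "L a \<inter> (+) (a *\<^sub>R w) ` L b = (+) (a *\<^sub>R w) ` K"
    proof (intro set_eqI iffI)
      fix x assume "x \<in> L a \<inter> (+) (a *\<^sub>R w) ` L b"
      then obtain k r k' r' where k: "k \<in> K" "r \<le> a" "x = k + r *\<^sub>R w"
        and k': "k' \<in> K" "a \<le> r'" "x = k' + r' *\<^sub>R w"
        unfolding Int_iff memL memT by blast
      show "x \<in> (+) (a *\<^sub>R w) ` K"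
      proof (cases "r = r'")
        case True
        then show ?thesis using k k' by (intro image_eqI[of _ _ k]) auto
      next
        case False
        then have d: "r' - r > 0" using k k' by simp
        \<comment> \<open>The points \<open>k\<close> and \<open>k'\<close> of \<open>K\<close> lie
          on a line parallel to \<open>w\<close>. With the weight \<open>c\<close> the parameters
          \<open>r\<close> and \<open>r'\<close> average to \<open>a\<close>, so the corresponding
          point of \<open>K\<close> is \<open>x - a *\<^sub>R w\<close>.\<close>
        define c where "c = (r' - a) / (r' - r)"
        have c: "0 \<le> c" "c \<le> 1"
          using d k k' by (auto simp: c_def)
        have "c *\<^sub>R k + (1 - c) *\<^sub>R k' \<in> K"
          using K(2) k k' c by (intro convexD) auto
        moreover have "c *\<^sub>R k + (1 - c) *\<^sub>R k' = x - a *\<^sub>R w"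
        proof -
          have kk: "k = x - r *\<^sub>R w" "k' = x - r' *\<^sub>R w"
            using k k' by (auto simp: algebra_simps)
          have "c * r + (1 - c) * r' = r' - c * (r' - r)" by (simp add: algebra_simps)
          also have "\<dots> = a" using d by (simp add: c_def)
          finally have e: "c * r + (1 - c) * r' = a" .
          have "c *\<^sub>R k + (1 - c) *\<^sub>R k' = x - (c * r + (1 - c) * r') *\<^sub>R w"
            unfolding kk by (simp add: algebra_simps)
          then show ?thesis unfolding e .
        qed
        ultimately show ?thesis
          by (intro image_eqI[of _ _ "x - a *\<^sub>R w"]) auto
      qed
    next
      fix x assume "x \<in> (+) (a *\<^sub>R w) ` K"
      then obtain k where "k \<in> K" "x = k + a *\<^sub>R w" by (auto simp: add.commute)
      then show "x \<in> L a \<inter> (+) (a *\<^sub>R w) ` L b"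
        unfolding Int_iff memL memT using ab
        by (intro conjI bexI[of _ k] exI[of _ a]) auto
    qed
    have "vol (L (a + b)) = vol (L a) + vol ((+) (a *\<^sub>R w) ` L b)
       - vol ((+) (a *\<^sub>R w) ` K)"
      unfolding U I[symmetric]
      by (intro measure_Un3) (simp_all add: lmeasurable_compact Lc measurable_translation)
    then show ?thesis
      by (simp add: f L0 measure_translation)
  qed
  have mono: "f 0 \<le> f a" if "0 \<le> a" for a
  proof -
    have "K \<subseteq> L a"
    proof
      fix x assume "x \<in> K"
      then show "x \<in> L a"
        unfolding memL using that by (intro bexI[of _ x] exI[of _ 0]) auto
    qed
    then show ?thesis
      unfolding f L0 using K(1) Lc[of a]
      by (intro measure_mono_fmeasurable) (auto intro: lmeasurable_compact fmeasurableD)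
  qed
  \<comment> \<open>After subtraction of \<open>f 0\<close>, the relation \<open>add\<close> is
    Cauchy's equation.\<close>
  have "f s - f 0 = s * (f 1 - f 0)"
    by (rule nonneg_additive_linear[of "\<lambda>a. f a - f 0"]) (use add mono s in auto)
  then show ?thesis by simp
qed

text \<open>Freezing the new coordinate at 0 and at 1 gives two functions to which the induction
  hypothesis applies, and affinity in that coordinate interpolates between them.\<close>

lemma multiaffine_expansion:
  fixes F :: "('b \<Rightarrow> real) \<Rightarrow> real"
  assumes "finite J"
    and "\<And>t j s. (\<And>i. 0 \<le> t i) \<Longrightarrow> j \<in> J \<Longrightarrow> 0 \<le> s \<Longrightarrow>
           F (t(j := s)) = F (t(j := 0)) + s * (F (t(j := 1)) - F (t(j := 0)))"
  shows "\<exists>c. \<forall>t. (\<forall>i. 0 \<le> t i) \<longrightarrow> (\<forall>i. i \<notin> J \<longrightarrow> t i = 0) \<longrightarrow>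
           F t = (\<Sum>S\<in>Pow J. c S * prod t S)"
  using assms
proof (induction J arbitrary: F)
  case empty
  then show ?case by (auto intro!: exI[of _ "\<lambda>S. F (\<lambda>_. 0)"] arg_cong[where f=F])
next
  case (insert j J)
  have aff: "F (t(j := e, i := s)) = F (t(j := e, i := 0)) + s * (F (t(j := e, i := 1)) - F (t(j := e, i := 0)))"
    if "\<And>i. 0 \<le> t i" "i \<in> J" "0 \<le> s" "0 \<le> e" for t i s e
    by (rule insert.prems) (use that in auto)
  have *: "\<exists>c. \<forall>t. (\<forall>i. 0 \<le> t i) \<longrightarrow> (\<forall>i. i \<notin> J \<longrightarrow> t i = 0) \<longrightarrow>
      F (t(j := e)) = (\<Sum>S\<in>Pow J. c S * prod t S)" if e: "0 \<le> e" for e :: real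
  proof (rule insert.IH)
    fix t :: "'b \<Rightarrow> real" and i s assume t: "\<And>i. 0 \<le> t i" "i \<in> J" "0 \<le> (s::real)"
    have "i \<noteq> j" using t(2) insert.hyps by auto
    then show "F ((t(i := s))(j := e)) = F ((t(i := 0))(j := e)) + s * (F ((t(i := 1))(j := e)) - F ((t(i := 0))(j := e)))"
      using aff[OF t e] by (simp add: fun_upd_twist)
  qed
  obtain c0 where c0: "\<And>t. (\<forall>i. 0 \<le> t i) \<Longrightarrow> (\<forall>i. i \<notin> J \<longrightarrow> t i = 0) \<Longrightarrow>
      F (t(j := 0)) = (\<Sum>S\<in>Pow J. c0 S * prod t S)"
    using *[of 0] by auto
  obtain c1 where c1: "\<And>t. (\<forall>i. 0 \<le> t i) \<Longrightarrow> (\<forall>i. i \<notin> J \<longrightarrow> t i = 0) \<Longrightarrow>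
      F (t(j := 1)) = (\<Sum>S\<in>Pow J. c1 S * prod t S)"
    using *[of 1] by auto
  \<comment> \<open>Subsets containing \<open>j\<close> carry the slope in the coordinate
    \<open>j\<close>, the others the value at 0.\<close>
  define c where "c S = (if j \<in> S then c1 (S - {j}) - c0 (S - {j}) else c0 S)" for S
  show ?case
  proof (intro exI[of _ c] allI impI)
    fix t :: "'b \<Rightarrow> real" assume t: "\<forall>i. 0 \<le> t i" "\<forall>i. i \<notin> insert j J \<longrightarrow> t i = 0"
    define t0 where "t0 = t(j := 0)"
    have t0: "\<forall>i. 0 \<le> t0 i" "\<forall>i. i \<notin> J \<longrightarrow> t0 i = 0"
      using t by (auto simp: t0_def)
    have t0u: "t0(j := e) = t(j := e)" for e by (simp add: t0_def)
    have pr: "prod t0 S = prod t S" if "S \<in> Pow J" for S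
      using that insert.hyps by (intro prod.cong) (auto simp: t0_def)
    have F0: "F (t(j := 0)) = (\<Sum>S\<in>Pow J. c0 S * prod t S)"
      using c0[OF t0] unfolding t0u by (simp add: pr cong: sum.cong_simp)
    have F1: "F (t(j := 1)) = (\<Sum>S\<in>Pow J. c1 S * prod t S)"
      using c1[OF t0] unfolding t0u by (simp add: pr cong: sum.cong_simp)
    have "F t = F (t(j := t j))" by simp
    also have "\<dots> = F (t(j := 0)) + t j * (F (t(j := 1)) - F (t(j := 0)))"
      by (rule insert.prems) (use t in auto)
    also have "\<dots> = (\<Sum>S\<in>Pow J. c0 S * prod t S)
        + (\<Sum>S\<in>Pow J. (c1 S - c0 S) * (t j * prod t S))"
      unfolding F0 F1 by (simp add: sum_distrib_left algebra_simps sum_subtractf)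
    also have "(\<Sum>S\<in>Pow J. c0 S * prod t S) = (\<Sum>S\<in>Pow J. c S * prod t S)"
      using insert.hyps by (intro sum.cong) (auto simp: c_def)
    also have "(\<Sum>S\<in>Pow J. (c1 S - c0 S) * (t j * prod t S))
        = (\<Sum>S\<in>insert j ` Pow J. c S * prod t S)"
    proof (subst sum.reindex)
      show "inj_on (insert j) (Pow J)"
        using insert.hyps by (auto simp: inj_on_def)
      show "(\<Sum>S\<in>Pow J. (c1 S - c0 S) * (t j * prod t S))
        = sum ((\<lambda>S. c S * prod t S) \<circ> insert j) (Pow J)"
      proof (intro sum.cong refl)
        fix S assume S: "S \<in> Pow J"
        then have "finite S" "j \<notin> S" using insert.hyps finite_subset by auto
        then show "(c1 S - c0 S) * (t j * prod t S) = ((\<lambda>S. c S * prod t S) \<circ> insert j) S"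
          by (simp add: c_def)
      qed
    qed
    also have "(\<Sum>S\<in>Pow J. c S * prod t S) + (\<Sum>S\<in>insert j ` Pow J. c S * prod t S)
       = (\<Sum>S\<in>Pow (insert j J). c S * prod t S)"
      unfolding Pow_insert using insert.hyps by (intro sum.union_disjoint[symmetric]) auto
    finally show "F t = (\<Sum>S\<in>Pow (insert j J). c S * prod t S)" .
  qed
qed

text \<open>One family \<open>c\<close> serves every \<open>S\<close>, since setting the lengths
  outside \<open>S\<close> to 0 turns the expansion over \<open>J\<close> into one over
  \<open>S\<close>. The limit exhibits \<open>c S\<close> as the leading coefficient and hence as a
  quantity that does not depend on \<open>J\<close>.\<close>

lemma measure_zonotope_expansion:
  fixes K :: "'a::euclidean_space set" and v :: "'b \<Rightarrow> 'a"
  assumes K: "compact K" "convex K" and J: "finite J"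
  shows "\<exists>c. \<forall>S\<subseteq>J.
      (\<forall>\<tau>\<ge>0. vol (zonotope_sum K S v \<tau>) = (\<Sum>T\<in>Pow S. c T * \<tau> ^ card T)) \<and>
      ((\<lambda>\<tau>. vol (zonotope_sum K S v \<tau>) / \<tau> ^ card S) \<longlongrightarrow> c S) at_top"
proof -
  define F where "F t = vol (minkowski_sum K (segment_sum J v t))" for t
  have "\<exists>c. \<forall>t. (\<forall>i. 0 \<le> t i) \<longrightarrow> (\<forall>i. i \<notin> J \<longrightarrow> t i = 0) \<longrightarrow>
           F t = (\<Sum>S\<in>Pow J. c S * prod t S)"
  proof (rule multiaffine_expansion[OF J])
    fix t :: "'b \<Rightarrow> real" and j s assume t: "\<And>i. 0 \<le> t i" and j: "j \<in> J" and s: "0 \<le> (s::real)"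
    define L where "L = minkowski_sum K (segment_sum (J - {j}) v t)"
    have L: "compact L" "convex L"
      using K J compact_convex_segment_sum[of "J - {j}" v t]
      by (auto simp: L_def intro: compact_minkowski_sum convex_minkowski_sum)
    have F: "F (t(j := r)) = vol (minkowski_sum L ((\<lambda>r. r *\<^sub>R v j) ` {0..r}))" for r
    proof -
      have "segment_sum J v (t(j := r)) = segment_sum (insert j (J - {j})) v (t(j := r))"
        using j by (simp add: insert_absorb)
      also have "\<dots> = minkowski_sum (segment_sum (J - {j}) v (t(j := r))) ((\<lambda>r. r *\<^sub>R v j) ` {0..r})"
        using J by (subst segment_sum_insert) auto
      also have "segment_sum (J - {j}) v (t(j := r)) = segment_sum (J - {j}) v t"
        by (intro segment_sum_cong) auto
      finally have e: "segment_sum J v (t(j := r))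
          = minkowski_sum (segment_sum (J - {j}) v t) ((\<lambda>r. r *\<^sub>R v j) ` {0..r})" .
      show ?thesis
        unfolding F_def e L_def minkowski_sum_assoc ..
    qed
    show "F (t(j := s)) = F (t(j := 0)) + s * (F (t(j := 1)) - F (t(j := 0)))"
      unfolding F by (rule measure_sum_segment_affine[OF L s])
  qed
  then obtain c where c: "\<And>t. (\<forall>i. 0 \<le> t i) \<Longrightarrow> (\<forall>i. i \<notin> J \<longrightarrow> t i = 0) \<Longrightarrow>
           F t = (\<Sum>S\<in>Pow J. c S * prod t S)"
    by blast
  have exp: "vol (zonotope_sum K S v \<tau>)
        = (\<Sum>T\<in>Pow S. c T * \<tau> ^ card T)" if S: "S \<subseteq> J" and \<tau>: "0 \<le> \<tau>" for S \<tau>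
  proof -
    define t where "t j = (if j \<in> S then \<tau> else 0)" for j
    have finS: "finite S" using S J finite_subset by blast
    have IS: "J \<inter> S = S" using S by blast
    have "segment_sum J v t = segment_sum S v (\<lambda>_. \<tau>)"
    proof (intro set_eqI iffI)
      fix x assume "x \<in> segment_sum J v t"
      then obtain z where z: "x = (\<Sum>j\<in>J. z j *\<^sub>R v j)" "\<forall>j\<in>J. 0 \<le> z j \<and> z j \<le> t j"
        unfolding segment_sum_def by blast
      have "x = (\<Sum>j\<in>S. z j *\<^sub>R v j)"
        unfolding z(1) using J S z(2) by (intro sum.mono_neutral_right) (force simp: t_def)+
      then show "x \<in> segment_sum S v (\<lambda>_. \<tau>)"
        using z(2) S unfolding segment_sum_def t_def by (force intro!: exI[of _ z])
    next
      fix x assume "x \<in> segment_sum S v (\<lambda>_. \<tau>)"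
      then obtain z where z: "x = (\<Sum>j\<in>S. z j *\<^sub>R v j)" "\<forall>j\<in>S. 0 \<le> z j \<and> z j \<le> \<tau>"
        unfolding segment_sum_def by blast
      have "x = (\<Sum>j\<in>J. (if j \<in> S then z j else 0) *\<^sub>R v j)"
        unfolding z(1) using J S by (intro sum.mono_neutral_cong_left) auto
      then show "x \<in> segment_sum J v t"
        using z(2) unfolding segment_sum_def t_def
        by (auto intro!: exI[of _ "\<lambda>j. if j \<in> S then z j else 0"])
    qed
    then have "vol (zonotope_sum K S v \<tau>) = F t"
      by (simp add: F_def)
    also have "\<dots> = (\<Sum>T\<in>Pow J. c T * prod t T)"
      using S \<tau> by (intro c) (auto simp: t_def)
    also have "\<dots> = (\<Sum>T\<in>Pow S. c T * \<tau> ^ card T)"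
    proof (rule sum.mono_neutral_cong_right)
      show "\<forall>T\<in>Pow J - Pow S. c T * prod t T = 0"
      proof
        fix T assume "T \<in> Pow J - Pow S"
        then obtain i where "finite T" "i \<in> T" "i \<notin> S"
          using J finite_subset by blast
        then have "finite T" "i \<in> T" "t i = 0" by (auto simp: t_def)
        then have "prod t T = 0" by (meson prod_zero)
        then show "c T * prod t T = 0" by simp
      qed
      fix T assume "T \<in> Pow S"
      then have "prod t T = (\<Prod>i\<in>T. \<tau>)"
        by (intro prod.cong) (auto simp: t_def)
      then show "c T * prod t T = c T * \<tau> ^ card T" by simp
    qed (use J S in auto)
    finally show ?thesis .
  qed
  show ?thesis
  proof (intro exI[of _ c] allI impI conjI)
    fix S assume S: "S \<subseteq> J"
    have finS: "finite S" using S J finite_subset by blast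
    have lim: "((\<lambda>\<tau>. c T * (\<tau> ^ card T / \<tau> ^ card S)) \<longlongrightarrow> (if T = S then c S else 0)) at_top"
      if T: "T \<in> Pow S" for T
    proof (cases "T = S")
      case True
      have "eventually (\<lambda>\<tau>. c S = c T * (\<tau> ^ card T / \<tau> ^ card S)) (at_top :: real filter)"
        using eventually_gt_at_top[of 0] by eventually_elim (simp add: True)
      then show ?thesis using True by (auto intro: tendsto_eventually elim: eventually_mono)
    next
      case False
      then have "card T < card S"
        using T finS by (intro psubset_card_mono) auto
      then have d: "card S - card T > 0" by simp
      have "((\<lambda>\<tau>::real. c T * inverse (\<tau> ^ (card S - card T))) \<longlongrightarrow> c T * 0) at_top"
        by (intro tendsto_mult tendsto_const tendsto_inverse_0_at_top
            filterlim_pow_at_top[OF d] filterlim_ident)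
      moreover have "eventually (\<lambda>\<tau>::real. c T * inverse (\<tau> ^ (card S - card T)) = c T * (\<tau> ^ card T / \<tau> ^ card S)) at_top"
        using eventually_gt_at_top[of 0]
      proof eventually_elim
        case (elim \<tau>)
        have "\<tau> ^ card S = \<tau> ^ (card S - card T) * \<tau> ^ card T"
          using \<open>card T < card S\<close> by (simp flip: power_add)
        then show ?case using elim by (simp add: field_simps)
      qed
      ultimately show ?thesis using False by (simp add: tendsto_cong)
    qed
    have "((\<lambda>\<tau>. \<Sum>T\<in>Pow S. c T * (\<tau> ^ card T / \<tau> ^ card S)) \<longlongrightarrow> (\<Sum>T\<in>Pow S. if T = S then c S else 0)) at_top"
      by (intro tendsto_sum lim)
    also have "(\<Sum>T\<in>Pow S. if T = S then c S else 0) = c S"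
      using finS by simp
    finally have "((\<lambda>\<tau>. \<Sum>T\<in>Pow S. c T * (\<tau> ^ card T / \<tau> ^ card S)) \<longlongrightarrow> c S) at_top" .
    moreover have "eventually (\<lambda>\<tau>. (\<Sum>T\<in>Pow S. c T * (\<tau> ^ card T / \<tau> ^ card S))
        = vol (zonotope_sum K S v \<tau>) / \<tau> ^ card S) at_top"
      using eventually_ge_at_top[of 0]
      by eventually_elim (simp add: exp[OF S] sum_divide_distrib)
    ultimately show "((\<lambda>\<tau>. vol (zonotope_sum K S v \<tau>) / \<tau> ^ card S)
        \<longlongrightarrow> c S) at_top"
      by (rule Lim_transform_eventually)
  qed (use exp in auto)
qed

section \<open>The inequality for a single zonotope coefficient\<close>

text \<open>Normalising both sums to 1 reduces the claim to Young's inequality for each term. If a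
  sum is 0, so are all its terms, and the convention that 0 to any power is 0 makes the left side
  vanish.\<close>

lemma Holder_sum_powr:
  fixes x y :: "'b \<Rightarrow> real"
  assumes x: "\<And>i. i \<in> S \<Longrightarrow> 0 \<le> x i" and y: "\<And>i. i \<in> S \<Longrightarrow> 0 \<le> y i"
    and l: "0 < l" "l < 1" and S: "finite S"
  shows "(\<Sum>i\<in>S. x i powr l * y i powr (1 - l)) \<le> (\<Sum>i\<in>S. x i) powr l * (\<Sum>i\<in>S. y i) powr (1 - l)"
proof (cases "(\<Sum>i\<in>S. x i) = 0 \<or> (\<Sum>i\<in>S. y i) = 0")
  case True
  then have "(\<forall>i\<in>S. x i = 0) \<or> (\<forall>i\<in>S. y i = 0)"
    using x y S by (auto simp: sum_nonneg_eq_0_iff)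
  then have "(\<Sum>i\<in>S. x i powr l * y i powr (1 - l)) = 0"
    by (intro sum.neutral) auto
  then show ?thesis by simp
next
  case False
  define X where "X = (\<Sum>i\<in>S. x i)"
  define Y where "Y = (\<Sum>i\<in>S. y i)"
  have XY: "X > 0" "Y > 0"
    using False x y sum_nonneg[of S x] sum_nonneg[of S y] unfolding X_def Y_def by force+
  define C where "C = X powr l * Y powr (1 - l)"
  have C: "C > 0" using XY by (simp add: C_def)
  have young: "x i powr l * y i powr (1 - l) \<le> C * (l * (x i / X) + (1 - l) * (y i / Y))" if i: "i \<in> S" for i
  proof (cases "x i = 0 \<or> y i = 0")
    case True
    then have "x i powr l * y i powr (1 - l) = 0" by auto
    moreover have "0 \<le> C * (l * (x i / X) + (1 - l) * (y i / Y))"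
      using x[OF i] y[OF i] l XY C by simp
    ultimately show ?thesis by linarith
  next
    case False
    then have pos: "x i > 0" "y i > 0" using x[OF i] y[OF i] by auto
    have "(x i / X) powr l * (y i / Y) powr (1 - l) \<le> l * (x i / X) + (1 - l) * (y i / Y)"
      using pos XY l by (intro Youngs_inequality_0) auto
    moreover have "(x i / X) powr l * (y i / Y) powr (1 - l) = x i powr l * y i powr (1 - l) / C"
      using pos XY by (simp add: powr_divide C_def)
    ultimately show ?thesis using C by (simp add: pos_divide_le_eq mult.commute)
  qed
  have "(\<Sum>i\<in>S. x i powr l * y i powr (1 - l)) \<le> (\<Sum>i\<in>S. C * (l * (x i / X) + (1 - l) * (y i / Y)))"
    using young by (rule sum_mono)
  also have "\<dots> = C * (l * ((\<Sum>i\<in>S. x i) / X) + (1 - l) * ((\<Sum>i\<in>S. y i) / Y))"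
    by (simp add: sum_distrib_left[symmetric] sum.distrib sum_divide_distrib[symmetric])
  also have "\<dots> = C" using XY by (simp add: X_def[symmetric] Y_def[symmetric])
  finally show ?thesis by (simp add: C_def X_def Y_def)
qed

lemma scaled_hull_subset:
  fixes A :: "'a::real_vector set"
  assumes A: "convex A" "0 \<in> A" and I: "finite I"
    and s: "\<And>p. p \<in> I \<Longrightarrow> 0 \<le> s p" "(\<Sum>p\<in>I. s p) \<le> 1" and a: "\<And>p. p \<in> I \<Longrightarrow> a p \<in> A"
  shows "(\<Sum>p\<in>I. s p *\<^sub>R a p) \<in> A"
proof (cases "(\<Sum>p\<in>I. s p) = 0")
  case True
  then have "s p = 0" if "p \<in> I" for p
    using s I that by (simp add: sum_nonneg_eq_0_iff)
  then show ?thesis using A by simp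
next
  case False
  define r where "r = (\<Sum>p\<in>I. s p)"
  have r: "0 < r" "r \<le> 1"
    using False s sum_nonneg[of I s] by (auto simp: r_def less_le)
  have "(\<Sum>p\<in>I. (s p / r) *\<^sub>R a p) \<in> A"
    using A(1) I a s r by (intro convex_sum) (auto simp: r_def sum_divide_distrib[symmetric])
  then have "r *\<^sub>R (\<Sum>p\<in>I. (s p / r) *\<^sub>R a p) + (1 - r) *\<^sub>R 0 \<in> A"
    using A r by (intro convexD) auto
  then show ?thesis
    using r by (simp add: scaleR_sum_right)
qed

text \<open>Each coordinate with respect to \<open>V\<close> extends to a linear, hence bounded,
  functional on the whole space. The constant serves to bound the overhang of the prisms.\<close>

lemma span_coordinate_bound:
  fixes V :: "'a::euclidean_space set"
  assumes V: "independent V"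
  obtains B where "B \<ge> 0" "\<And>u v. v \<in> V \<Longrightarrow> \<bar>u v\<bar> \<le> B * norm (\<Sum>v\<in>V. u v *\<^sub>R v)"
proof -
  have finV: "finite V" using V independent_imp_finite by auto
  have "\<exists>\<psi>::'a \<Rightarrow> real. linear \<psi> \<and> (\<forall>x\<in>V. \<psi> x = (if x = v then 1 else 0))" for v
    using linear_independent_extend[OF V, of "\<lambda>x. if x = v then 1 else (0::real)"] by blast
  then obtain \<psi> :: "'a \<Rightarrow> 'a \<Rightarrow> real"
    where \<psi>: "\<And>v. linear (\<psi> v)" "\<And>v x. x \<in> V \<Longrightarrow> \<psi> v x = (if x = v then 1 else 0)" by metis
  have "\<exists>b>0. \<forall>x. \<bar>\<psi> v x\<bar> \<le> b * norm x" for v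
    using linear_bounded_pos[OF \<psi>(1)[of v]] by auto
  then obtain b where b: "\<And>v. b v > 0" "\<And>v x. \<bar>\<psi> v x\<bar> \<le> b v * norm x" by metis
  show ?thesis
  proof (rule that[of "\<Sum>v\<in>V. b v"])
    show "0 \<le> (\<Sum>v\<in>V. b v)" using b(1) by (simp add: sum_nonneg less_imp_le)
    fix u v assume v: "v \<in> V"
    have "\<psi> v (\<Sum>w\<in>V. u w *\<^sub>R w) = (\<Sum>w\<in>V. u w * \<psi> v w)"
      using \<psi>(1)[of v] by (simp add: linear_sum linear_cmul)
    also have "\<dots> = (\<Sum>w\<in>V. if w = v then u w else 0)"
      using \<psi>(2) by (intro sum.cong) auto
    also have "\<dots> = u v" using finV v by simp
    finally have "\<bar>u v\<bar> \<le> b v * norm (\<Sum>w\<in>V. u w *\<^sub>R w)"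
      using b(2)[of v] by metis
    also have "\<dots> \<le> (\<Sum>v\<in>V. b v) * norm (\<Sum>w\<in>V. u w *\<^sub>R w)"
      using b(1) finV v by (intro mult_right_mono member_le_sum) (auto simp: less_imp_le)
    finally show "\<bar>u v\<bar> \<le> (\<Sum>v\<in>V. b v) * norm (\<Sum>v\<in>V. u v *\<^sub>R v)" .
  qed
qed

text \<open>The essential point is that \<open>M\<close> does not depend on \<open>\<tau>\<close>. A
  point of \<open>C\<close> differs from its combination of a feasible basis by a bounded vector of
  \<open>span V\<close>, so the prism coordinates leave the range from 0 to \<open>\<tau>\<close> by
  at most \<open>M\<close>. Degenerate points go to \<open>N\<close>.\<close>

lemma cells_cover_sum:
  fixes C P V :: "'a::euclidean_space set"
  assumes P: "finite P" and V: "independent V"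
    and C: "bounded C" "\<And>x. x \<in> C \<Longrightarrow> \<exists>s. (\<forall>p\<in>P. 0 \<le> s p) \<and> (\<Sum>p\<in>P. s p) \<le> 1 \<and> x = (\<Sum>p\<in>P. s p *\<^sub>R p)"
    and \<theta>: "\<And>p. 0 < \<theta> p" "\<And>p. \<theta> p \<le> 1"
  shows "\<exists>M N. M > 0 \<and> negligible N \<and>
    (\<forall>\<tau>\<ge>0. zonotope_sum C V (\<lambda>v. v) \<tau>
        \<subseteq> N \<union> (\<Union>I\<in>feasible_bases P V \<theta>. cell I V \<theta> (- M) (\<tau> + M)))"
proof -
  have finV: "finite V" using V independent_imp_finite by auto
  obtain B where B: "B \<ge> 0" "\<And>u v. v \<in> V \<Longrightarrow> \<bar>u v\<bar> \<le> B * norm (\<Sum>v\<in>V. u v *\<^sub>R v)"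
    using span_coordinate_bound[OF V] by metis
  obtain R where R: "R > 0" "\<And>x. x \<in> C \<Longrightarrow> norm x \<le> R"
    using C(1) by (auto simp: bounded_pos)
  define Q where "Q = (\<Sum>p\<in>P. norm p / \<theta> p)"
  have Q: "Q \<ge> 0" unfolding Q_def using \<theta> by (intro sum_nonneg) (simp add: less_imp_le)
  \<comment> \<open>The number \<open>R + Q\<close> bounds the vector of \<open>span V\<close> in
    question and \<open>B\<close> converts this to coordinates; the summand 1 makes \<open>M\<close>
    positive.\<close>
  define M where "M = B * (R + Q) + 1"
  define N where "N = (\<Union>I\<in>{I\<in>Pow P. dim (I \<union> V) < DIM('a)}. span (I \<union> V))"
  show ?thesis
  proof (intro exI[of _ M] exI[of _ N] conjI allI impI)
    show "M > 0" unfolding M_def using B R Q by (simp add: add_nonneg_pos)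
    show "negligible N"
      unfolding N_def using P by (intro negligible_Union) (auto intro: negligible_lowdim simp: dim_span)
    fix \<tau> :: real assume \<tau>: "0 \<le> \<tau>"
    show "zonotope_sum C V (\<lambda>v. v) \<tau>
        \<subseteq> N \<union> (\<Union>I\<in>feasible_bases P V \<theta>. cell I V \<theta> (- M) (\<tau> + M))"
    proof
      fix x assume "x \<in> zonotope_sum C V (\<lambda>v. v) \<tau>"
      then obtain c z where c: "c \<in> C" and z: "\<forall>v\<in>V. 0 \<le> z v \<and> z v \<le> \<tau>"
        and x: "x = c + (\<Sum>v\<in>V. z v *\<^sub>R v)"
        unfolding minkowski_sum_def segment_sum_def by blast
      have zV: "(\<Sum>v\<in>V. z v *\<^sub>R v) \<in> span V"
        by (intro span_sum span_scale span_base)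
      obtain s where s: "\<forall>p\<in>P. 0 \<le> s p" "(\<Sum>p\<in>P. s p) \<le> 1" "c = (\<Sum>p\<in>P. s p *\<^sub>R p)"
        using C(2)[OF c] by blast
      have "c - (\<Sum>p\<in>P. s p *\<^sub>R p) \<in> span V" using s(3) span_0 by simp
      moreover have "(\<Sum>p\<in>P. \<theta> p * s p) \<le> 1"
      proof -
        \<comment> \<open>Weights of at most 1 push the vertices outwards, so the perturbed polytope
          still contains \<open>C\<close>.\<close>
        have "(\<Sum>p\<in>P. \<theta> p * s p) \<le> (\<Sum>p\<in>P. 1 * s p)"
          using s(1) \<theta>(2) by (intro sum_mono mult_right_mono) auto
        then show ?thesis using s(2) by simp
      qed
      ultimately consider
        (1) I t where "I \<in> feasible_bases P V \<theta>" "\<forall>p\<in>I. 0 < t p" "c - (\<Sum>p\<in>I. t p *\<^sub>R p) \<in> span V"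
            "(\<Sum>p\<in>I. \<theta> p * t p) \<le> 1"
        | (2) I where "I \<subseteq> P" "dim (I \<union> V) < DIM('a)" "c \<in> span (I \<union> V)"
        using feasible_bases_cover[of P V \<theta> s c, OF P V \<theta>(1)] s(1) by blast
      then show "x \<in> N \<union> (\<Union>I\<in>feasible_bases P V \<theta>. cell I V \<theta> (- M) (\<tau> + M))"
      proof cases
        case 2
        have "(\<Sum>v\<in>V. z v *\<^sub>R v) \<in> span (I \<union> V)"
          using zV span_mono[of V "I \<union> V"] by auto
        then have "x \<in> span (I \<union> V)"
          unfolding x using 2(3) by (intro span_add)
        then show ?thesis using 2 by (auto simp: N_def)
      next
        case 1
        have I: "I \<subseteq> P" "finite I" using 1(1) P finite_subset by (auto simp: feasible_bases_def)
        obtain u where u: "c - (\<Sum>p\<in>I. t p *\<^sub>R p) = (\<Sum>v\<in>V. u v *\<^sub>R v)"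
          using 1(3) span_finite[OF finV] by auto
        have tb: "t p \<le> 1 / \<theta> p" if p: "p \<in> I" for p
        proof -
          have "\<theta> p * t p \<le> (\<Sum>p\<in>I. \<theta> p * t p)"
            using I(2) p 1(2) \<theta>(1) by (intro member_le_sum) (auto intro: less_imp_le mult_pos_pos)
          then have "\<theta> p * t p \<le> 1" using 1(4) by simp
          then show ?thesis using \<theta>(1) by (simp add: pos_le_divide_eq mult.commute)
        qed
        have "norm (\<Sum>p\<in>I. t p *\<^sub>R p) \<le> (\<Sum>p\<in>I. norm p / \<theta> p)"
        proof (rule sum_norm_le)
          fix p assume p: "p \<in> I"
          have "0 < t p" using 1(2) p by blast
          then have "\<bar>t p\<bar> \<le> 1 / \<theta> p" using tb[OF p] by simp
          then have "\<bar>t p\<bar> * norm p \<le> 1 / \<theta> p * norm p" by (rule mult_right_mono) simp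
          then show "norm (t p *\<^sub>R p) \<le> norm p / \<theta> p" by simp
        qed
        also have "\<dots> \<le> Q"
          unfolding Q_def using I(1) P \<theta>(1) by (intro sum_mono2) (auto simp: less_imp_le)
        finally have "norm (c - (\<Sum>p\<in>I. t p *\<^sub>R p)) \<le> R + Q"
          using R(2)[OF c] norm_triangle_ineq4[of c "\<Sum>p\<in>I. t p *\<^sub>R p"] by linarith
        then have "B * norm (\<Sum>v\<in>V. u v *\<^sub>R v) \<le> B * (R + Q)"
          unfolding u using B(1) by (rule mult_left_mono)
        then have ub: "\<bar>u v\<bar> \<le> M" if "v \<in> V" for v
          using B(2)[OF that, of u] by (simp add: M_def)
        have "x = (\<Sum>p\<in>I. t p *\<^sub>R p) + (\<Sum>v\<in>V. (u v + z v) *\<^sub>R v)"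
          unfolding x using u by (simp add: scaleR_add_left sum.distrib algebra_simps)
        moreover have "- M \<le> u v + z v \<and> u v + z v \<le> \<tau> + M" if "v \<in> V" for v
          using ub[OF that] z that by (fastforce simp: abs_le_iff)
        ultimately have "x \<in> cell I V \<theta> (- M) (\<tau> + M)"
          unfolding cell_def mem_Collect_eq using 1(2,4)
          by (intro exI[of _ t] exI[of _ "\<lambda>v. u v + z v"] conjI ballI) auto
        then show ?thesis using 1(1) by blast
      qed
    qed
  qed
qed

text \<open>The weight \<open>1 / \<alpha> p\<close> places the vertex at
  \<open>\<alpha> p *\<^sub>R p\<close>, which lies in \<open>A\<close>. In contrast to the covering
  of \<open>C\<close>, no overhang occurs.\<close>

lemma cells_subset_sum:
  fixes A P V :: "'a::euclidean_space set"
  assumes A: "convex A" "0 \<in> A" and P: "finite P"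
    and \<alpha>: "\<And>p. p \<in> P \<Longrightarrow> 0 < \<alpha> p" "\<And>p. p \<in> P \<Longrightarrow> \<alpha> p *\<^sub>R p \<in> A" and I: "I \<subseteq> P"
  shows "cell I V (\<lambda>p. 1 / \<alpha> p) 0 \<tau> \<subseteq> zonotope_sum A V (\<lambda>v. v) \<tau>"
proof
  fix x assume "x \<in> cell I V (\<lambda>p. 1 / \<alpha> p) 0 \<tau>"
  then obtain s z where x: "x = (\<Sum>p\<in>I. s p *\<^sub>R p) + (\<Sum>v\<in>V. z v *\<^sub>R v)"
    and s: "\<forall>p\<in>I. 0 < s p" "(\<Sum>p\<in>I. 1 / \<alpha> p * s p) \<le> 1" and z: "\<forall>v\<in>V. 0 \<le> z v \<and> z v \<le> \<tau>"
    unfolding cell_def by blast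
  have "(\<Sum>p\<in>I. (s p / \<alpha> p) *\<^sub>R (\<alpha> p *\<^sub>R p)) \<in> A"
  proof (rule scaled_hull_subset[OF A])
    show "finite I" using I P finite_subset by blast
    show "0 \<le> s p / \<alpha> p" if "p \<in> I" for p
      using s(1) \<alpha>(1)[of p] that I by (auto intro!: divide_nonneg_pos less_imp_le)
    show "(\<Sum>p\<in>I. s p / \<alpha> p) \<le> 1" using s(2) by simp
    show "\<alpha> p *\<^sub>R p \<in> A" if "p \<in> I" for p using \<alpha>(2) that I by blast
  qed
  moreover have "(\<Sum>p\<in>I. (s p / \<alpha> p) *\<^sub>R (\<alpha> p *\<^sub>R p)) = (\<Sum>p\<in>I. s p *\<^sub>R p)"
    using \<alpha>(1) I by (intro sum.cong) (force simp: less_le)+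
  ultimately show "x \<in> zonotope_sum A V (\<lambda>v. v) \<tau>"
    using x z unfolding minkowski_sum_def segment_sum_def by auto
qed

text \<open>Two systems of weights occur: \<open>\<theta>\<close> selects the bases and thereby
  cones that are disjoint modulo \<open>span V\<close>, while \<open>\<alpha>\<close> only sets the
  sizes of the simplices inside these cones. Hence the cells are disjoint whatever
  \<open>\<alpha>\<close> is.\<close>

lemma sum_cells_le:
  fixes A P V :: "'a::euclidean_space set"
  assumes A: "compact A" "convex A" "0 \<in> A" and P: "finite P" and V: "finite V"
    and \<alpha>: "\<And>p. p \<in> P \<Longrightarrow> 0 < \<alpha> p" "\<And>p. p \<in> P \<Longrightarrow> \<alpha> p *\<^sub>R p \<in> A"
    and gen: "generic_weights P V \<theta>"
    and meas: "\<And>I. I \<in> feasible_bases P V \<theta> \<Longrightarrow> cell I V (\<lambda>p. 1 / \<alpha> p) 0 \<tau> \<in> lmeasurable"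
  shows "(\<Sum>I\<in>feasible_bases P V \<theta>. vol (cell I V (\<lambda>p. 1 / \<alpha> p) 0 \<tau>))
     \<le> vol (zonotope_sum A V (\<lambda>v. v) \<tau>)"
proof -
  have FBP: "I \<subseteq> P" if "I \<in> feasible_bases P V \<theta>" for I
    using that by (auto simp: feasible_bases_def)
  have fin: "finite (feasible_bases P V \<theta>)"
    by (rule finite_subset[of _ "Pow P"]) (use P in \<open>auto simp: feasible_bases_def\<close>)
  have span: "x - (\<Sum>p\<in>I. s p *\<^sub>R p) \<in> span V" if "x = (\<Sum>p\<in>I. s p *\<^sub>R p) + (\<Sum>v\<in>V. z v *\<^sub>R v)" for x I s z
    unfolding that by (simp add: span_sum span_scale span_base)
  have disj: "disjoint_family_on (\<lambda>I. cell I V (\<lambda>p. 1 / \<alpha> p) 0 \<tau>) (feasible_bases P V \<theta>)"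
    unfolding disjoint_family_on_def
  proof (intro ballI impI, rule ccontr)
    fix I J assume IJ: "I \<in> feasible_bases P V \<theta>" "J \<in> feasible_bases P V \<theta>" "I \<noteq> J"
      and "cell I V (\<lambda>p. 1 / \<alpha> p) 0 \<tau> \<inter> cell J V (\<lambda>p. 1 / \<alpha> p) 0 \<tau> \<noteq> {}"
    then obtain x s z t z' where "x = (\<Sum>p\<in>I. s p *\<^sub>R p) + (\<Sum>v\<in>V. z v *\<^sub>R v)" "\<forall>p\<in>I. 0 < s p"
        "x = (\<Sum>p\<in>J. t p *\<^sub>R p) + (\<Sum>v\<in>V. z' v *\<^sub>R v)" "\<forall>p\<in>J. 0 < t p"
      unfolding cell_def by blast
    then show False
      using feasible_bases_disjoint[OF gen IJ(1,2), of s x t] IJ(3) span by blast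
  qed
  have "(\<Sum>I\<in>feasible_bases P V \<theta>. vol (cell I V (\<lambda>p. 1 / \<alpha> p) 0 \<tau>))
      = vol (\<Union>I\<in>feasible_bases P V \<theta>. cell I V (\<lambda>p. 1 / \<alpha> p) 0 \<tau>)"
    using fin meas disj
    by (intro measure_UNION'[symmetric]) (auto simp: disjoint_family_on_def pairwise_def disjnt_def)
  also have "\<dots> \<le> vol (zonotope_sum A V (\<lambda>v. v) \<tau>)"
  proof (rule measure_mono_fmeasurable)
    show "(\<Union>I\<in>feasible_bases P V \<theta>. cell I V (\<lambda>p. 1 / \<alpha> p) 0 \<tau>)
        \<subseteq> zonotope_sum A V (\<lambda>v. v) \<tau>"
      using cells_subset_sum[OF A(2,3) P \<alpha>] FBP by blast
    show "(\<Union>I\<in>feasible_bases P V \<theta>. cell I V (\<lambda>p. 1 / \<alpha> p) 0 \<tau>) \<in> sets lebesgue"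
      using fin meas by (intro sets.finite_UN) (auto simp: fmeasurableD)
    show "zonotope_sum A V (\<lambda>v. v) \<tau> \<in> lmeasurable"
      using A(1) compact_convex_segment_sum[OF V] by (intro lmeasurable_compact compact_minkowski_sum) blast+
  qed
  finally show ?thesis .
qed

text \<open>The covering bounds \<open>cC\<close> above by the sum of the \<open>g I\<close>, up to
  the perturbation, and the disjoint cells bound \<open>cA\<close> and \<open>cB\<close> below by
  the sums of \<open>g I * prod \<alpha> I\<close> and \<open>g I * prod \<beta> I\<close>. Every
  basis has \<open>m\<close> elements, whence the powers of \<open>\<kappa>\<close> and
  \<open>1 - \<eta>\<close>. Hoelder over the bases joins these bounds, and \<open>\<eta>\<close>
  tends to 0.\<close>

lemma zonotope_coefficient_inequality:
  fixes A B C P V :: "'a::euclidean_space set"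
  assumes V: "independent V"
    and A: "compact A" "convex A" "0 \<in> A" and B: "compact B" "convex B" "0 \<in> B" and C: "compact C"
    and P: "finite P"
    and cover: "\<And>x. x \<in> C \<Longrightarrow> \<exists>s. (\<forall>p\<in>P. 0 \<le> s p) \<and> (\<Sum>p\<in>P. s p) \<le> 1 \<and> x = (\<Sum>p\<in>P. s p *\<^sub>R p)"
    and \<alpha>: "\<And>p. p \<in> P \<Longrightarrow> 0 < \<alpha> p" "\<And>p. p \<in> P \<Longrightarrow> \<alpha> p *\<^sub>R p \<in> A"
    and \<beta>: "\<And>p. p \<in> P \<Longrightarrow> 0 < \<beta> p" "\<And>p. p \<in> P \<Longrightarrow> \<beta> p *\<^sub>R p \<in> B"
    and l: "0 < l" "l < 1"
    and \<kappa>: "0 < \<kappa>" "\<And>p. p \<in> P \<Longrightarrow> \<kappa> \<le> \<alpha> p powr l * \<beta> p powr (1 - l)"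
    and cA: "((\<lambda>\<tau>. vol (zonotope_sum A V (\<lambda>v. v) \<tau>) / \<tau> ^ card V) \<longlongrightarrow> cA) at_top"
    and cB: "((\<lambda>\<tau>. vol (zonotope_sum B V (\<lambda>v. v) \<tau>) / \<tau> ^ card V) \<longlongrightarrow> cB) at_top"
    and cC: "((\<lambda>\<tau>. vol (zonotope_sum C V (\<lambda>v. v) \<tau>) / \<tau> ^ card V) \<longlongrightarrow> cC) at_top"
  shows "\<kappa> ^ (DIM('a) - card V) * cC \<le> cA powr l * cB powr (1 - l)"
proof -
  have finV: "finite V" using V independent_imp_finite by auto
  define m where "m = DIM('a) - card V"
  have main: "\<kappa> ^ m * ((1 - \<eta>) ^ m * cC) \<le> cA powr l * cB powr (1 - l)" if \<eta>: "0 < \<eta>" "\<eta> < 1" for \<eta>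
  proof -
    obtain \<theta> where gen: "generic_weights P V \<theta>" and \<theta>: "\<And>p. 1 - \<eta> \<le> \<theta> p" "\<And>p. \<theta> p \<le> 1"
      using generic_weights_exist[OF P \<eta>] by metis
    have \<theta>0: "0 < \<theta> p" for p using \<theta>(1)[of p] \<eta> by linarith
    define \<F> where "\<F> = feasible_bases P V \<theta>"
    have FBP: "I \<subseteq> P" if "I \<in> \<F>" for I
      using that by (auto simp: feasible_bases_def \<F>_def)
    have finF: "finite \<F>"
      by (rule finite_subset[of _ "Pow P"]) (use P in \<open>auto simp: feasible_bases_def \<F>_def\<close>)
    have card: "card I = m" if "I \<in> \<F>" for I
    proof -
      have "complements V I" "finite I"
        using that FBP[OF that] P finite_subset by (auto simp: \<F>_def feasible_bases_def)
      then have "card I + card V = DIM('a)"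
        using finV by (metis complements_def card_Un_disjoint)
      then show ?thesis by (simp add: m_def)
    qed
    have "\<forall>I\<in>\<F>. \<exists>g. g \<ge> 0 \<and> (\<forall>w a b. (\<forall>p\<in>I. 0 < w p) \<longrightarrow> a < b \<longrightarrow> cell I V w a b \<in> lmeasurable \<and>
        vol (cell I V w a b) = g * (b - a) ^ card V / prod w I)"
    proof
      fix I assume "I \<in> \<F>"
      then have "complements V I" by (simp add: \<F>_def feasible_bases_def)
      then show "\<exists>g. g \<ge> 0 \<and> (\<forall>w a b. (\<forall>p\<in>I. 0 < w p) \<longrightarrow> a < b \<longrightarrow> cell I V w a b \<in> lmeasurable \<and>
        vol (cell I V w a b) = g * (b - a) ^ card V / prod w I)"
        unfolding complements_def by (intro measure_cell) simp_all
    qed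
    from bchoice[OF this] obtain g where g0: "\<And>I. I \<in> \<F> \<Longrightarrow> 0 \<le> g I"
      and gm: "\<And>I w a b. I \<in> \<F> \<Longrightarrow> (\<forall>p\<in>I. 0 < w p) \<Longrightarrow> a < b \<Longrightarrow> cell I V w a b \<in> lmeasurable"
      and g: "\<And>I w a b. I \<in> \<F> \<Longrightarrow> (\<forall>p\<in>I. 0 < w p) \<Longrightarrow> a < b \<Longrightarrow>
         vol (cell I V w a b) = g I * (b - a) ^ card V / prod w I"
      by blast
    define G where "G = (\<Sum>I\<in>\<F>. g I)"
    have "\<exists>M N. M > 0 \<and> negligible N \<and> (\<forall>\<tau>\<ge>0. zonotope_sum C V (\<lambda>v. v) \<tau>
        \<subseteq> N \<union> (\<Union>I\<in>\<F>. cell I V \<theta> (- M) (\<tau> + M)))"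
      unfolding \<F>_def by (rule cells_cover_sum[OF P V compact_imp_bounded[OF C] cover \<theta>0 \<theta>(2)])
    then obtain M N where M: "M > 0" and N: "negligible N"
      and sub: "\<forall>\<tau>\<ge>0. zonotope_sum C V (\<lambda>v. v) \<tau>
        \<subseteq> N \<union> (\<Union>I\<in>\<F>. cell I V \<theta> (- M) (\<tau> + M))"
      by blast
    \<comment> \<open>The overhang enters only through the factor
      \<open>((\<tau> + 2 * M) / \<tau>) ^ card V\<close>, which tends to 1.\<close>
    have upper: "vol (zonotope_sum C V (\<lambda>v. v) \<tau>) / \<tau> ^ card V
        \<le> ((\<tau> + 2 * M) / \<tau>) ^ card V * (G / (1 - \<eta>) ^ m)" if \<tau>: "0 < \<tau>" for \<tau>
    proof -
      have cm: "cell I V \<theta> (- M) (\<tau> + M) \<in> lmeasurable" if "I \<in> \<F>" for I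
        using gm[OF that] \<theta>0 M \<tau> by simp
      have Um: "(\<Union>I\<in>\<F>. cell I V \<theta> (- M) (\<tau> + M)) \<in> lmeasurable"
        using finF cm by (intro fmeasurable.finite_UN) auto
      have "vol (zonotope_sum C V (\<lambda>v. v) \<tau>)
          \<le> vol (N \<union> (\<Union>I\<in>\<F>. cell I V \<theta> (- M) (\<tau> + M)))"
      proof (rule measure_mono_fmeasurable)
        show "zonotope_sum C V (\<lambda>v. v) \<tau>
            \<subseteq> N \<union> (\<Union>I\<in>\<F>. cell I V \<theta> (- M) (\<tau> + M))"
          using sub \<tau> by simp
        show "zonotope_sum C V (\<lambda>v. v) \<tau> \<in> sets lebesgue"
          using C compact_convex_segment_sum[OF finV]
          by (intro fmeasurableD lmeasurable_compact compact_minkowski_sum) blast+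
        show "N \<union> (\<Union>I\<in>\<F>. cell I V \<theta> (- M) (\<tau> + M)) \<in> lmeasurable"
          using N Um by (intro fmeasurable.Un) (auto simp: negligible_iff_measure)
      qed
      also have "\<dots> \<le> vol N + vol (\<Union>I\<in>\<F>. cell I V \<theta> (- M) (\<tau> + M))"
        using N Um by (intro measure_Un_le) (auto simp: negligible_iff_measure fmeasurableD)
      also have "\<dots> = vol (\<Union>I\<in>\<F>. cell I V \<theta> (- M) (\<tau> + M))"
        using N by (simp add: negligible_iff_measure)
      also have "\<dots> \<le> (\<Sum>I\<in>\<F>. vol (cell I V \<theta> (- M) (\<tau> + M)))"
        using finF cm by (intro measure_UNION_le) (auto simp: fmeasurableD)
      also have "\<dots> \<le> (\<Sum>I\<in>\<F>. g I * ((\<tau> + 2 * M) ^ card V / (1 - \<eta>) ^ m))"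
      proof (rule sum_mono)
        fix I assume I: "I \<in> \<F>"
        have "(\<Prod>p\<in>I. 1 - \<eta>) \<le> prod \<theta> I"
          using \<theta>(1) \<eta> by (intro prod_mono) auto
        then have pr: "(1 - \<eta>) ^ m \<le> prod \<theta> I" using card[OF I] by simp
        have "vol (cell I V \<theta> (- M) (\<tau> + M)) = g I * ((\<tau> + 2 * M) ^ card V / prod \<theta> I)"
          using g[OF I, of \<theta> "- M" "\<tau> + M"] \<theta>0 M \<tau> by (simp add: algebra_simps)
        also have "\<dots> \<le> g I * ((\<tau> + 2 * M) ^ card V / (1 - \<eta>) ^ m)"
          using g0[OF I] pr \<eta> M \<tau> \<theta>0
          by (intro mult_left_mono divide_left_mono) (auto intro!: mult_pos_pos prod_pos)
        finally show "vol (cell I V \<theta> (- M) (\<tau> + M)) \<le> g I * ((\<tau> + 2 * M) ^ card V / (1 - \<eta>) ^ m)" .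
      qed
      also have "\<dots> = \<tau> ^ card V * (((\<tau> + 2 * M) / \<tau>) ^ card V * (G / (1 - \<eta>) ^ m))"
      proof -
        have "(\<Sum>I\<in>\<F>. g I * ((\<tau> + 2 * M) ^ card V / (1 - \<eta>) ^ m)) = G * ((\<tau> + 2 * M) ^ card V / (1 - \<eta>) ^ m)"
          by (simp only: G_def sum_distrib_right)
        then show ?thesis using \<tau> by (simp add: power_divide)
      qed
      finally show ?thesis
        using \<tau> by (simp add: pos_divide_le_eq mult.commute)
    qed
    have "((\<lambda>\<tau>. 1 + 2 * M * inverse \<tau>) \<longlongrightarrow> 1 + 2 * M * 0) at_top"
      by (intro tendsto_intros tendsto_inverse_0_at_top filterlim_ident)
    moreover have "eventually (\<lambda>\<tau>. 1 + 2 * M * inverse \<tau> = (\<tau> + 2 * M) / \<tau>) at_top"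
      using eventually_gt_at_top[of 0] by eventually_elim (simp add: field_simps)
    ultimately have "((\<lambda>\<tau>. (\<tau> + 2 * M) / \<tau>) \<longlongrightarrow> 1) at_top"
      by (simp add: tendsto_cong)
    then have lim: "((\<lambda>\<tau>. ((\<tau> + 2 * M) / \<tau>) ^ card V * (G / (1 - \<eta>) ^ m)) \<longlongrightarrow> 1 ^ card V * (G / (1 - \<eta>) ^ m)) at_top"
      by (intro tendsto_intros)
    have "cC \<le> 1 ^ card V * (G / (1 - \<eta>) ^ m)"
    proof (rule tendsto_le[OF _ lim cC])
      show "eventually (\<lambda>\<tau>. vol (zonotope_sum C V (\<lambda>v. v) \<tau>) / \<tau> ^ card V
          \<le> ((\<tau> + 2 * M) / \<tau>) ^ card V * (G / (1 - \<eta>) ^ m)) at_top"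
        using eventually_gt_at_top[of 0] upper by (rule eventually_mono)
    qed simp
    then have cC_le: "(1 - \<eta>) ^ m * cC \<le> G"
      using \<eta> by (simp add: pos_le_divide_eq mult.commute)
    \<comment> \<open>Stated for a general body because \<open>A\<close> and \<open>B\<close> use
      the same bases and the same \<open>g\<close>; only the radial factors differ.\<close>
    have lower: "(\<Sum>I\<in>\<F>. g I * prod a I) \<le> cK"
      if K: "compact K" "convex K" "0 \<in> K"
        and a: "\<And>p. p \<in> P \<Longrightarrow> 0 < a p" "\<And>p. p \<in> P \<Longrightarrow> a p *\<^sub>R p \<in> K"
        and cK: "((\<lambda>\<tau>. vol (zonotope_sum K V (\<lambda>v. v) \<tau>) / \<tau> ^ card V) \<longlongrightarrow> cK) at_top"
      for K a cK
    proof (rule tendsto_lowerbound[OF cK])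
      have "(\<Sum>I\<in>\<F>. g I * prod a I) \<le> vol (zonotope_sum K V (\<lambda>v. v) \<tau>) / \<tau> ^ card V"
        if \<tau>: "0 < \<tau>" for \<tau>
      proof -
        have ai: "\<forall>p\<in>I. 0 < 1 / a p" if "I \<in> \<F>" for I using FBP[OF that] a(1) by auto
        have "(\<Sum>I\<in>\<F>. g I * prod a I) * \<tau> ^ card V = (\<Sum>I\<in>\<F>. vol (cell I V (\<lambda>p. 1 / a p) 0 \<tau>))"
          unfolding sum_distrib_right
        proof (intro sum.cong refl)
          fix I assume I: "I \<in> \<F>"
          show "g I * prod a I * \<tau> ^ card V = vol (cell I V (\<lambda>p. 1 / a p) 0 \<tau>)"
            using g[OF I ai[OF I] \<tau>] by (simp add: prod_dividef)
        qed
        also have "\<dots> \<le> vol (zonotope_sum K V (\<lambda>v. v) \<tau>)"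
          unfolding \<F>_def using gm[OF _ ai \<tau>] by (intro sum_cells_le[OF K P finV a gen]) (auto simp: \<F>_def)
        finally show ?thesis using \<tau> by (simp add: pos_le_divide_eq)
      qed
      then show "eventually (\<lambda>\<tau>. (\<Sum>I\<in>\<F>. g I * prod a I) \<le> vol (zonotope_sum K V (\<lambda>v. v) \<tau>) / \<tau> ^ card V) at_top"
        by (rule eventually_mono[OF eventually_gt_at_top[of 0]])
    qed simp
    have pos: "0 \<le> \<alpha> p" "0 \<le> \<beta> p" if "I \<in> \<F>" "p \<in> I" for I p
      using FBP[OF that(1)] that(2) \<alpha>(1)[of p] \<beta>(1)[of p] by (auto simp: less_imp_le)
    have "\<kappa> ^ m * ((1 - \<eta>) ^ m * cC) \<le> \<kappa> ^ m * G"
      using cC_le \<kappa>(1) by (intro mult_left_mono) auto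
    also have "\<dots> = (\<Sum>I\<in>\<F>. g I * \<kappa> ^ m)"
      by (simp only: G_def sum_distrib_right mult.commute[of "\<kappa> ^ m"])
    also have "\<dots> \<le> (\<Sum>I\<in>\<F>. (g I * prod \<alpha> I) powr l * (g I * prod \<beta> I) powr (1 - l))"
    proof (rule sum_mono)
      fix I assume I: "I \<in> \<F>"
      have pos': "0 < \<alpha> p" "0 < \<beta> p" if "p \<in> I" for p using FBP[OF I] that \<alpha>(1) \<beta>(1) by auto
      have "\<kappa> ^ m = (\<Prod>p\<in>I. \<kappa>)" using card[OF I] by simp
      also have "\<dots> \<le> (\<Prod>p\<in>I. \<alpha> p powr l * \<beta> p powr (1 - l))"
        using \<kappa> FBP[OF I] by (intro prod_mono) (auto simp: less_imp_le)
      also have "\<dots> = prod \<alpha> I powr l * prod \<beta> I powr (1 - l)"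
        using pos' by (simp add: prod.distrib prod_powr_distrib less_imp_le)
      finally have "g I * \<kappa> ^ m \<le> g I * (prod \<alpha> I powr l * prod \<beta> I powr (1 - l))"
        using g0[OF I] by (rule mult_left_mono)
      \<comment> \<open>The exponents \<open>l\<close> and \<open>1 - l\<close> sum to 1, so
        \<open>g I\<close> can be shared out between the two bodies.\<close>
      also have "g I * (prod \<alpha> I powr l * prod \<beta> I powr (1 - l))
          = g I powr l * g I powr (1 - l) * (prod \<alpha> I powr l * prod \<beta> I powr (1 - l))"
        using g0[OF I] by (cases "g I = 0") (auto simp flip: powr_add)
      also have "g I powr l * g I powr (1 - l) * (prod \<alpha> I powr l * prod \<beta> I powr (1 - l))
          = (g I * prod \<alpha> I) powr l * (g I * prod \<beta> I) powr (1 - l)"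
        using g0[OF I] pos' by (simp add: powr_mult prod_nonneg less_imp_le)
      finally show "g I * \<kappa> ^ m \<le> (g I * prod \<alpha> I) powr l * (g I * prod \<beta> I) powr (1 - l)" .
    qed
    also have "\<dots> \<le> (\<Sum>I\<in>\<F>. g I * prod \<alpha> I) powr l * (\<Sum>I\<in>\<F>. g I * prod \<beta> I) powr (1 - l)"
      using g0 pos l finF by (intro Holder_sum_powr mult_nonneg_nonneg prod_nonneg ballI)
    also have "\<dots> \<le> cA powr l * cB powr (1 - l)"
      using lower[OF A \<alpha> cA] lower[OF B \<beta> cB] l g0 pos
      by (intro mult_mono powr_mono2 sum_nonneg mult_nonneg_nonneg prod_nonneg ballI) auto
    finally show ?thesis .
  qed
  have "((\<lambda>\<eta>. \<kappa> ^ m * ((1 - \<eta>) ^ m * cC)) \<longlongrightarrow> \<kappa> ^ m * ((1 - 0) ^ m * cC)) (at_right 0)"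
    by (intro tendsto_intros)
  moreover have "eventually (\<lambda>\<eta>. \<kappa> ^ m * ((1 - \<eta>) ^ m * cC) \<le> cA powr l * cB powr (1 - l)) (at_right 0)"
    using eventually_at_right_real[of 0 1] by (auto elim!: eventually_mono intro: main)
  ultimately have "\<kappa> ^ m * ((1 - 0) ^ m * cC) \<le> cA powr l * cB powr (1 - l)"
    by (rule tendsto_upperbound) simp
  then show ?thesis by (simp add: m_def)
qed

section \<open>The Euclidean ball as a limit of zonotopes\<close>

text \<open>The inverse \<open>R\<close> maps the unit ball onto itself, and this ball has positive
  finite volume. Taken as the reference set, it shows that \<open>R\<close> preserves
  volume.\<close>

lemma lborel_distr_orthogonal:
  fixes Q :: "'a::euclidean_space \<Rightarrow> 'a"
  assumes Q: "orthogonal_transformation Q"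
  shows "distr lborel borel Q = lborel"
proof (rule measure_eqI)
  show "sets (distr lborel borel Q) = sets lborel" by simp
next
  have linQ: "linear Q" using Q by (rule orthogonal_transformation_linear)
  have "bij Q" using Q by (rule orthogonal_transformation_bij)
  define R where "R = inv Q"
  have R: "orthogonal_transformation R"
    unfolding R_def using Q by (rule orthogonal_transformation_inv)
  have linR: "linear R" and injR: "inj R"
    using R by (auto intro: orthogonal_transformation_linear orthogonal_transformation_inj)
  have vim: "Q -` X = R ` X" for X
    using \<open>bij Q\<close> by (simp add: R_def bij_vimage_eq_inv_image)
  fix X assume "X \<in> sets (distr lborel borel Q)"
  then have X: "X \<in> sets borel" by simp
  have Qm: "Q \<in> borel_measurable lborel"
    using linQ by (simp add: borel_measurable_continuous_onI linear_continuous_on linear_linear)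
  have "R ` cball 0 1 = cball 0 1"
    using R by (simp add: image_orthogonal_transformation_cball linear_0[OF linR])
  then have "emeasure lborel (R ` X) * emeasure lborel (cball 0 1 :: 'a set)
      = emeasure lborel X * emeasure lborel (cball 0 1 :: 'a set)"
    using linear_image_emeasure[OF linR injR X, of "cball 0 1"] by simp
  moreover have "emeasure lborel (cball 0 1 :: 'a set) \<noteq> \<infinity>"
    using emeasure_lborel_cball_finite[of "0::'a" 1] by simp
  moreover have "emeasure lborel (cball 0 1 :: 'a set) \<noteq> 0"
  proof -
    have "unit_ball_vol (real DIM('a)) \<noteq> 0"
      by (metis less_irrefl of_nat_0_le_iff unit_ball_vol_pos)
    then show ?thesis by (simp add: emeasure_cball)
  qed
  ultimately have "emeasure lborel (R ` X) = emeasure lborel X"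
    by (simp add: mult.commute[of _ "emeasure lborel (cball 0 1)"] ennreal_mult_cancel_left)
  then show "emeasure (distr lborel borel Q) X = emeasure lborel X"
    using X Qm by (simp add: emeasure_distr vim)
qed

text \<open>The Euclidean norm is, up to a factor, the cosine transform of the uniform measure on the unit
  ball.\<close>

lemma integral_abs_inner_cball:
  obtains \<kappa> where "0 < \<kappa>"
    "\<And>x::real^'n. (LINT y|lborel. indicator (cball 0 1) y * \<bar>x \<bullet> y\<bar>) = \<kappa> * norm x"
proof -
  define \<phi> where "\<phi> x = (LINT y|lborel. indicator (cball 0 1) y * \<bar>x \<bullet> y\<bar>)" for x :: "real^'n"
  have int: "integrable lborel (\<lambda>y. indicator (cball 0 1) y * \<bar>x \<bullet> y\<bar>)" for x :: "real^'n"
  proof -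
    have "integrable lborel (\<lambda>y. indicator (cball 0 1) y *\<^sub>R \<bar>x \<bullet> y\<bar>)"
      by (intro borel_integrable_compact continuous_intros) auto
    then show ?thesis by simp
  qed
  \<comment> \<open>Rotation invariance and homogeneity leave only multiples of the norm.\<close>
  have rot: "\<phi> (Q x) = \<phi> x" if Q: "orthogonal_transformation Q" for Q :: "real^'n \<Rightarrow> real^'n" and x
  proof -
    have lin: "linear Q" using Q by (rule orthogonal_transformation_linear)
    have Qm: "Q \<in> borel_measurable lborel"
      using lin by (simp add: borel_measurable_continuous_onI linear_continuous_on linear_linear)
    have "\<phi> (Q x) = (LINT y|distr lborel borel Q. indicator (cball 0 1) y * \<bar>Q x \<bullet> y\<bar>)"
      by (simp add: \<phi>_def lborel_distr_orthogonal[OF Q])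
    also have "\<dots> = (LINT y|lborel. indicator (cball 0 1) (Q y) * \<bar>Q x \<bullet> Q y\<bar>)"
    proof (rule integral_distr)
      show "Q \<in> lborel \<rightarrow>\<^sub>M borel" by (rule Qm)
      show "(\<lambda>y. indicator (cball 0 1) y * \<bar>Q x \<bullet> y\<bar>) \<in> borel_measurable borel"
        by (intro borel_measurable_times borel_measurable_indicator borel_measurable_continuous_onI
            continuous_intros) auto
    qed
    also have "\<dots> = \<phi> x"
      using Q by (simp add: \<phi>_def orthogonal_transformation_def orthogonal_transformation_norm[OF Q] indicator_def
          cong: if_cong)
    finally show ?thesis .
  qed
  obtain e :: "real^'n" where e: "norm e = 1"
    using vector_choose_size[of 1] by auto
  have "\<phi> x = \<phi> e * norm x" for x
  proof -
    obtain Q where Q: "orthogonal_transformation Q" "Q (norm x *\<^sub>R e) = x"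
      using orthogonal_transformation_exists[of "norm x *\<^sub>R e" x] e by auto
    then have "\<phi> x = \<phi> (norm x *\<^sub>R e)" using rot by metis
    also have "\<dots> = (LINT y|lborel. norm x * (indicator (cball 0 1) y * \<bar>e \<bullet> y\<bar>))"
      by (simp add: \<phi>_def abs_mult mult.left_commute)
    also have "\<dots> = norm x * \<phi> e"
      unfolding \<phi>_def by (rule integral_mult_right_zero)
    finally show ?thesis by simp
  qed
  moreover have "0 < \<phi> e"
  proof -
    \<comment> \<open>Positivity of the constant is read off from a small ball on which the
      integrand is at least 1/4: it stays inside the unit ball as 1/2 + 1/4 < 1, and there
      \<open>e \<bullet> y\<close> is at least 1/2 - 1/4.\<close>
    define S where "S = cball ((1/2) *\<^sub>R e) (1/4)"
    have S: "y \<in> cball 0 1 \<and> 1/4 \<le> \<bar>e \<bullet> y\<bar>" if "y \<in> S" for y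
    proof -
      define d where "d = y - (1/2) *\<^sub>R e"
      have d: "norm d \<le> 1/4" "y = (1/2) *\<^sub>R e + d"
        using that by (auto simp: S_def d_def dist_norm norm_minus_commute)
      have "norm y \<le> 1/2 + 1/4"
        using norm_triangle_ineq[of "(1/2) *\<^sub>R e" d] d e by simp
      moreover have "\<bar>e \<bullet> d\<bar> \<le> 1/4"
        using Cauchy_Schwarz_ineq2[of e d] e d by simp
      moreover have "e \<bullet> y = 1/2 + e \<bullet> d"
        using e by (simp add: d(2) inner_add_right dot_square_norm)
      ultimately show ?thesis by (simp add: abs_le_iff)
    qed
    have "0 < measure lborel S / 4"
      by (simp add: S_def content_cball_pos)
    also have "\<dots> = (LINT y|lborel. indicator S y * (1/4))"
      by (simp add: S_def)
    also have "\<dots> \<le> \<phi> e"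
      unfolding \<phi>_def
    proof (rule integral_mono[OF _ int])
      show "integrable lborel (\<lambda>y. indicator S y * (1/4 :: real))"
        by (intro integrable_mult_left integrable_real_indicator)
           (use emeasure_bounded_finite[of S] in \<open>auto simp: S_def\<close>)
      show "indicator S y * (1/4) \<le> indicator (cball 0 1) y * \<bar>e \<bullet> y\<bar>" for y
        using S[of y] by (auto simp: indicator_def)
    qed
    finally show ?thesis .
  qed
  ultimately show ?thesis using that unfolding \<phi>_def by blast
qed

text \<open>A Riemann sum for the preceding integral. The integrand is Lipschitz in \<open>y\<close>
  with constant \<open>norm x\<close>, so the error is relative to \<open>norm x\<close> and one
  partition serves all \<open>x\<close>. The volumes of the pieces are absorbed into the vectors by
  homogeneity.\<close>

lemma abs_inner_sum_approx_norm:
  assumes \<epsilon>: "0 < \<epsilon>"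
  obtains N :: nat and w :: "nat \<Rightarrow> real^'n" where
    "\<And>x. (1 - \<epsilon>) * norm x \<le> (\<Sum>k<N. \<bar>x \<bullet> w k\<bar>)" "\<And>x. (\<Sum>k<N. \<bar>x \<bullet> w k\<bar>) \<le> (1 + \<epsilon>) * norm x"
proof -
  define B where "B = (cball 0 1 :: (real^'n) set)"
  obtain \<kappa> where \<kappa>: "0 < \<kappa>" "\<And>x::real^'n. (LINT y|lborel. indicator B y * \<bar>x \<bullet> y\<bar>) = \<kappa> * norm x"
    using integral_abs_inner_cball unfolding B_def by blast
  define \<mu> where "\<mu> = measure lborel B"
  have \<mu>: "\<mu> > 0" by (simp add: \<mu>_def B_def content_cball_pos)
  \<comment> \<open>An error of at most \<open>norm x * \<delta>\<close> over a set of volume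
    \<open>\<mu>\<close> integrates to at most
    \<open>\<epsilon> * \<kappa> * norm x\<close>.\<close>
  define \<delta> where "\<delta> = \<epsilon> * \<kappa> / \<mu>"
  have \<delta>: "\<delta> > 0" using \<epsilon> \<kappa> \<mu> by (simp add: \<delta>_def)
  have "\<exists>F. finite F \<and> B \<subseteq> (\<Union>c\<in>F. ball c \<delta>)"
    using compact_eq_totally_bounded[of B] \<delta> by (force simp: B_def)
  then obtain F where F: "finite F" "B \<subseteq> (\<Union>c\<in>F. ball c \<delta>)" by blast
  obtain N :: nat and c where "F = c ` {k. k < N}"
    using finite_imp_nat_seg_image_inj_on[OF F(1)] by blast
  then have cover: "\<exists>k<N. y \<in> ball (c k) \<delta>" if "y \<in> B" for y
    using F(2) that by blast
  \<comment> \<open>Each point is assigned to the first ball that contains it, which makes the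
    pieces disjoint.\<close>
  define P where "P k = (B \<inter> ball (c k) \<delta>) - (\<Union>j<k. ball (c j) \<delta>)" for k
  have Pm [measurable]: "P k \<in> sets borel" for k
    unfolding P_def B_def by measurable
  have Pfin: "emeasure lborel (P k) < \<infinity>" for k
    by (rule emeasure_bounded_finite, rule bounded_subset[of B]) (auto simp: P_def B_def)
  have P: "\<exists>k<N. \<forall>j. y \<in> P j \<longleftrightarrow> j = k" if y: "y \<in> B" for y
  proof -
    define k where "k = (LEAST k. y \<in> ball (c k) \<delta>)"
    obtain k0 where k0: "k0 < N" "y \<in> ball (c k0) \<delta>" using cover[OF y] by blast
    have k: "y \<in> ball (c k) \<delta>" "k \<le> k0"
      unfolding k_def using k0(2) by (rule LeastI, rule Least_le)
    have less: "y \<notin> ball (c j) \<delta>" if "j < k" for j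
      using not_less_Least[of j] that unfolding k_def by blast
    have "y \<in> P j \<longleftrightarrow> j = k" for j
    proof
      assume "y \<in> P j"
      then have "y \<in> ball (c j) \<delta>" "\<not> k < j" using k(1) by (auto simp: P_def)
      then show "j = k" using less by (metis linorder_neqE_nat)
    next
      assume "j = k"
      then show "y \<in> P j" using k(1) less y by (simp add: P_def)
    qed
    then show ?thesis using k(2) k0(1) by (intro exI[of _ k]) auto
  qed
  define w where "w k = (measure lborel (P k) / \<kappa>) *\<^sub>R c k" for k
  have main: "\<bar>\<kappa> * (\<Sum>k<N. \<bar>x \<bullet> w k\<bar>) - \<kappa> * norm x\<bar> \<le> \<epsilon> * \<kappa> * norm x" for x
  proof -
    define f where "f y = indicator B y * \<bar>x \<bullet> y\<bar>" for y
    define g where "g y = (\<Sum>k<N. indicator (P k) y * \<bar>x \<bullet> c k\<bar>)" for y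
    have fi: "integrable lborel f"
    proof -
      have "integrable lborel (\<lambda>y. indicator (cball 0 1) y *\<^sub>R \<bar>x \<bullet> y\<bar>)"
        by (intro borel_integrable_compact continuous_intros) auto
      then show ?thesis by (simp add: f_def[abs_def] B_def)
    qed
    have gi: "integrable lborel g" and gI: "integral\<^sup>L lborel g = (\<Sum>k<N. measure lborel (P k) * \<bar>x \<bullet> c k\<bar>)"
    proof -
      have 1: "integrable lborel (\<lambda>y. indicator (P k) y * \<bar>x \<bullet> c k\<bar>)" for k
        using Pfin by (intro integrable_mult_left integrable_real_indicator) auto
      show "integrable lborel g"
        unfolding g_def[abs_def] using 1 by (intro Bochner_Integration.integrable_sum)
      show "integral\<^sup>L lborel g = (\<Sum>k<N. measure lborel (P k) * \<bar>x \<bullet> c k\<bar>)"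
        unfolding g_def[abs_def] using 1 by (subst Bochner_Integration.integral_sum) auto
    qed
    have bound: "\<bar>g y - f y\<bar> \<le> indicator B y * (norm x * \<delta>)" for y
    proof (cases "y \<in> B")
      case True
      then obtain k where k: "k < N" "\<And>j. y \<in> P j \<longleftrightarrow> j = k" using P by blast
      have "g y = (\<Sum>j<N. if j = k then \<bar>x \<bullet> c j\<bar> else 0)"
        unfolding g_def using k(2) by (intro sum.cong) auto
      also have "\<dots> = \<bar>x \<bullet> c k\<bar>" using k(1) by simp
      finally have "\<bar>g y - f y\<bar> = \<bar>\<bar>x \<bullet> c k\<bar> - \<bar>x \<bullet> y\<bar>\<bar>" using True by (simp add: f_def)
      also have "\<dots> \<le> \<bar>x \<bullet> c k - x \<bullet> y\<bar>" by (rule abs_triangle_ineq3)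
      also have "\<dots> = \<bar>x \<bullet> (c k - y)\<bar>" by (simp add: inner_diff_right)
      also have "\<dots> \<le> norm x * norm (c k - y)" by (rule Cauchy_Schwarz_ineq2)
      also have "\<dots> \<le> norm x * \<delta>"
        using k(2)[of k] by (intro mult_left_mono) (auto simp: P_def dist_norm)
      finally show ?thesis using True by simp
    next
      case False
      then have "y \<notin> P k" for k by (simp add: P_def)
      then show ?thesis using False by (simp add: f_def g_def)
    qed
    have bi: "integrable lborel (\<lambda>y. indicator B y * (norm x * \<delta>))"
      by (intro integrable_mult_left integrable_real_indicator)
         (use emeasure_bounded_finite[of B] in \<open>auto simp: B_def\<close>)
    have "\<bar>integral\<^sup>L lborel g - integral\<^sup>L lborel f\<bar> = \<bar>LINT y|lborel. g y - f y\<bar>"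
      using fi gi by simp
    also have "\<dots> \<le> (LINT y|lborel. \<bar>g y - f y\<bar>)"
      using integral_norm_bound[of lborel "\<lambda>y. g y - f y"] by simp
    also have "\<dots> \<le> (LINT y|lborel. indicator B y * (norm x * \<delta>))"
      using fi gi bi bound by (intro integral_mono) auto
    also have "\<dots> = \<mu> * (norm x * \<delta>)"
      by (simp add: \<mu>_def B_def)
    also have "\<dots> = \<epsilon> * \<kappa> * norm x"
      using \<mu> by (simp add: \<delta>_def)
    finally have "\<bar>integral\<^sup>L lborel g - integral\<^sup>L lborel f\<bar> \<le> \<epsilon> * \<kappa> * norm x" .
    moreover have "integral\<^sup>L lborel f = \<kappa> * norm x"
      using \<kappa>(2)[of x] by (simp add: f_def[abs_def])
    moreover have "integral\<^sup>L lborel g = \<kappa> * (\<Sum>k<N. \<bar>x \<bullet> w k\<bar>)"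
      unfolding gI w_def using \<kappa>(1) by (simp add: sum_distrib_left abs_mult)
    ultimately show ?thesis by simp
  qed
  show ?thesis
  proof (rule that[where w=w and N=N])
    fix x :: "real^'n"
    have "\<kappa> * (\<Sum>k<N. \<bar>x \<bullet> w k\<bar>) \<le> \<kappa> * ((1 + \<epsilon>) * norm x)"
      "\<kappa> * ((1 - \<epsilon>) * norm x) \<le> \<kappa> * (\<Sum>k<N. \<bar>x \<bullet> w k\<bar>)"
      using main[of x] by (auto simp: abs_le_iff algebra_simps)
    then show "(1 - \<epsilon>) * norm x \<le> (\<Sum>k<N. \<bar>x \<bullet> w k\<bar>)" "(\<Sum>k<N. \<bar>x \<bullet> w k\<bar>) \<le> (1 + \<epsilon>) * norm x"
      using \<kappa>(1) by auto
  qed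
qed

lemma measure_minkowski_sum_translation:
  "vol (minkowski_sum K ((+) a ` S)) = vol (minkowski_sum K S)"
proof -
  have "minkowski_sum K ((+) a ` S) = (+) a ` minkowski_sum K S"
    unfolding minkowski_sum_def by (auto simp: algebra_simps image_iff) (metis add.left_commute)+
  then show ?thesis by (simp add: measure_translation)
qed

text \<open>The sum of the \<open>\<bar>x \<bullet> w k\<bar>\<close> is the support function of the
  zonotope with segments from \<open>- w k\<close> to \<open>w k\<close>, so its comparison with the
  norm yields an inner and an outer ball. Segments in \<open>segment_sum\<close> start at 0; hence
  \<open>v k = 2 *\<^sub>R w k\<close> and a translation, which does not affect volume. The zonotope
  is fixed before \<open>K\<close> and \<open>\<tau>\<close>.\<close>

lemma zonotope_ball_sandwich:
  assumes \<epsilon>: "0 < \<epsilon>"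
  obtains N :: nat and v :: "nat \<Rightarrow> real^'n" where
    "\<And>K \<tau>. compact K \<Longrightarrow> 0 \<le> \<tau> \<Longrightarrow> vol (minkowski_sum K (cball 0 (\<tau> * (1 - \<epsilon>))))
       \<le> vol (zonotope_sum K {..<N} v \<tau>)"
    "\<And>K \<tau>. compact K \<Longrightarrow> 0 \<le> \<tau> \<Longrightarrow> vol (zonotope_sum K {..<N} v \<tau>)
       \<le> vol (minkowski_sum K (cball 0 (\<tau> * (1 + \<epsilon>))))"
proof -
  obtain N :: nat and w :: "nat \<Rightarrow> real^'n" where
    w: "\<And>x. (1 - \<epsilon>) * norm x \<le> (\<Sum>k<N. \<bar>x \<bullet> w k\<bar>)" "\<And>x. (\<Sum>k<N. \<bar>x \<bullet> w k\<bar>) \<le> (1 + \<epsilon>) * norm x"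
    using abs_inner_sum_approx_norm[OF \<epsilon>] by metis
  define v where "v k = 2 *\<^sub>R w k" for k
  define Z where "Z \<tau> = (+) (- (\<tau> *\<^sub>R (\<Sum>k<N. w k))) ` segment_sum {..<N} v (\<lambda>_. \<tau>)" for \<tau>
  have cZ: "compact (Z \<tau>) \<and> convex (Z \<tau>)" for \<tau>
    unfolding Z_def using compact_convex_segment_sum[of "{..<N}" v "\<lambda>_. \<tau>"]
    by (intro conjI compact_translation convex_translation) auto
  have memZ: "(\<Sum>k<N. y k *\<^sub>R w k) \<in> Z \<tau>" if "\<And>k. k < N \<Longrightarrow> \<bar>y k\<bar> \<le> \<tau>" for y \<tau>
  proof -
    define z where "z k = (y k + \<tau>) / 2" for k
    have "z k *\<^sub>R v k = \<tau> *\<^sub>R w k + y k *\<^sub>R w k" for k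
    proof -
      have "z k * 2 = \<tau> + y k" by (simp add: z_def)
      then show ?thesis unfolding v_def scaleR_scaleR by (simp only: scaleR_add_left)
    qed
    then have "(\<Sum>k<N. y k *\<^sub>R w k) = - (\<tau> *\<^sub>R (\<Sum>k<N. w k)) + (\<Sum>k<N. z k *\<^sub>R v k)"
      by (simp add: sum.distrib scaleR_sum_right)
    moreover have "(\<Sum>k<N. z k *\<^sub>R v k) \<in> segment_sum {..<N} v (\<lambda>_. \<tau>)"
      using that unfolding segment_sum_def z_def by (force simp: abs_le_iff)
    ultimately show ?thesis unfolding Z_def by blast
  qed
  have Zmem: "\<exists>y. (\<forall>k<N. \<bar>y k\<bar> \<le> \<tau>) \<and> x = (\<Sum>k<N. y k *\<^sub>R w k)" if x: "x \<in> Z \<tau>" for x \<tau>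
  proof -
    obtain z where z: "\<forall>k\<in>{..<N}. 0 \<le> z k \<and> z k \<le> \<tau>"
      "x = - (\<tau> *\<^sub>R (\<Sum>k<N. w k)) + (\<Sum>k<N. z k *\<^sub>R v k)"
      using x unfolding Z_def segment_sum_def by blast
    have "z k *\<^sub>R v k = \<tau> *\<^sub>R w k + (2 * z k - \<tau>) *\<^sub>R w k" for k
    proof -
      have "z k * 2 = \<tau> + (2 * z k - \<tau>)" by simp
      then show ?thesis unfolding v_def scaleR_scaleR by (simp only: scaleR_add_left)
    qed
    then have "x = (\<Sum>k<N. (2 * z k - \<tau>) *\<^sub>R w k)"
      unfolding z(2) by (simp only: sum.distrib scaleR_sum_right) simp
    moreover have "\<forall>k<N. \<bar>2 * z k - \<tau>\<bar> \<le> \<tau>"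
    proof (intro allI impI)
      fix k assume "k < N"
      then have "0 \<le> z k" "z k \<le> \<tau>" using z(1) by auto
      then show "\<bar>2 * z k - \<tau>\<bar> \<le> \<tau>" by linarith
    qed
    ultimately show ?thesis by (intro exI[of _ "\<lambda>k. 2 * z k - \<tau>"] conjI)
  qed
  have up: "Z \<tau> \<subseteq> cball 0 (\<tau> * (1 + \<epsilon>))" if \<tau>: "0 \<le> \<tau>" for \<tau>
  proof
    fix x assume "x \<in> Z \<tau>"
    then obtain y where y: "\<forall>k<N. \<bar>y k\<bar> \<le> \<tau>" "x = (\<Sum>k<N. y k *\<^sub>R w k)" using Zmem by blast
    \<comment> \<open>For the outer inclusion it suffices to test in the direction of
      \<open>x\<close> itself.\<close>
    have "x \<bullet> x = (\<Sum>k<N. y k * (x \<bullet> w k))"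
      by (subst (2) y(2)) (simp add: inner_sum_right)
    also have "\<dots> \<le> (\<Sum>k<N. \<tau> * \<bar>x \<bullet> w k\<bar>)"
    proof (rule sum_mono)
      fix k assume "k \<in> {..<N}"
      then have "\<bar>y k\<bar> * \<bar>x \<bullet> w k\<bar> \<le> \<tau> * \<bar>x \<bullet> w k\<bar>" using y(1) by (intro mult_right_mono) auto
      then show "y k * (x \<bullet> w k) \<le> \<tau> * \<bar>x \<bullet> w k\<bar>"
        using abs_ge_self[of "y k * (x \<bullet> w k)"] by (simp add: abs_mult)
    qed
    also have "\<dots> \<le> \<tau> * ((1 + \<epsilon>) * norm x)"
      unfolding sum_distrib_left[symmetric] using w(2) \<tau> by (rule mult_left_mono)
    finally have "norm x * norm x \<le> \<tau> * (1 + \<epsilon>) * norm x"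
      by (simp add: dot_square_norm power2_eq_square mult.assoc)
    then have "norm x \<le> \<tau> * (1 + \<epsilon>)"
      using \<tau> \<epsilon> by (cases "x = 0") auto
    then show "x \<in> cball 0 (\<tau> * (1 + \<epsilon>))" by simp
  qed
  have low: "cball 0 (\<tau> * (1 - \<epsilon>)) \<subseteq> Z \<tau>" if \<tau>: "0 \<le> \<tau>" for \<tau>
  proof (rule subsetI, rule ccontr)
    fix x assume x: "x \<in> cball 0 (\<tau> * (1 - \<epsilon>))" "x \<notin> Z \<tau>"
    have "closed (Z \<tau>)" "convex (Z \<tau>)" using cZ[of \<tau>] compact_imp_closed by auto
    then obtain a b where ab: "a \<bullet> x < b" "\<forall>z\<in>Z \<tau>. b < a \<bullet> z"
      using separating_hyperplane_closed_point[of "Z \<tau>" x] x(2) by blast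
    \<comment> \<open>These coefficients give a point of \<open>Z \<tau>\<close> at which the inner
      product with \<open>a\<close> is smallest, namely minus \<open>\<tau>\<close> times the
      support function.\<close>
    define y where "y k = - \<tau> * sgn (a \<bullet> w k)" for k
    have "(\<Sum>k<N. y k *\<^sub>R w k) \<in> Z \<tau>"
      using \<tau> by (intro memZ) (auto simp: y_def abs_mult sgn_if)
    then have "b < a \<bullet> (\<Sum>k<N. y k *\<^sub>R w k)" using ab(2) by blast
    also have "\<dots> = - \<tau> * (\<Sum>k<N. \<bar>a \<bullet> w k\<bar>)"
    proof -
      have "y k * (a \<bullet> w k) = - \<tau> * \<bar>a \<bullet> w k\<bar>" for k
        by (simp add: y_def abs_sgn)
      then show ?thesis by (simp add: inner_sum_right sum_distrib_left)
    qed
    also have "\<dots> \<le> - (\<tau> * ((1 - \<epsilon>) * norm a))"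
      using mult_left_mono[OF w(1)[of a] \<tau>] by simp
    finally have "\<tau> * (1 - \<epsilon>) * norm a < - (a \<bullet> x)"
      using ab(1) by (simp add: mult.assoc)
    also have "\<dots> \<le> norm a * norm x"
      using Cauchy_Schwarz_ineq2[of a x] by (simp add: abs_le_iff)
    also have "\<dots> \<le> norm a * (\<tau> * (1 - \<epsilon>))"
      using x(1) by (intro mult_left_mono) auto
    finally show False by (simp add: mult.commute)
  qed
  have eq: "vol (minkowski_sum K (Z \<tau>)) = vol (zonotope_sum K {..<N} v \<tau>)" for K \<tau>
    unfolding Z_def by (rule measure_minkowski_sum_translation)
  show ?thesis
  proof (rule that[where N=N and v=v])
    fix K :: "(real^'n) set" and \<tau> :: real assume "compact K" "0 \<le> \<tau>"
    then show "vol (minkowski_sum K (cball 0 (\<tau> * (1 - \<epsilon>))))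
       \<le> vol (zonotope_sum K {..<N} v \<tau>)"
      "vol (zonotope_sum K {..<N} v \<tau>)
       \<le> vol (minkowski_sum K (cball 0 (\<tau> * (1 + \<epsilon>))))"
      unfolding eq[symmetric] using cZ[of \<tau>] low[of \<tau>] up[of \<tau>]
      by (intro measure_minkowski_sum_mono; simp)+
  qed
qed

section \<open>The Steiner polynomial\<close>

text \<open>For independent vectors this is the volume of the parallelotope on them times the volume
  of the projection of \<open>K\<close> to the orthogonal complement of their span. As a limit it
  refers to \<open>S\<close> alone and not to a larger index set.\<close>

definition zonotope_coeff :: "'a::euclidean_space set \<Rightarrow> ('b \<Rightarrow> 'a) \<Rightarrow> 'b set \<Rightarrow> real" where
  "zonotope_coeff K v S =
     Lim at_top (\<lambda>\<tau>. vol (zonotope_sum K S v \<tau>) / \<tau> ^ card S)"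

lemma tendsto_zonotope_coeff:
  fixes K :: "'a::euclidean_space set"
  assumes "compact K" "convex K" "finite S"
  shows "((\<lambda>\<tau>. vol (zonotope_sum K S v \<tau>) / \<tau> ^ card S)
           \<longlongrightarrow> zonotope_coeff K v S) at_top"
proof -
  obtain c where "((\<lambda>\<tau>. vol (zonotope_sum K S v \<tau>) / \<tau> ^ card S)
        \<longlongrightarrow> c S) at_top"
    using measure_zonotope_expansion[OF assms, of v] by auto
  then show ?thesis
    unfolding zonotope_coeff_def by (simp add: tendsto_Lim)
qed

lemma zonotope_coeff_nonneg:
  fixes K :: "'a::euclidean_space set"
  assumes "compact K" "convex K" "finite S"
  shows "0 \<le> zonotope_coeff K v S"
  by (rule tendsto_lowerbound[OF tendsto_zonotope_coeff[OF assms]])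
     (auto intro!: eventually_mono[OF eventually_gt_at_top[of 0]])

lemma measure_zonotope_sum_subsets:
  fixes K :: "'a::euclidean_space set"
  assumes K: "compact K" "convex K" and J: "finite J" and \<tau>: "0 \<le> \<tau>"
  shows "vol (zonotope_sum K J v \<tau>)
     = (\<Sum>S\<in>Pow J. zonotope_coeff K v S * \<tau> ^ card S)"
proof -
  obtain c where c: "\<forall>S\<subseteq>J.
      (\<forall>\<tau>\<ge>0. vol (zonotope_sum K S v \<tau>) = (\<Sum>T\<in>Pow S. c T * \<tau> ^ card T)) \<and>
      ((\<lambda>\<tau>. vol (zonotope_sum K S v \<tau>) / \<tau> ^ card S) \<longlongrightarrow> c S) at_top"
    using measure_zonotope_expansion[OF K J, of v] by (elim exE) (rule that)
  have "zonotope_coeff K v S = c S" if "S \<subseteq> J" for S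
    unfolding zonotope_coeff_def using c that by (simp add: tendsto_Lim)
  moreover have "vol (zonotope_sum K J v \<tau>) = (\<Sum>T\<in>Pow J. c T * \<tau> ^ card T)"
    using c \<tau> by simp
  ultimately show ?thesis
    by (simp cong: sum.cong_simp)
qed

text \<open>Links generators indexed by \<open>S\<close> to the set of vectors with which the cells
  work.\<close>

lemma segment_sum_reindex:
  assumes "inj_on v S"
  shows "segment_sum S v (\<lambda>_. \<tau>) = segment_sum (v ` S) (\<lambda>x. x) (\<lambda>_. \<tau>)"
proof (intro set_eqI iffI)
  fix x assume "x \<in> segment_sum S v (\<lambda>_. \<tau>)"
  then obtain z where z: "x = (\<Sum>j\<in>S. z j *\<^sub>R v j)" "\<forall>j\<in>S. 0 \<le> z j \<and> z j \<le> \<tau>"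
    unfolding segment_sum_def by blast
  have "x = (\<Sum>w\<in>v ` S. z (the_inv_into S v w) *\<^sub>R w)"
    unfolding z(1) using assms by (subst sum.reindex) (auto simp: the_inv_into_f_f intro!: sum.cong)
  moreover have "\<forall>w\<in>v ` S. 0 \<le> z (the_inv_into S v w) \<and> z (the_inv_into S v w) \<le> \<tau>"
    using z(2) assms by (auto simp: the_inv_into_f_f)
  ultimately show "x \<in> segment_sum (v ` S) (\<lambda>x. x) (\<lambda>_. \<tau>)"
    unfolding segment_sum_def mem_Collect_eq by (intro exI[of _ "\<lambda>w. z (the_inv_into S v w)"] conjI)
next
  fix x assume "x \<in> segment_sum (v ` S) (\<lambda>x. x) (\<lambda>_. \<tau>)"
  then obtain z where z: "x = (\<Sum>w\<in>v ` S. z w *\<^sub>R w)" "\<forall>w\<in>v ` S. 0 \<le> z w \<and> z w \<le> \<tau>"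
    unfolding segment_sum_def by blast
  have "x = (\<Sum>j\<in>S. z (v j) *\<^sub>R v j)"
    unfolding z(1) using assms by (simp add: sum.reindex)
  then show "x \<in> segment_sum S v (\<lambda>_. \<tau>)"
    using z(2) unfolding segment_sum_def mem_Collect_eq by (intro exI[of _ "\<lambda>j. z (v j)"] conjI) auto
qed

text \<open>All generators lie in the span of a smaller subfamily \<open>T\<close>, so their sum of
  segments fits into a translate of a dilated one over \<open>T\<close>. The volume grows at most
  like \<open>\<tau> ^ card T\<close>, a lower power than the normalisation. Repeated vectors count
  as dependent.\<close>

lemma zonotope_coeff_dependent:
  fixes K :: "'a::euclidean_space set" and v :: "'b \<Rightarrow> 'a"
  assumes K: "compact K" "convex K" and S: "finite S" and dep: "\<not> (inj_on v S \<and> independent (v ` S))"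
  shows "zonotope_coeff K v S = 0"
proof -
  obtain B where B: "B \<subseteq> v ` S" "independent B" "v ` S \<subseteq> span B"
    by (rule maximal_independent_subset)
  obtain T where T: "T \<subseteq> S" "inj_on v T" "v ` T = B"
    using B(1) subset_image_inj[of B v S] by blast
  have "T \<noteq> S" using dep T B(2) by blast
  then have card: "card T < card S" using T(1) S by (intro psubset_card_mono) auto
  have finT: "finite T" using T(1) S finite_subset by blast
  have "\<exists>a. v j = (\<Sum>k\<in>T. a k *\<^sub>R v k)" if "j \<in> S" for j
  proof -
    have "v j \<in> span (v ` T)" using B(3) that T(3) by blast
    then obtain u where "v j = (\<Sum>w\<in>v ` T. u w *\<^sub>R w)"
      using span_finite[of "v ` T"] finT by auto
    then have "v j = (\<Sum>k\<in>T. u (v k) *\<^sub>R v k)" using T(2) by (simp add: sum.reindex)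
    then show ?thesis by (intro exI[of _ "\<lambda>k. u (v k)"])
  qed
  then obtain a where a: "\<And>j. j \<in> S \<Longrightarrow> v j = (\<Sum>k\<in>T. a j k *\<^sub>R v k)" by metis
  \<comment> \<open>The coordinates over \<open>T\<close> are at most \<open>M * \<tau>\<close> in
    absolute value. Shifting this symmetric range to start at 0 produces the length
    \<open>2 * M * \<tau>\<close>, and the summand 1 makes \<open>M\<close> positive, so that the
    length tends to infinity with \<open>\<tau>\<close>.\<close>
  define M where "M = (\<Sum>j\<in>S. \<Sum>k\<in>T. \<bar>a j k\<bar>) + 1"
  have M: "M > 0" unfolding M_def by (intro add_nonneg_pos sum_nonneg) auto
  have sub: "segment_sum S v (\<lambda>_. \<tau>) \<subseteq> (+) (- ((M * \<tau>) *\<^sub>R (\<Sum>k\<in>T. v k))) ` segment_sum T v (\<lambda>_. 2 * M * \<tau>)"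
    if \<tau>: "0 \<le> \<tau>" for \<tau>
  proof
    fix x assume "x \<in> segment_sum S v (\<lambda>_. \<tau>)"
    then obtain z where z: "x = (\<Sum>j\<in>S. z j *\<^sub>R v j)" "\<forall>j\<in>S. 0 \<le> z j \<and> z j \<le> \<tau>"
      unfolding segment_sum_def by blast
    define y where "y k = (\<Sum>j\<in>S. z j * a j k)" for k
    have "x = (\<Sum>j\<in>S. \<Sum>k\<in>T. (z j * a j k) *\<^sub>R v k)"
      unfolding z(1)
    proof (intro sum.cong refl)
      fix j assume "j \<in> S"
      show "z j *\<^sub>R v j = (\<Sum>k\<in>T. (z j * a j k) *\<^sub>R v k)"
        by (subst a[OF \<open>j \<in> S\<close>]) (simp add: scaleR_sum_right)
    qed
    also have "\<dots> = (\<Sum>k\<in>T. y k *\<^sub>R v k)"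
      by (subst sum.swap) (simp add: y_def scaleR_sum_left)
    finally have x: "x = (\<Sum>k\<in>T. y k *\<^sub>R v k)" .
    have yb: "\<bar>y k\<bar> \<le> M * \<tau>" if k: "k \<in> T" for k
    proof -
      have "\<bar>y k\<bar> \<le> (\<Sum>j\<in>S. \<bar>z j * a j k\<bar>)" unfolding y_def by (rule sum_abs)
      also have "\<dots> \<le> (\<Sum>j\<in>S. \<tau> * (\<Sum>k\<in>T. \<bar>a j k\<bar>))"
      proof (rule sum_mono)
        fix j assume j: "j \<in> S"
        have "\<bar>a j k\<bar> \<le> (\<Sum>k\<in>T. \<bar>a j k\<bar>)" using finT k by (intro member_le_sum) auto
        then show "\<bar>z j * a j k\<bar> \<le> \<tau> * (\<Sum>k\<in>T. \<bar>a j k\<bar>)"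
          unfolding abs_mult using z(2) j \<tau> by (intro mult_mono) auto
      qed
      also have "\<dots> \<le> M * \<tau>"
        using \<tau> by (simp add: M_def sum_distrib_left[symmetric] algebra_simps)
      finally show ?thesis .
    qed
    have "x = - ((M * \<tau>) *\<^sub>R (\<Sum>k\<in>T. v k)) + (\<Sum>k\<in>T. (y k + M * \<tau>) *\<^sub>R v k)"
      unfolding x by (simp add: scaleR_add_left sum.distrib scaleR_sum_right)
    moreover have "\<forall>k\<in>T. 0 \<le> y k + M * \<tau> \<and> y k + M * \<tau> \<le> 2 * M * \<tau>"
    proof
      fix k assume "k \<in> T"
      then show "0 \<le> y k + M * \<tau> \<and> y k + M * \<tau> \<le> 2 * M * \<tau>" using yb[of k] by (auto simp: abs_le_iff)
    qed
    then have "(\<Sum>k\<in>T. (y k + M * \<tau>) *\<^sub>R v k) \<in> segment_sum T v (\<lambda>_. 2 * M * \<tau>)"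
      unfolding segment_sum_def mem_Collect_eq by (intro exI[of _ "\<lambda>k. y k + M * \<tau>"] conjI refl)
    ultimately show "x \<in> (+) (- ((M * \<tau>) *\<^sub>R (\<Sum>k\<in>T. v k))) ` segment_sum T v (\<lambda>_. 2 * M * \<tau>)"
      by blast
  qed
  define f where "f \<sigma> = vol (zonotope_sum K T v \<sigma>)" for \<sigma>
  have le: "vol (zonotope_sum K S v \<tau>) \<le> f (2 * M * \<tau>)" if \<tau>: "0 \<le> \<tau>" for \<tau>
  proof -
    have "vol (zonotope_sum K S v \<tau>)
      \<le> vol (minkowski_sum K ((+) (- ((M * \<tau>) *\<^sub>R (\<Sum>k\<in>T. v k))) ` segment_sum T v (\<lambda>_. 2 * M * \<tau>)))"
      using K(1) compact_convex_segment_sum[OF S] compact_convex_segment_sum[OF finT] sub[OF \<tau>]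
      by (intro measure_minkowski_sum_mono compact_translation) auto
    then show ?thesis
      unfolding measure_minkowski_sum_translation f_def .
  qed
  have "filterlim (\<lambda>\<tau>. 2 * M * \<tau>) at_top at_top"
    using M by (intro filterlim_tendsto_pos_mult_at_top[OF tendsto_const] filterlim_ident) auto
  then have 1: "((\<lambda>\<tau>. f (2 * M * \<tau>) / (2 * M * \<tau>) ^ card T) \<longlongrightarrow> zonotope_coeff K v T) at_top"
    using filterlim_compose[OF tendsto_zonotope_coeff[OF K finT, of v]] unfolding f_def by blast
  have d: "0 < card S - card T" using card by simp
  have 2: "((\<lambda>\<tau>::real. inverse (\<tau> ^ (card S - card T))) \<longlongrightarrow> 0) at_top"
    by (intro tendsto_inverse_0_at_top filterlim_pow_at_top[OF d] filterlim_ident)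
  have "((\<lambda>\<tau>. f (2 * M * \<tau>) / (2 * M * \<tau>) ^ card T * (2 * M) ^ card T * inverse (\<tau> ^ (card S - card T)))
      \<longlongrightarrow> zonotope_coeff K v T * (2 * M) ^ card T * 0) at_top"
    by (intro tendsto_mult 1 2 tendsto_const)
  moreover have "eventually (\<lambda>\<tau>. vol (zonotope_sum K S v \<tau>) / \<tau> ^ card S
      \<le> f (2 * M * \<tau>) / (2 * M * \<tau>) ^ card T * (2 * M) ^ card T * inverse (\<tau> ^ (card S - card T))) at_top"
    using eventually_gt_at_top[of 0]
  proof eventually_elim
    case (elim \<tau>)
    have p: "\<tau> ^ card S = \<tau> ^ card T * \<tau> ^ (card S - card T)"
      using card by (simp flip: power_add)
    have "f (2 * M * \<tau>) / (2 * M * \<tau>) ^ card T * (2 * M) ^ card T * inverse (\<tau> ^ (card S - card T))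
        = f (2 * M * \<tau>) / \<tau> ^ card S"
      using elim M unfolding p by (simp add: power_mult_distrib field_simps)
    then show ?case using le[of \<tau>] elim by (simp add: divide_right_mono)
  qed
  ultimately have "zonotope_coeff K v S \<le> zonotope_coeff K v T * (2 * M) ^ card T * 0"
    using tendsto_le[OF _ _ tendsto_zonotope_coeff[OF K S, of v]] by simp
  then show ?thesis using zonotope_coeff_nonneg[OF K S, of v] by simp
qed

text \<open>A version with finitely many points, and up to a factor $\kappa$, of the statement that $C$ lies in
  the hull of the radial geometric mean of $A$ and $B$.\<close>

definition radial_mean_cover :: "real \<Rightarrow> 'a::euclidean_space set \<Rightarrow> 'a set \<Rightarrow> 'a set \<Rightarrow> bool" where
  "radial_mean_cover l A B C \<longleftrightarrow> (\<forall>\<kappa>. 0 < \<kappa> \<longrightarrow> \<kappa> < 1 \<longrightarrow> (\<exists>P \<alpha> \<beta>. finite P \<and>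
     (\<forall>x\<in>C. \<exists>s. (\<forall>p\<in>P. 0 \<le> s p) \<and> (\<Sum>p\<in>P. s p) \<le> 1 \<and> x = (\<Sum>p\<in>P. s p *\<^sub>R p)) \<and>
     (\<forall>p\<in>P. 0 < \<alpha> p \<and> \<alpha> p *\<^sub>R p \<in> A \<and> 0 < \<beta> p \<and> \<beta> p *\<^sub>R p \<in> B
        \<and> \<kappa> \<le> \<alpha> p powr l * \<beta> p powr (1 - l))))"

text \<open>For dependent vectors the left side is 0. Otherwise each \<open>\<kappa>\<close> below 1
  gives the inequality with an extra factor \<open>\<kappa> ^ m\<close>, and \<open>\<kappa>\<close>
  tends to 1.\<close>

lemma zonotope_coeff_inequality:
  fixes A B C :: "'a::euclidean_space set" and v :: "'b \<Rightarrow> 'a"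
  assumes A: "compact A" "convex A" "0 \<in> A" and B: "compact B" "convex B" "0 \<in> B"
    and C: "compact C" "convex C" and l: "0 < l" "l < 1" and cover: "radial_mean_cover l A B C"
    and S: "finite S"
  shows "zonotope_coeff C v S \<le> zonotope_coeff A v S powr l * zonotope_coeff B v S powr (1 - l)"
proof (cases "inj_on v S \<and> independent (v ` S)")
  case False
  then show ?thesis using zonotope_coeff_dependent[OF C S] by simp
next
  case True
  define m where "m = DIM('a) - card (v ` S)"
  have lim: "((\<lambda>\<tau>. vol (zonotope_sum K (v ` S) (\<lambda>x. x) \<tau>) / \<tau> ^ card (v ` S))
        \<longlongrightarrow> zonotope_coeff K v S) at_top" if "compact K" "convex K" for K
    using tendsto_zonotope_coeff[OF that S, of v]
    unfolding segment_sum_reindex[OF conjunct1[OF True]] card_image[OF conjunct1[OF True]] .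
  have "\<kappa> ^ m * zonotope_coeff C v S \<le> zonotope_coeff A v S powr l * zonotope_coeff B v S powr (1 - l)"
    if \<kappa>: "0 < \<kappa>" "\<kappa> < 1" for \<kappa>
  proof -
    obtain P \<alpha> \<beta> where H: "finite P \<and>
     (\<forall>x\<in>C. \<exists>s. (\<forall>p\<in>P. 0 \<le> s p) \<and> (\<Sum>p\<in>P. s p) \<le> 1 \<and> x = (\<Sum>p\<in>P. s p *\<^sub>R p)) \<and>
     (\<forall>p\<in>P. 0 < \<alpha> p \<and> \<alpha> p *\<^sub>R p \<in> A \<and> 0 < \<beta> p \<and> \<beta> p *\<^sub>R p \<in> B
        \<and> \<kappa> \<le> \<alpha> p powr l * \<beta> p powr (1 - l))"
      using cover[unfolded radial_mean_cover_def, THEN spec, THEN mp, OF \<kappa>(1), THEN mp, OF \<kappa>(2)]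
      by (elim exE) (rule that)
    then have P: "finite P"
      and cov: "\<And>x. x \<in> C \<Longrightarrow> \<exists>s. (\<forall>p\<in>P. 0 \<le> s p) \<and> (\<Sum>p\<in>P. s p) \<le> 1 \<and> x = (\<Sum>p\<in>P. s p *\<^sub>R p)"
      and ab: "\<And>p. p \<in> P \<Longrightarrow> 0 < \<alpha> p" "\<And>p. p \<in> P \<Longrightarrow> \<alpha> p *\<^sub>R p \<in> A"
        "\<And>p. p \<in> P \<Longrightarrow> 0 < \<beta> p" "\<And>p. p \<in> P \<Longrightarrow> \<beta> p *\<^sub>R p \<in> B"
      and ab\<kappa>: "\<And>p. p \<in> P \<Longrightarrow> \<kappa> \<le> \<alpha> p powr l * \<beta> p powr (1 - l)"
      by blast+
    have ind: "independent (v ` S)" using True by simp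
    show ?thesis
      unfolding m_def
      by (rule zonotope_coefficient_inequality[OF ind A B C(1) P cov ab l \<kappa>(1) ab\<kappa>
            lim[OF A(1,2)] lim[OF B(1,2)] lim[OF C]])
  qed
  then have "eventually (\<lambda>\<kappa>. \<kappa> ^ m * zonotope_coeff C v S
      \<le> zonotope_coeff A v S powr l * zonotope_coeff B v S powr (1 - l)) (at_left 1)"
    using eventually_at_left_real[of 0 1] by (auto elim!: eventually_mono)
  moreover have "((\<lambda>\<kappa>. \<kappa> ^ m * zonotope_coeff C v S) \<longlongrightarrow> 1 ^ m * zonotope_coeff C v S) (at_left 1)"
    by (intro tendsto_intros)
  ultimately have "1 ^ m * zonotope_coeff C v S \<le> zonotope_coeff A v S powr l * zonotope_coeff B v S powr (1 - l)"
    using tendsto_upperbound[of "\<lambda>\<kappa>. \<kappa> ^ m * zonotope_coeff C v S" _ "at_left 1"] by simp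
  then show ?thesis by simp
qed

section \<open>From the polynomials of zonotopes to the Steiner polynomial\<close>

definition zonotope_poly_coeff :: "'a::euclidean_space set \<Rightarrow> ('b \<Rightarrow> 'a) \<Rightarrow> 'b set \<Rightarrow> nat \<Rightarrow> real" where
  "zonotope_poly_coeff K v J k = (\<Sum>S\<in>{S\<in>Pow J. card S = k}. zonotope_coeff K v S)"

lemma zonotope_poly_coeff_nonneg:
  assumes "compact K" "convex K" "finite J"
  shows "0 \<le> zonotope_poly_coeff K v J k"
  unfolding zonotope_poly_coeff_def using assms finite_subset
  by (intro sum_nonneg zonotope_coeff_nonneg) auto

text \<open>More than \<open>DIM('a)\<close> vectors are dependent, so larger sets contribute
  nothing. The degree thus stays bounded while the number of segments grows, which permits a limit
  of the coefficients.\<close>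

lemma measure_zonotope_sum:
  fixes K :: "'a::euclidean_space set"
  assumes K: "compact K" "convex K" and J: "finite J" and \<tau>: "0 \<le> \<tau>"
  shows "vol (zonotope_sum K J v \<tau>)
     = (\<Sum>k\<le>DIM('a). zonotope_poly_coeff K v J k * \<tau> ^ k)"
proof -
  have zero: "zonotope_coeff K v S = 0" if "S \<subseteq> J" "DIM('a) < card S" for S
  proof (rule zonotope_coeff_dependent[OF K])
    show "finite S" using that J finite_subset by blast
    show "\<not> (inj_on v S \<and> independent (v ` S))"
    proof
      assume "inj_on v S \<and> independent (v ` S)"
      then have "card S \<le> DIM('a)" using independent_card_le[of "v ` S"] card_image[of v S] by simp
      then show False using that(2) by simp
    qed
  qed
  have "vol (zonotope_sum K J v \<tau>)
      = (\<Sum>S\<in>Pow J. zonotope_coeff K v S * \<tau> ^ card S)"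
    by (rule measure_zonotope_sum_subsets[OF K J \<tau>])
  also have "\<dots> = (\<Sum>S\<in>{S\<in>Pow J. card S \<le> DIM('a)}. zonotope_coeff K v S * \<tau> ^ card S)"
    using J zero by (intro sum.mono_neutral_right) auto
  also have "\<dots> = (\<Sum>k\<le>DIM('a). \<Sum>S\<in>{S\<in>{S\<in>Pow J. card S \<le> DIM('a)}. card S = k}. zonotope_coeff K v S * \<tau> ^ card S)"
    using J by (intro sum.group[symmetric]) auto
  also have "\<dots> = (\<Sum>k\<le>DIM('a). zonotope_poly_coeff K v J k * \<tau> ^ k)"
    unfolding zonotope_poly_coeff_def sum_distrib_right by (intro sum.cong) auto
  finally show ?thesis .
qed

lemma zonotope_poly_coeff_inequality:
  fixes A B C :: "'a::euclidean_space set" and v :: "'b \<Rightarrow> 'a"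
  assumes A: "compact A" "convex A" "0 \<in> A" and B: "compact B" "convex B" "0 \<in> B"
    and C: "compact C" "convex C" and l: "0 < l" "l < 1" and cover: "radial_mean_cover l A B C"
    and J: "finite J"
  shows "zonotope_poly_coeff C v J k \<le> zonotope_poly_coeff A v J k powr l * zonotope_poly_coeff B v J k powr (1 - l)"
proof -
  have fin: "finite S" if "S \<subseteq> J" for S using that J finite_subset by blast
  have "zonotope_poly_coeff C v J k
      \<le> (\<Sum>S\<in>{S\<in>Pow J. card S = k}. zonotope_coeff A v S powr l * zonotope_coeff B v S powr (1 - l))"
    unfolding zonotope_poly_coeff_def
    using zonotope_coeff_inequality[OF A B C l cover] fin by (intro sum_mono) auto
  also have "\<dots> \<le> zonotope_poly_coeff A v J k powr l * zonotope_poly_coeff B v J k powr (1 - l)"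
    unfolding zonotope_poly_coeff_def
    using A B l J fin by (intro Holder_sum_powr zonotope_coeff_nonneg) auto
  finally show ?thesis .
qed

text \<open>Subtracting \<open>2 ^ Suc n\<close> times the value at \<open>t\<close> from the value
  at \<open>2 * t\<close> removes the top term and multiplies the coefficient of degree
  \<open>k\<close> by the nonzero number \<open>2 ^ k - 2 ^ Suc n\<close>. Induction yields the
  lower coefficients, and the value at 1 then gives the top one.\<close>

lemma convergent_coefficients:
  fixes q :: "nat \<Rightarrow> nat \<Rightarrow> real"
  assumes "\<And>t. 0 < t \<Longrightarrow> convergent (\<lambda>N. \<Sum>k\<le>n. q N k * t ^ k)" and "k \<le> n"
  shows "convergent (\<lambda>N. q N k)"
  using assms
proof (induction n arbitrary: q k)
  case 0
  then show ?case using "0.prems"(1)[of 1] by simp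
next
  case (Suc n)
  have low: "convergent (\<lambda>N. q N k)" if k: "k \<le> n" for k
  proof -
    define c where "c k = (2::real) ^ k - 2 ^ Suc n" for k
    have ck: "c k \<noteq> 0" using k by (simp add: c_def flip: power_Suc)
    have "convergent (\<lambda>N. \<Sum>k\<le>n. (c k * q N k) * t ^ k)" if t: "0 < t" for t
    proof -
      have "(\<Sum>k\<le>n. (c k * q N k) * t ^ k)
          = (\<Sum>k\<le>Suc n. q N k * (2 * t) ^ k) - 2 ^ Suc n * (\<Sum>k\<le>Suc n. q N k * t ^ k)" for N
      proof -
        have "(\<Sum>k\<le>Suc n. q N k * (2 * t) ^ k) - 2 ^ Suc n * (\<Sum>k\<le>Suc n. q N k * t ^ k)
            = (\<Sum>k\<le>Suc n. (c k * q N k) * t ^ k)"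
          unfolding sum_distrib_left sum_subtractf[symmetric] c_def
          by (intro sum.cong refl) (simp add: power_mult_distrib algebra_simps)
        then show ?thesis by (simp add: c_def)
      qed
      moreover have "convergent (\<lambda>N. \<Sum>k\<le>Suc n. q N k * (2 * t) ^ k)"
        using t by (intro Suc.prems(1)) auto
      moreover have "convergent (\<lambda>N. 2 ^ Suc n * (\<Sum>k\<le>Suc n. q N k * t ^ k))"
        using Suc.prems(1)[OF t] by (intro convergent_mult convergent_const)
      ultimately show ?thesis by (simp only: convergent_diff)
    qed
    then have "convergent (\<lambda>N. c k * q N k)"
      using Suc.IH[of "\<lambda>N k. c k * q N k" k] k by simp
    then show ?thesis using convergent_mult_const_iff[OF ck] by simp
  qed
  show ?case
  proof (cases "k = Suc n")
    case False
    then show ?thesis using low Suc.prems(2) by simp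
  next
    case True
    have "convergent (\<lambda>N. (\<Sum>k\<le>Suc n. q N k * 1 ^ k) - (\<Sum>k\<le>n. q N k))"
    proof (rule convergent_diff)
      show "convergent (\<lambda>N. \<Sum>k\<le>Suc n. q N k * 1 ^ k)" by (rule Suc.prems(1)) simp
      show "convergent (\<lambda>N. \<Sum>k\<le>n. q N k)" using low by (intro convergent_sum) simp
    qed
    then show ?thesis using True by simp
  qed
qed

lemma polynomial_coeffs_unique:
  fixes c d :: "nat \<Rightarrow> real"
  assumes "\<And>t. 0 < t \<Longrightarrow> (\<Sum>i\<le>n. c i * t ^ i) = (\<Sum>i\<le>n. d i * t ^ i)" and "i \<le> n"
  shows "c i = d i"
proof (rule ccontr)
  assume "c i \<noteq> d i"
  then have "finite {t. (\<Sum>i\<le>n. (c i - d i) * t ^ i) = 0}"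
    unfolding polyfun_finite_roots using assms(2) by (intro exI[of _ i]) auto
  moreover have "{0<..} \<subseteq> {t. (\<Sum>i\<le>n. (c i - d i) * t ^ i) = 0}"
    using assms(1) by (auto simp: left_diff_distrib sum_subtractf)
  ultimately have "finite {0::real<..}" using finite_subset by blast
  then show False using infinite_Ioi[of "0::real"] by blast
qed

text \<open>The ball of radius \<open>s\<close> lies in the dilate of \<open>K\<close> by
  \<open>s / r\<close>, so by convexity the larger parallel body lies in the dilate of the smaller
  one by \<open>1 + s / r\<close>. This provides continuity in the radius before Steiner's formula
  is available.\<close>

lemma measure_parallel_growth:
  fixes K :: "'a::euclidean_space set"
  assumes K: "compact K" "convex K" and r: "0 < r" "cball 0 r \<subseteq> K" and \<sigma>: "0 \<le> \<sigma>" and s: "0 \<le> s"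
  shows "vol (minkowski_sum K (cball 0 (\<sigma> + s)))
     \<le> (1 + s / r) ^ DIM('a) * vol (minkowski_sum K (cball 0 \<sigma>))"
proof -
  define m where "m = 1 + s / r"
  have m: "1 \<le> m" using r s by (simp add: m_def)
  have c: "compact (minkowski_sum K (cball 0 \<rho>))" for \<rho>
    using K(1) by (intro compact_minkowski_sum) auto
  have sub: "minkowski_sum K (cball 0 (\<sigma> + s)) \<subseteq> (\<lambda>x. m *\<^sub>R x + 0) ` minkowski_sum K (cball 0 \<sigma>)"
  proof
    fix x assume "x \<in> minkowski_sum K (cball 0 (\<sigma> + s))"
    then obtain k b where x: "k \<in> K" "norm b \<le> \<sigma> + s" "x = k + b"
      unfolding minkowski_sum_def by auto
    have "\<exists>b1 b2. b = b1 + b2 \<and> norm b1 \<le> \<sigma> \<and> norm b2 \<le> s"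
    proof (cases "\<sigma> + s = 0")
      case True
      then show ?thesis using x(2) \<sigma> s by (intro exI[of _ 0]) auto
    next
      case False
      then have p: "\<sigma> + s > 0" using \<sigma> s by simp
      define u where "u = norm b / (\<sigma> + s)"
      have u: "0 \<le> u" "u \<le> 1" using p x(2) by (auto simp: u_def)
      have "b = (\<sigma> / (\<sigma> + s)) *\<^sub>R b + (s / (\<sigma> + s)) *\<^sub>R b"
        using p by (simp flip: scaleR_add_left add_divide_distrib)
      moreover have "norm ((\<sigma> / (\<sigma> + s)) *\<^sub>R b) \<le> \<sigma>"
        using mult_left_le[OF u(2) \<sigma>] \<sigma> p by (simp add: u_def)
      moreover have "norm ((s / (\<sigma> + s)) *\<^sub>R b) \<le> s"
        using mult_left_le[OF u(2) s] s p by (simp add: u_def)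
      ultimately show ?thesis by blast
    qed
    then obtain b1 b2 where b: "b = b1 + b2" "norm b1 \<le> \<sigma>" "norm b2 \<le> s" by blast
    have "\<exists>k2\<in>K. b2 = (m - 1) *\<^sub>R k2"
    proof (cases "s = 0")
      case True
      then show ?thesis using b(3) x(1) by (intro bexI[of _ k]) (auto simp: m_def)
    next
      case False
      then have "0 < s" using s by simp
      have "(r / s) *\<^sub>R b2 \<in> cball 0 r"
        using b(3) r \<open>0 < s\<close> by (simp add: pos_divide_le_eq)
      then show ?thesis
        using r \<open>0 < s\<close> by (intro bexI[of _ "(r / s) *\<^sub>R b2"]) (auto simp: m_def)
    qed
    then obtain k2 where k2: "k2 \<in> K" "b2 = (m - 1) *\<^sub>R k2" by blast
    \<comment> \<open>Convexity of \<open>K\<close> collects \<open>k + (m - 1) *\<^sub>R k2\<close>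
      into \<open>m *\<^sub>R y\<close>.\<close>
    define y where "y = (1 / m) *\<^sub>R k + ((m - 1) / m) *\<^sub>R k2"
    have "1 / m + (m - 1) / m = 1" using m by (simp add: field_simps)
    then have yK: "y \<in> K"
      unfolding y_def using K(2) x(1) k2(1) m by (intro convexD) auto
    have "norm ((1 / m) *\<^sub>R b1) \<le> \<sigma>"
    proof -
      have "norm b1 / m \<le> norm b1 / 1" using m by (intro divide_left_mono) auto
      then show ?thesis using b(2) m by simp
    qed
    then have "y + (1 / m) *\<^sub>R b1 \<in> minkowski_sum K (cball 0 \<sigma>)"
      using yK unfolding minkowski_sum_def mem_Collect_eq
      by (intro exI[of _ y] exI[of _ "(1 / m) *\<^sub>R b1"] conjI) auto
    moreover have "x = m *\<^sub>R (y + (1 / m) *\<^sub>R b1) + 0"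
      unfolding x(3) b(1) k2(2) y_def using m by (simp add: scaleR_add_right)
    ultimately show "x \<in> (\<lambda>x. m *\<^sub>R x + 0) ` minkowski_sum K (cball 0 \<sigma>)" by blast
  qed
  have "vol (minkowski_sum K (cball 0 (\<sigma> + s)))
      \<le> vol ((\<lambda>x. m *\<^sub>R x + 0) ` minkowski_sum K (cball 0 \<sigma>))"
    using sub c by (intro measure_mono_fmeasurable)
      (auto intro!: fmeasurableD lmeasurable_compact compact_scaling)
  also have "\<dots> = \<bar>m\<bar> ^ DIM('a) * vol (minkowski_sum K (cball 0 \<sigma>))"
    by (rule measure_lebesgue_affine)
  finally show ?thesis using m by (simp add: m_def)
qed

text \<open>The order of quantifiers matters: the zonotopes come before \<open>K\<close>, since
  coefficients of different bodies are compared for a common zonotope. A ball around 0 inside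
  \<open>K\<close> turns the error in the radius into a factor tending to 1.\<close>

lemma zonotopes_converge_to_ball:
  "\<exists>(M :: nat \<Rightarrow> nat) (v :: nat \<Rightarrow> nat \<Rightarrow> real^'n).
    \<forall>K r \<tau>. compact K \<and> convex K \<and> 0 < r \<and> cball 0 r \<subseteq> K \<and> 0 < \<tau> \<longrightarrow>
      (\<lambda>N. vol (zonotope_sum K {..<M N} (v N) \<tau>))
        \<longlonglongrightarrow> vol (minkowski_sum K (cball 0 \<tau>))"
proof -
  \<comment> \<open>The double \<open>Suc\<close> keeps \<open>e N\<close> strictly below 1, so that
    the inner radius is positive.\<close>
  define e where "e N = inverse (real (Suc (Suc N)))" for N
  have e: "0 < e N" "e N < 1" for N
    by (auto simp: e_def inverse_less_1_iff)
  have e0: "e \<longlonglongrightarrow> 0"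
    unfolding e_def[abs_def] using LIMSEQ_Suc[OF LIMSEQ_inverse_real_of_nat] .
  have "\<exists>M v. \<forall>K \<tau>. compact (K :: (real^'n) set) \<longrightarrow> 0 \<le> \<tau> \<longrightarrow>
      vol (minkowski_sum K (cball 0 (\<tau> * (1 - e N))))
        \<le> vol (minkowski_sum K (segment_sum {..<M::nat} v (\<lambda>_. \<tau>))) \<and>
      vol (zonotope_sum K {..<M} v \<tau>)
        \<le> vol (minkowski_sum K (cball 0 (\<tau> * (1 + e N))))" for N
    using zonotope_ball_sandwich[OF e(1)[of N]] by metis
  then obtain M and v :: "nat \<Rightarrow> nat \<Rightarrow> real^'n" where Mv: "\<And>N K \<tau>. compact (K :: (real^'n) set) \<Longrightarrow> 0 \<le> \<tau> \<Longrightarrow>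
      vol (minkowski_sum K (cball 0 (\<tau> * (1 - e N))))
        \<le> vol (zonotope_sum K {..<M N} (v N) \<tau>) \<and>
      vol (zonotope_sum K {..<M N} (v N) \<tau>)
        \<le> vol (minkowski_sum K (cball 0 (\<tau> * (1 + e N))))"
    by metis
  show ?thesis
  proof (intro exI[of _ M] exI[of _ v] allI impI)
    fix K :: "(real^'n) set" and r \<tau> :: real
    assume "compact K \<and> convex K \<and> 0 < r \<and> cball 0 r \<subseteq> K \<and> 0 < \<tau>"
    then have K: "compact K" "convex K" and r: "0 < r" "cball 0 r \<subseteq> K" and \<tau>: "0 < \<tau>" by auto
    define f where "f \<sigma> = vol (minkowski_sum K (cball 0 \<sigma>))" for \<sigma>
    define g where "g N = (1 + \<tau> * e N / r) ^ DIM(real^'n)" for N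
    have gpos: "g N > 0" for N
      unfolding g_def using \<tau> e(1)[of N] r by (intro zero_less_power add_pos_nonneg) auto
    have "g \<longlonglongrightarrow> (1 + \<tau> * 0 / r) ^ DIM(real^'n)"
      unfolding g_def[abs_def] using r by (intro tendsto_intros e0) auto
    then have g1: "g \<longlonglongrightarrow> 1" by simp
    have up: "f (\<tau> * (1 + e N)) \<le> g N * f \<tau>" for N
      using measure_parallel_growth[OF K r, of \<tau> "\<tau> * e N"] \<tau> e(1)[of N]
      by (simp add: f_def g_def algebra_simps)
    have low: "f \<tau> / g N \<le> f (\<tau> * (1 - e N))" for N
      using measure_parallel_growth[OF K r, of "\<tau> * (1 - e N)" "\<tau> * e N"] \<tau> e[of N] gpos[of N]
      by (simp add: f_def g_def pos_divide_le_eq algebra_simps)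
    show "(\<lambda>N. vol (zonotope_sum K {..<M N} (v N) \<tau>))
        \<longlonglongrightarrow> vol (minkowski_sum K (cball 0 \<tau>))"
    proof (rule tendsto_sandwich)
      show "\<forall>\<^sub>F N in sequentially. f \<tau> / g N \<le> vol (zonotope_sum K {..<M N} (v N) \<tau>)"
        using Mv[OF K(1), of \<tau>] low \<tau> unfolding f_def by (intro always_eventually allI) (meson less_imp_le order_trans)
      show "\<forall>\<^sub>F N in sequentially. vol (zonotope_sum K {..<M N} (v N) \<tau>) \<le> g N * f \<tau>"
        using Mv[OF K(1), of \<tau>] up \<tau> unfolding f_def by (intro always_eventually allI) (meson less_imp_le order_trans)
      have "(\<lambda>N. f \<tau> / g N) \<longlonglongrightarrow> f \<tau> / 1" "(\<lambda>N. g N * f \<tau>) \<longlonglongrightarrow> 1 * f \<tau>"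
        by (intro tendsto_intros g1; simp)+
      then show "(\<lambda>N. f \<tau> / g N) \<longlonglongrightarrow> vol (minkowski_sum K (cball 0 \<tau>))"
        "(\<lambda>N. g N * f \<tau>) \<longlonglongrightarrow> vol (minkowski_sum K (cball 0 \<tau>))"
        by (simp_all add: f_def)
    qed
  qed
qed

text \<open>A polynomial is determined by its values at positive \<open>t\<close>, so an expansion
  found by any means is the one that \<open>THE\<close> describes.\<close>

lemma quermassintegral_eqI:
  fixes K :: "'a::euclidean_space set"
  assumes steiner: "\<And>t. 0 < t \<Longrightarrow> vol (minkowski_sum K (cball 0 t)) = (\<Sum>k\<le>DIM('a). q k * t ^ k)"
    and i: "i \<le> DIM('a)"
  shows "quermassintegral i K = q i / (DIM('a) choose i)"
proof -
  define W where "W j = (if j \<le> DIM('a) then q j / (DIM('a) choose j) else 0)" for j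
  have out: "outer_parallel K t = minkowski_sum K (cball 0 t)" if t: "0 < t" for t
  proof (intro set_eqI iffI)
    fix x assume "x \<in> outer_parallel K t"
    then obtain y b where "y \<in> K" "norm b \<le> 1" "x = y + t *\<^sub>R b"
      unfolding outer_parallel_def by auto
    moreover have "norm (t *\<^sub>R b) \<le> t" using t \<open>norm b \<le> 1\<close> by (simp add: mult_left_le)
    ultimately show "x \<in> minkowski_sum K (cball 0 t)"
      unfolding minkowski_sum_def mem_Collect_eq by (intro exI[of _ y] exI[of _ "t *\<^sub>R b"] conjI) auto
  next
    fix x assume "x \<in> minkowski_sum K (cball 0 t)"
    then obtain y b where "y \<in> K" "norm b \<le> t" "x = y + b"
      unfolding minkowski_sum_def by auto
    then show "x \<in> outer_parallel K t"
      using t unfolding outer_parallel_def mem_Collect_eq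
      by (intro exI[of _ y] exI[of _ "(1 / t) *\<^sub>R b"] conjI) auto
  qed
  have bin: "real (DIM('a) choose j) \<noteq> 0" if "j \<le> DIM('a)" for j
    using that by simp
  have W: "(\<forall>t>0. vol (outer_parallel K t)
        = (\<Sum>j=0..DIM('a). real (DIM('a) choose j) * W j * t ^ j)) \<and> (\<forall>j>DIM('a). W j = 0)"
  proof (intro conjI allI impI)
    fix t :: real assume t: "0 < t"
    show "vol (outer_parallel K t) = (\<Sum>j=0..DIM('a). real (DIM('a) choose j) * W j * t ^ j)"
      unfolding out[OF t] steiner[OF t] using bin by (intro sum.cong) (auto simp: W_def)
  qed (simp add: W_def)
  have "W' = W" if W': "(\<forall>t>0. vol (outer_parallel K t)
        = (\<Sum>j=0..DIM('a). real (DIM('a) choose j) * W' j * t ^ j)) \<and> (\<forall>j>DIM('a). W' j = 0)" for W'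
  proof
    fix j
    show "W' j = W j"
    proof (cases "j \<le> DIM('a)")
      case True
      have "real (DIM('a) choose j) * W' j = real (DIM('a) choose j) * W j"
      proof (rule polynomial_coeffs_unique[OF _ True])
        fix t :: real assume "0 < t"
        then show "(\<Sum>j\<le>DIM('a). real (DIM('a) choose j) * W' j * t ^ j)
            = (\<Sum>j\<le>DIM('a). real (DIM('a) choose j) * W j * t ^ j)"
          using W W' unfolding atMost_atLeast0 by metis
      qed
      then show ?thesis using bin[OF True] by simp
    next
      case False
      then show ?thesis using W W' by simp
    qed
  qed
  then have "quermassintegral i K = W i"
    unfolding quermassintegral_def using W by (subst the_equality[where a=W]) auto
  then show ?thesis using i by (simp add: W_def)
qed

text \<open>The volumes of the sums with zonotopes are polynomials of degree at most
  \<open>n\<close> that converge at each positive \<open>t\<close>, so their coefficients converge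
  and the limits form the Steiner polynomial. The inequality holds at each stage and passes to the
  limit.\<close>

theorem quermassintegral_radial_mean:
  fixes A B C :: "(real^'n) set"
  assumes A: "compact A" "convex A" "0 \<in> interior A" and B: "compact B" "convex B" "0 \<in> interior B"
    and C: "compact C" "convex C" "0 \<in> interior C" and l: "0 < l" "l < 1"
    and cover: "radial_mean_cover l A B C" and i: "i \<le> CARD('n)"
  shows "quermassintegral i C \<le> quermassintegral i A powr l * quermassintegral i B powr (1 - l)"
proof -
  define n where "n = DIM(real^'n)"
  obtain M :: "nat \<Rightarrow> nat" and v :: "nat \<Rightarrow> nat \<Rightarrow> real^'n" where
    lim: "\<forall>K r \<tau>. compact K \<and> convex K \<and> 0 < r \<and> cball 0 r \<subseteq> K \<and> 0 < \<tau> \<longrightarrow>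
      (\<lambda>N. vol (zonotope_sum K {..<M N} (v N) \<tau>))
        \<longlonglongrightarrow> vol (minkowski_sum K (cball 0 \<tau>))"
    using zonotopes_converge_to_ball by (elim exE) (rule that)
  define q where "q K N k = zonotope_poly_coeff K (v N) {..<M N} k" for K N k
  have main: "quermassintegral i K = lim (\<lambda>N. q K N i) / (n choose i) \<and> convergent (\<lambda>N. q K N i)"
    if K: "compact K" "convex K" "0 \<in> interior K" for K
  proof -
    obtain r where r: "0 < r" "cball 0 r \<subseteq> K"
      using K(3) unfolding mem_interior_cball by blast
    have lim': "(\<lambda>N. \<Sum>k\<le>n. q K N k * t ^ k) \<longlonglongrightarrow> vol (minkowski_sum K (cball 0 t))" if t: "0 < t" for t
    proof -
      have "(\<Sum>k\<le>n. q K N k * t ^ k) = vol (zonotope_sum K {..<M N} (v N) t)" for N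
        unfolding q_def n_def using measure_zonotope_sum[OF K(1,2), of "{..<M N}" t "v N"] t by simp
      then show ?thesis using lim K(1,2) r t by simp
    qed
    have conv: "convergent (\<lambda>N. q K N k)" if "k \<le> n" for k
    proof (rule convergent_coefficients[OF _ that])
      fix t :: real assume "0 < t"
      from lim'[OF this] show "convergent (\<lambda>N. \<Sum>k\<le>n. q K N k * t ^ k)" by (rule convergentI)
    qed
    have "vol (minkowski_sum K (cball 0 t)) = (\<Sum>k\<le>DIM(real^'n). lim (\<lambda>N. q K N k) * t ^ k)" if t: "0 < t" for t
    proof (rule LIMSEQ_unique[OF lim'[OF t]])
      show "(\<lambda>N. \<Sum>k\<le>n. q K N k * t ^ k) \<longlonglongrightarrow> (\<Sum>k\<le>DIM(real^'n). lim (\<lambda>N. q K N k) * t ^ k)"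
        unfolding n_def[symmetric]
        using conv by (intro tendsto_intros) (auto simp: convergent_LIMSEQ_iff)
    qed
    then show ?thesis
      using quermassintegral_eqI[of K "\<lambda>k. lim (\<lambda>N. q K N k)" i] conv[of i] i by (simp add: n_def)
  qed
  have nn: "0 \<le> lim (\<lambda>N. q K N i)" if "compact K" "convex K" "0 \<in> interior K" for K
    using main[OF that] zonotope_poly_coeff_nonneg[OF that(1,2)]
    by (intro LIMSEQ_le_const[of "\<lambda>N. q K N i"]) (auto simp: convergent_LIMSEQ_iff q_def)
  have to: "(\<lambda>N. q K N i) \<longlonglongrightarrow> lim (\<lambda>N. q K N i)" if "compact K" "convex K" "0 \<in> interior K" for K
    using main[OF that] by (simp add: convergent_LIMSEQ_iff)
  have "lim (\<lambda>N. q C N i) \<le> lim (\<lambda>N. q A N i) powr l * lim (\<lambda>N. q B N i) powr (1 - l)"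
  proof (rule LIMSEQ_le[OF to[OF C]])
    have "eventually (\<lambda>N. 0 \<le> q K N i) sequentially" if "compact K" "convex K" for K
      unfolding q_def by (intro always_eventually allI zonotope_poly_coeff_nonneg[OF that]) simp
    then show "(\<lambda>N. q A N i powr l * q B N i powr (1 - l)) \<longlonglongrightarrow> lim (\<lambda>N. q A N i) powr l * lim (\<lambda>N. q B N i) powr (1 - l)"
      using l A B by (intro tendsto_mult tendsto_powr2 to tendsto_const) auto
    show "\<exists>N. \<forall>k\<ge>N. q C k i \<le> q A k i powr l * q B k i powr (1 - l)"
      unfolding q_def using interior_subset A B
      by (intro exI allI impI zonotope_poly_coeff_inequality[OF A(1,2) _ B(1,2) _ C(1,2) l cover]) auto
  qed
  then have "lim (\<lambda>N. q C N i) / (n choose i)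
      \<le> lim (\<lambda>N. q A N i) powr l * lim (\<lambda>N. q B N i) powr (1 - l) / (n choose i)"
    by (intro divide_right_mono) auto
  \<comment> \<open>The exponents sum to 1, so the binomial coefficient divides through.\<close>
  also have "\<dots> = (lim (\<lambda>N. q A N i) / (n choose i)) powr l * (lim (\<lambda>N. q B N i) / (n choose i)) powr (1 - l)"
  proof -
    have "real (n choose i) > 0" using i by (simp add: n_def)
    then have "real (n choose i) powr l * real (n choose i) powr (1 - l) = real (n choose i)"
      by (simp flip: powr_add)
    then show ?thesis using nn[OF A] nn[OF B] by (simp add: powr_divide)
  qed
  finally show ?thesis using main[OF A] main[OF B] main[OF C] by simp
qed

section \<open>Polar bodies\<close>

lemma polar_body_compact_convex:
  fixes K :: "'a::euclidean_space set"
  assumes K: "bounded K" "0 \<in> interior K"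
  shows "compact (polar_body K)" "convex (polar_body K)" "0 \<in> interior (polar_body K)"
proof -
  have eq: "polar_body K = (\<Inter>y\<in>K. {x. y \<bullet> x \<le> 1})"
    unfolding polar_body_def by (auto simp: inner_commute)
  obtain r where r: "0 < r" "cball 0 r \<subseteq> K"
    using K(2) unfolding mem_interior_cball by blast
  obtain R where R: "0 < R" "\<And>x. x \<in> K \<Longrightarrow> norm x \<le> R"
    using K(1) by (auto simp: bounded_pos)
  have "closed (polar_body K)"
    unfolding eq by (intro closed_INT ballI closed_halfspace_le)
  moreover have "polar_body K \<subseteq> cball 0 (1 / r)"
  proof
    fix x assume x: "x \<in> polar_body K"
    show "x \<in> cball 0 (1 / r)"
    proof (cases "x = 0")
      case False
      have "(r / norm x) *\<^sub>R x \<in> K" using r False by (intro subsetD[OF r(2)]) simp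
      then have "x \<bullet> ((r / norm x) *\<^sub>R x) \<le> 1" using x unfolding polar_body_def by blast
      then have "r * norm x \<le> 1" using False by (simp add: dot_square_norm power2_eq_square)
      then show ?thesis using r by (simp add: pos_le_divide_eq mult.commute)
    qed (use r in simp)
  qed
  ultimately show "compact (polar_body K)"
    by (meson bounded_cball bounded_subset compact_eq_bounded_closed)
  show "convex (polar_body K)"
    unfolding eq by (intro convex_INT convex_halfspace_le)
  have "cball 0 (1 / R) \<subseteq> polar_body K"
  proof (clarsimp simp: polar_body_def)
    fix x y :: 'a assume x: "norm x \<le> 1 / R" and y: "y \<in> K"
    have "x \<bullet> y \<le> norm x * norm y" by (rule norm_cauchy_schwarz)
    also have "\<dots> \<le> 1 / R * R" using x R(2)[OF y] R(1) by (intro mult_mono) auto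
    finally show "x \<bullet> y \<le> 1" using R by simp
  qed
  then show "0 \<in> interior (polar_body K)"
    unfolding mem_interior_cball using R by (intro exI[of _ "1 / R"]) auto
qed

section \<open>Support functions and means\<close>

lemma support_function_upper:
  assumes "bounded K" "y \<in> K"
  shows "u \<bullet> y \<le> support_function K u"
proof -
  have "bdd_above ((\<lambda>y. u \<bullet> y) ` K)"
    using assms(1) by (intro bounded_imp_bdd_above bounded_linear_image bounded_linear_inner_right)
  then show ?thesis
    unfolding support_function_def using assms(2) by (intro cSUP_upper)
qed

lemma support_function_bounds:
  fixes K :: "'a::euclidean_space set"
  assumes K: "bounded K" "0 \<in> interior K"
  obtains r R where "0 < r" "0 < R" "\<And>u. norm u = 1 \<Longrightarrow> r \<le> support_function K u"
    "\<And>u. norm u = 1 \<Longrightarrow> support_function K u \<le> R"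
proof -
  obtain r where r: "0 < r" "cball 0 r \<subseteq> K"
    using K(2) unfolding mem_interior_cball by blast
  obtain R where R: "0 < R" "\<And>x. x \<in> K \<Longrightarrow> norm x \<le> R"
    using K(1) by (auto simp: bounded_pos)
  show ?thesis
  proof (rule that[OF r(1) R(1)])
    fix u :: 'a assume u: "norm u = 1"
    have "r *\<^sub>R u \<in> K" using r u by (intro subsetD[OF r(2)]) simp
    then have "u \<bullet> (r *\<^sub>R u) \<le> support_function K u" by (rule support_function_upper[OF K(1)])
    then show "r \<le> support_function K u" using u by (simp add: dot_square_norm)
    have "K \<noteq> {}" using K(2) interior_subset by blast
    moreover have "u \<bullet> y \<le> R" if "y \<in> K" for y
      using norm_cauchy_schwarz[of u y] R(2)[OF that] u by simp
    ultimately show "support_function K u \<le> R"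
      unfolding support_function_def by (rule cSUP_least)
  qed
qed

text \<open>Young's inequality for the powers with exponent \<open>p\<close>, followed by the
  increasing power \<open>1 / p\<close>.\<close>

lemma geometric_le_power_mean:
  fixes a b :: real
  assumes "0 < a" "0 < b" "0 < p" "0 < l" "l < 1"
  shows "a powr l * b powr (1 - l) \<le> (l * a powr p + (1 - l) * b powr p) powr (1 / p)"
proof -
  have "(a powr p) powr l * (b powr p) powr (1 - l) \<le> l * a powr p + (1 - l) * b powr p"
    using assms by (intro Youngs_inequality_0) auto
  then have "((a powr p) powr l * (b powr p) powr (1 - l)) powr (1 / p)
      \<le> (l * a powr p + (1 - l) * b powr p) powr (1 / p)"
    using assms by (intro powr_mono2) auto
  moreover have "((a powr p) powr l * (b powr p) powr (1 - l)) powr (1 / p) = a powr l * b powr (1 - l)"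
    using assms by (simp add: powr_mult powr_powr)
  ultimately show ?thesis by simp
qed

text \<open>A small cube around \<open>x\<close> lies in the hull of \<open>D\<close>, and by
  Caratheodory each of its finitely many vertices requires only finitely many points of
  \<open>D\<close>. Catching the whole cube, and not just \<open>x\<close>, keeps \<open>x\<close>
  in the interior.\<close>

lemma finite_subset_interior_convex_hull:
  fixes D :: "'a::euclidean_space set"
  assumes "x \<in> interior (convex hull D)"
  obtains F where "finite F" "F \<subseteq> D" "x \<in> interior (convex hull F)"
proof -
  obtain e where e: "0 < e" "cball x e \<subseteq> convex hull D"
    using assms unfolding mem_interior_cball by blast
  \<comment> \<open>A vector with coordinates of size at most \<open>d\<close> has norm at most
    \<open>DIM('a)\<close> times \<open>d\<close>, which is \<open>e\<close>.\<close>
  define d where "d = e / (real DIM('a))"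
  have d: "0 < d" using e by (simp add: d_def)
  obtain S where S: "finite S" "cbox (x - (\<Sum>i\<in>Basis. d *\<^sub>R i)) (x + (\<Sum>i\<in>Basis. d *\<^sub>R i)) = convex hull S"
    using cube_convex_hull[OF d, of x] by blast
  have "S \<subseteq> convex hull D"
  proof
    fix y assume "y \<in> S"
    then have "y \<in> cbox (x - (\<Sum>i\<in>Basis. d *\<^sub>R i)) (x + (\<Sum>i\<in>Basis. d *\<^sub>R i))"
      unfolding S(2) by (rule hull_inc)
    then have "\<bar>(y - x) \<bullet> i\<bar> \<le> d" if "i \<in> Basis" for i
      using that by (auto simp: mem_box inner_diff_left inner_add_left inner_sum_left_Basis abs_le_iff algebra_simps)
    then have "norm (y - x) \<le> real DIM('a) * d"
      using norm_le_l1[of "y - x"] sum_bounded_above[of Basis "\<lambda>i. \<bar>(y - x) \<bullet> i\<bar>" d] by fastforce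
    then show "y \<in> convex hull D"
      using e by (intro subsetD[OF e(2)]) (auto simp: d_def dist_norm norm_minus_commute)
  qed
  then have "\<forall>y\<in>S. \<exists>F. finite F \<and> F \<subseteq> D \<and> y \<in> convex hull F"
    unfolding caratheodory[of D] by blast
  then obtain F where F: "\<And>y. y \<in> S \<Longrightarrow> finite (F y) \<and> F y \<subseteq> D \<and> y \<in> convex hull (F y)"
    by metis
  show ?thesis
  proof (rule that[of "\<Union>y\<in>S. F y"])
    have "convex hull S \<subseteq> convex hull (\<Union>y\<in>S. F y)"
    proof (intro hull_minimal subsetI)
      fix y assume y: "y \<in> S"
      then have "convex hull (F y) \<subseteq> convex hull (\<Union>y\<in>S. F y)" by (intro hull_mono) auto
      then show "y \<in> convex hull (\<Union>y\<in>S. F y)" using F[OF y] by blast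
    qed simp
    then have "box (x - (\<Sum>i\<in>Basis. d *\<^sub>R i)) (x + (\<Sum>i\<in>Basis. d *\<^sub>R i)) \<subseteq> convex hull (\<Union>y\<in>S. F y)"
      unfolding S(2)[symmetric] using box_subset_cbox by blast
    moreover have "x \<in> box (x - (\<Sum>i\<in>Basis. d *\<^sub>R i)) (x + (\<Sum>i\<in>Basis. d *\<^sub>R i))"
      using d by (auto simp: mem_box inner_diff_left inner_add_left inner_sum_left_Basis)
    ultimately show "x \<in> interior (convex hull (\<Union>y\<in>S. F y))"
      by (meson interiorI open_box)
  qed (use S F in auto)
qed

text \<open>The interiors of hulls of finite subsets of \<open>D\<close> form an open cover of
  \<open>C\<close>; a finite subcover involves only finitely many points.\<close>

lemma compact_subset_polytope:
  fixes D C :: "'a::euclidean_space set"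
  assumes C: "compact C" "C \<subseteq> interior (convex hull D)"
  obtains F where "finite F" "F \<subseteq> D" "C \<subseteq> convex hull F"
proof -
  have "\<forall>x\<in>C. \<exists>F. finite F \<and> F \<subseteq> D \<and> x \<in> interior (convex hull F)"
    using C(2) finite_subset_interior_convex_hull by (metis subsetD)
  then obtain F where F: "\<And>x. x \<in> C \<Longrightarrow> finite (F x) \<and> F x \<subseteq> D \<and> x \<in> interior (convex hull (F x))"
    by metis
  have "C \<subseteq> (\<Union>x\<in>C. interior (convex hull (F x)))" using F by blast
  then obtain X where X: "X \<subseteq> C" "finite X" "C \<subseteq> (\<Union>x\<in>X. interior (convex hull (F x)))"
    using compactE_image[OF C(1), of C "\<lambda>x. interior (convex hull (F x))"] by auto
  show ?thesis
  proof (rule that[of "\<Union>x\<in>X. F x"])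
    show "C \<subseteq> convex hull (\<Union>x\<in>X. F x)"
    proof
      fix y assume "y \<in> C"
      then obtain x where x: "x \<in> X" "y \<in> convex hull (F x)"
        using X(3) interior_subset by blast
      have "convex hull (F x) \<subseteq> convex hull (\<Union>x\<in>X. F x)" using x(1) by (intro hull_mono) auto
      then show "y \<in> convex hull (\<Union>x\<in>X. F x)" using x by blast
    qed
  qed (use X F in auto)
qed

text \<open>For compact \<open>A\<close> and \<open>B\<close> star-shaped about 0, the set in the
  hypothesis is the one whose radial function is the geometric mean of theirs. Shrinking
  \<open>C\<close> by \<open>\<kappa>\<close> moves it from the closure of the hull into the
  interior, where finitely many points suffice; enlarging these by \<open>1 / \<kappa>\<close>
  undoes the shrinking.\<close>

lemma radial_mean_coverI:
  fixes A B C :: "'a::euclidean_space set"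
  assumes C: "compact C" and l: "0 < l" "l < 1"
    and A: "0 \<in> interior A" and B: "0 \<in> interior B"
    and sub: "C \<subseteq> closure (convex hull {x. \<exists>\<alpha> \<beta>. 0 < \<alpha> \<and> 0 < \<beta> \<and> \<alpha> *\<^sub>R x \<in> A \<and> \<beta> *\<^sub>R x \<in> B
        \<and> 1 \<le> \<alpha> powr l * \<beta> powr (1 - l)})"
  shows "radial_mean_cover l A B C"
  unfolding radial_mean_cover_def
proof (intro allI impI)
  fix \<kappa> :: real assume \<kappa>: "0 < \<kappa>" "\<kappa> < 1"
  define D where "D = {x. \<exists>\<alpha> \<beta>. 0 < \<alpha> \<and> 0 < \<beta> \<and> \<alpha> *\<^sub>R x \<in> A \<and> \<beta> *\<^sub>R x \<in> B
        \<and> 1 \<le> \<alpha> powr l * \<beta> powr (1 - l)}"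
  \<comment> \<open>Common points qualify with both factors equal to 1; this puts a ball around 0
    into the hull.\<close>
  have "A \<inter> B \<subseteq> convex hull D"
    unfolding D_def by (intro subsetI hull_inc CollectI exI[of _ 1]) auto
  then have "0 \<in> interior (convex hull D)"
    using A B interior_mono[of "A \<inter> B" "convex hull D"] by auto
  have scaled: "(\<lambda>x. \<kappa> *\<^sub>R x) ` C \<subseteq> interior (convex hull D)"
  proof
    fix y assume "y \<in> (\<lambda>x. \<kappa> *\<^sub>R x) ` C"
    then obtain x where x: "x \<in> closure (convex hull D)" "y = \<kappa> *\<^sub>R x"
      using sub unfolding D_def by blast
    have "x - (1 - \<kappa>) *\<^sub>R (x - 0) \<in> interior (convex hull D)"
      using \<kappa> x(1) \<open>0 \<in> interior (convex hull D)\<close>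
      by (intro mem_interior_closure_convex_shrink) auto
    then show "y \<in> interior (convex hull D)" by (simp add: x(2) scaleR_diff_left)
  qed
  obtain F where F: "finite F" "F \<subseteq> D" "(\<lambda>x. \<kappa> *\<^sub>R x) ` C \<subseteq> convex hull F"
    using compact_subset_polytope[OF compact_scaling[OF C] scaled] by metis
  have "\<forall>x\<in>F. \<exists>\<alpha> \<beta>. 0 < \<alpha> \<and> 0 < \<beta> \<and> \<alpha> *\<^sub>R x \<in> A \<and> \<beta> *\<^sub>R x \<in> B \<and> 1 \<le> \<alpha> powr l * \<beta> powr (1 - l)"
    using F(2) unfolding D_def by blast
  then obtain a b where ab: "\<And>x. x \<in> F \<Longrightarrow> 0 < a x \<and> 0 < b x \<and> a x *\<^sub>R x \<in> A \<and> b x *\<^sub>R x \<in> B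
      \<and> 1 \<le> a x powr l * b x powr (1 - l)"
    by metis
  define P where "P = (\<lambda>x. (1 / \<kappa>) *\<^sub>R x) ` F"
  \<comment> \<open>Because \<open>p\<close> is \<open>1 / \<kappa>\<close> times a point of
    \<open>F\<close>, both factors shrink by \<open>\<kappa>\<close>. As the exponents sum to 1,
    their weighted product shrinks by exactly \<open>\<kappa>\<close>.\<close>
  define \<alpha> where "\<alpha> p = \<kappa> * a (\<kappa> *\<^sub>R p)" for p
  define \<beta> where "\<beta> p = \<kappa> * b (\<kappa> *\<^sub>R p)" for p
  show "\<exists>P \<alpha> \<beta>. finite P \<and>
     (\<forall>x\<in>C. \<exists>s. (\<forall>p\<in>P. 0 \<le> s p) \<and> (\<Sum>p\<in>P. s p) \<le> 1 \<and> x = (\<Sum>p\<in>P. s p *\<^sub>R p)) \<and>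
     (\<forall>p\<in>P. 0 < \<alpha> p \<and> \<alpha> p *\<^sub>R p \<in> A \<and> 0 < \<beta> p \<and> \<beta> p *\<^sub>R p \<in> B
        \<and> \<kappa> \<le> \<alpha> p powr l * \<beta> p powr (1 - l))"
  proof (rule exI[of _ P], rule exI[of _ \<alpha>], rule exI[of _ \<beta>], intro conjI ballI)
    show "finite P" using F(1) by (simp add: P_def)
  next
    fix x assume "x \<in> C"
    then have "\<kappa> *\<^sub>R x \<in> convex hull F" using F(3) by blast
    then obtain u where u: "\<forall>x\<in>F. 0 \<le> u x" "sum u F = 1" "(\<Sum>y\<in>F. u y *\<^sub>R y) = \<kappa> *\<^sub>R x"
      unfolding convex_hull_finite[OF F(1)] by blast
    have inj: "inj_on (\<lambda>x. (1 / \<kappa>) *\<^sub>R x) F" using \<kappa> by (auto simp: inj_on_def)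
    show "\<exists>s. (\<forall>p\<in>P. 0 \<le> s p) \<and> (\<Sum>p\<in>P. s p) \<le> 1 \<and> x = (\<Sum>p\<in>P. s p *\<^sub>R p)"
    proof (intro exI[of _ "\<lambda>p. u (\<kappa> *\<^sub>R p)"] conjI)
      show "\<forall>p\<in>P. 0 \<le> u (\<kappa> *\<^sub>R p)" using u(1) \<kappa> by (auto simp: P_def)
      show "(\<Sum>p\<in>P. u (\<kappa> *\<^sub>R p)) \<le> 1"
        unfolding P_def using inj \<kappa> u(2) by (simp add: sum.reindex)
      have "(\<Sum>p\<in>P. u (\<kappa> *\<^sub>R p) *\<^sub>R p) = (1 / \<kappa>) *\<^sub>R (\<Sum>y\<in>F. u y *\<^sub>R y)"
        unfolding P_def using inj \<kappa> by (simp add: sum.reindex scaleR_sum_right mult.commute)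
      then show "x = (\<Sum>p\<in>P. u (\<kappa> *\<^sub>R p) *\<^sub>R p)" unfolding u(3) using \<kappa> by simp
    qed
  next
    fix p assume "p \<in> P"
    then have p: "\<kappa> *\<^sub>R p \<in> F" using \<kappa> by (auto simp: P_def)
    note abp = ab[OF p]
    show "0 < \<alpha> p" "0 < \<beta> p" using abp \<kappa> by (auto simp: \<alpha>_def \<beta>_def)
    show "\<alpha> p *\<^sub>R p \<in> A" "\<beta> p *\<^sub>R p \<in> B" using abp by (auto simp: \<alpha>_def \<beta>_def mult.commute)
    have "\<kappa> * 1 \<le> \<kappa> * (a (\<kappa> *\<^sub>R p) powr l * b (\<kappa> *\<^sub>R p) powr (1 - l))"
      using abp \<kappa> by (intro mult_left_mono) auto
    also have "\<dots> = \<kappa> powr (l + (1 - l)) * (a (\<kappa> *\<^sub>R p) powr l * b (\<kappa> *\<^sub>R p) powr (1 - l))"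
      using \<kappa> by simp
    also have "\<dots> = \<alpha> p powr l * \<beta> p powr (1 - l)"
      using abp \<kappa> unfolding powr_add by (simp add: \<alpha>_def \<beta>_def powr_mult)
    finally show "\<kappa> \<le> \<alpha> p powr l * \<beta> p powr (1 - l)" by simp
  qed
qed

theorem corollary6p5:
  fixes K L :: "(real ^ 'n) set" and i :: nat and p l :: real
  assumes "convex_body K" and "0 \<in> interior K"
    and "convex_body L" and "0 \<in> interior L"
    and "i \<in> {1..CARD('n) - 1}"
    and "p \<ge> 0"
    and "0 < l" and "l < 1"
  shows "quermassintegral i (polar_body (Lp_combination p l K L))
           \<le> quermassintegral i (polar_body K) powr l
             * quermassintegral i (polar_body L) powr (1 - l)"
proof -
  have K: "bounded K" and L: "bounded L"
    using assms(1,3) by (auto simp: convex_body_def compact_imp_bounded)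
  define h where "h = support_function K"
  define k where "k = support_function L"
  define f where "f u = (if p = 0 then h u powr l * k u powr (1 - l)
      else (l * h u powr p + (1 - l) * k u powr p) powr (1 / p))" for u
  obtain r1 R1 where h: "0 < r1" "0 < R1" "\<And>u. norm u = 1 \<Longrightarrow> r1 \<le> h u" "\<And>u. norm u = 1 \<Longrightarrow> h u \<le> R1"
    using support_function_bounds[OF K assms(2)] unfolding h_def by metis
  obtain r2 R2 where k: "0 < r2" "0 < R2" "\<And>u. norm u = 1 \<Longrightarrow> r2 \<le> k u" "\<And>u. norm u = 1 \<Longrightarrow> k u \<le> R2"
    using support_function_bounds[OF L assms(4)] unfolding k_def by metis
  have hk: "0 < h u" "0 < k u" if "norm u = 1" for u
    using h(1) h(3)[OF that] k(1) k(3)[OF that] by auto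
  define M where "M = Lp_combination p l K L"
  have M: "M = {x. \<forall>u\<in>sphere 0 1. x \<bullet> u \<le> f u}"
    by (simp add: M_def Lp_combination_def f_def h_def k_def)
  \<comment> \<open>This bound carries the comparison between different \<open>p\<close>; beyond it,
    only an upper bound for \<open>f\<close> is used.\<close>
  have fgeo: "h u powr l * k u powr (1 - l) \<le> f u" if "norm u = 1" for u
    using geometric_le_power_mean[of "h u" "k u" p l] hk[OF that] assms(6-8) by (simp add: f_def)
  define r where "r = r1 powr l * r2 powr (1 - l)"
  have r: "0 < r" using h(1) k(1) by (simp add: r_def)
  have fr: "r \<le> f u" if "norm u = 1" for u
  proof -
    have "r \<le> h u powr l * k u powr (1 - l)"
      unfolding r_def using h(1) h(3)[OF that] k(1) k(3)[OF that] assms(7,8)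
      by (intro mult_mono powr_mono2) auto
    then show ?thesis using fgeo[OF that] by linarith
  qed
  define R where "R = (if p = 0 then R1 powr l * R2 powr (1 - l)
      else (l * R1 powr p + (1 - l) * R2 powr p) powr (1 / p))"
  have fR: "f u \<le> R" if "norm u = 1" for u
    unfolding f_def R_def using hk[OF that] h(4)[OF that] k(4)[OF that] assms(6-8)
    by (auto intro!: mult_mono powr_mono2 add_mono mult_left_mono)
  have M_bounded: "bounded M"
  proof (rule boundedI)
    fix x assume x: "x \<in> M"
    show "norm x \<le> max R 0"
    proof (cases "x = 0")
      case False
      then have u: "norm (x /\<^sub>R norm x) = 1" by simp
      then have "x /\<^sub>R norm x \<in> sphere 0 1" by simp
      then have "x \<bullet> (x /\<^sub>R norm x) \<le> f (x /\<^sub>R norm x)" using x unfolding M by blast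
      moreover have "x \<bullet> (x /\<^sub>R norm x) = norm x"
        using False by (simp add: dot_square_norm power2_eq_square)
      ultimately have "norm x \<le> R"
        using fR[OF u] by linarith
      then show ?thesis by simp
    qed simp
  qed
  have M_int: "0 \<in> interior M"
  proof -
    have "cball 0 r \<subseteq> M"
    proof (clarsimp simp: M)
      fix x u :: "real^'n" assume "norm x \<le> r" "norm u = 1"
      then show "x \<bullet> u \<le> f u"
        using norm_cauchy_schwarz[of x u] fr[of u] by simp
    qed
    then show ?thesis unfolding mem_interior_cball using r by blast
  qed
  note C = polar_body_compact_convex[OF M_bounded M_int]
  note A = polar_body_compact_convex[OF K assms(2)]
  note B = polar_body_compact_convex[OF L assms(4)]
  have polarK: "(1 / h u) *\<^sub>R u \<in> polar_body K" if "norm u = 1" for u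
  proof (clarsimp simp: polar_body_def)
    fix y assume "y \<in> K"
    then have "u \<bullet> y \<le> h u" unfolding h_def by (rule support_function_upper[OF K])
    then show "u \<bullet> y / h u \<le> 1" using hk[OF that] by simp
  qed
  have polarL: "(1 / k u) *\<^sub>R u \<in> polar_body L" if "norm u = 1" for u
  proof (clarsimp simp: polar_body_def)
    fix y assume "y \<in> L"
    then have "u \<bullet> y \<le> k u" unfolding k_def by (rule support_function_upper[OF L])
    then show "u \<bullet> y / k u \<le> 1" using hk[OF that] by simp
  qed
  define D where "D = {x. \<exists>\<alpha> \<beta>. 0 < \<alpha> \<and> 0 < \<beta> \<and> \<alpha> *\<^sub>R x \<in> polar_body K \<and> \<beta> *\<^sub>R x \<in> polar_body L
        \<and> 1 \<le> \<alpha> powr l * \<beta> powr (1 - l)}"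
  \<comment> \<open>By duality: a point of the polar outside the closed hull is cut off by a
    hyperplane, whose normal, suitably scaled, is a point of \<open>M\<close> that violates the
    polar inequality.\<close>
  have "polar_body M \<subseteq> closure (convex hull D)"
  proof (rule subsetI, rule ccontr)
    fix x assume x: "x \<in> polar_body M" "x \<notin> closure (convex hull D)"
    have "0 \<in> D"
      unfolding D_def using A(3) B(3) interior_subset by (intro CollectI exI[of _ 1]) auto
    then have 0: "0 \<in> closure (convex hull D)"
      using hull_inc closure_subset by (metis subsetD)
    obtain a b where ab: "a \<bullet> x < b" "\<forall>z\<in>closure (convex hull D). b < a \<bullet> z"
      using separating_hyperplane_closed_point[of "closure (convex hull D)" x] x(2) by auto
    have b: "b < 0" using ab(2) 0 by force
    \<comment> \<open>Since 0 lies in the hull, \<open>b\<close> is negative. Division by it turns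
      \<open>b < a \<bullet> z\<close> into \<open>y \<bullet> z < 1\<close> and
      \<open>a \<bullet> x < b\<close> into \<open>x \<bullet> y > 1\<close>.\<close>
    define y where "y = (1 / b) *\<^sub>R a"
    have "y \<bullet> u \<le> f u" if u: "norm u = 1" for u
    proof -
      define g where "g = h u powr l * k u powr (1 - l)"
      have g: "0 < g" using hk[OF u] by (simp add: g_def)
      \<comment> \<open>The factors \<open>g / h u\<close> and \<open>g / k u\<close> carry this
        point to \<open>u /\<^sub>R h u\<close> and \<open>u /\<^sub>R k u\<close>, which lie in the
        two polars; their weighted product is 1 by the choice of \<open>g\<close>.\<close>
      have "(1 / g) *\<^sub>R u \<in> D"
        unfolding D_def
      proof (rule CollectI, rule exI[of _ "g / h u"], rule exI[of _ "g / k u"], intro conjI)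
        show "0 < g / h u" "0 < g / k u" using g hk[OF u] by auto
        show "(g / h u) *\<^sub>R (1 / g) *\<^sub>R u \<in> polar_body K" "(g / k u) *\<^sub>R (1 / g) *\<^sub>R u \<in> polar_body L"
          using g polarK[OF u] polarL[OF u] by auto
        have "(g / h u) powr l * (g / k u) powr (1 - l) = g powr (l + (1 - l)) / (h u powr l * k u powr (1 - l))"
          unfolding powr_add using g hk[OF u] by (simp add: powr_divide)
        also have "\<dots> = 1" using g by (simp add: g_def[symmetric])
        finally show "1 \<le> (g / h u) powr l * (g / k u) powr (1 - l)" by simp
      qed
      then have "(1 / g) *\<^sub>R u \<in> closure (convex hull D)"
        using hull_inc closure_subset by (metis subsetD)
      then have "b < a \<bullet> ((1 / g) *\<^sub>R u)" using ab(2) by blast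
      then have "b * g < a \<bullet> u" using g by (simp add: pos_less_divide_eq)
      then have "y \<bullet> u \<le> g"
        using b by (simp add: y_def neg_divide_le_eq mult.commute)
      then show ?thesis using fgeo[OF u] by (simp add: g_def)
    qed
    then have "y \<in> M" unfolding M by simp
    then have "x \<bullet> y \<le> 1" using x(1) unfolding polar_body_def by blast
    then have "b \<le> a \<bullet> x"
      using b by (simp add: y_def neg_divide_le_eq inner_commute)
    then show False using ab(1) by simp
  qed
  then have cover: "radial_mean_cover l (polar_body K) (polar_body L) (polar_body M)"
    unfolding D_def using assms(7,8) by (intro radial_mean_coverI C(1) A(3) B(3))
  have "i \<le> CARD('n)" using assms(5) by auto
  then show ?thesis
    using quermassintegral_radial_mean[OF A B C assms(7,8) cover] by (simp add: M_def)
qed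

end
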